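(* Let $k\geq 1$ be an integer with $n=3k+1\geq 10$, and let $$F_n=\sum_{i=0}^{k}x_{3i}x_{3i+1}^2+\sum_{i=1}^{k}x_{3i-2}x_{3i-1}x_{3i+1}\in\mathbb C[x_0,\dots,x_n].$$ Then the variety $\underline{\mathrm{VSP}}(F_n,n+1)$ is reducible.
   Context: Let $T=\mathbb C[y_0,\dots,y_n]$ act on $\mathbb C[x_0,\dots,x_n]$ by differentiation, $y_i=\partial/\partial x_i$; for a form $F$, $\mathrm{Ann}(F)=\{h\in T:h\circ F=0\}$. For $r\in\mathbb N$ let $h_r(e)=\min\{r,\dim T_e\}$ for $e\ge 0$ (the generic Hilbert function of $r$ points in $\mathbb P^n$). The multigraded Hilbert scheme (Haiman–Sturmfels) $\mathrm{Hilb}_T^{h_r}$ parametrizes homogeneous ideals $\mathcal J\subset T$ with $\dim(T/\mathcal J)_e=h_r(e)$ for all $e$. $\mathrm{Slip}_{r,\mathbb P^n}$ is its irreducible component containing the radical ideals of $r$ distinct points in $\mathbb P^n$ having Hilbert function $h_r$ (the closure of the set of such ideals). The border variety of sums of powers of $F$ is $\underline{\mathrm{VSP}}(F,r)=\{\mathcal J\in\mathrm{Slip}_{r,\mathbb P^n}:\mathcal J\subset\mathrm{Ann}(F)\}$. *)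

theory Defs
  imports "HOL-Analysis.Analysis" "HOL-Library.Poly_Mapping" "HOL-Algebra.Ideal"
begin

text \<open>
  Polynomials with complex coefficients are finitely supported functions on exponent vectors, which
  are themselves finitely supported. The variables are indexed by an arbitrary type; polynomials in
  finitely many variables \<open>0, \<dots>, n\<close> form the subring \<open>polys n\<close> of \<^typ>\<open>nat\<close>-indexed polynomials.
  This subring represents both the ring of forms in \<open>x\<^sub>0, \<dots>, x\<^sub>n\<close> and the ring \<open>T\<close> of
  differential operators in \<open>y\<^sub>0, \<dots>, y\<^sub>n\<close>.
\<close>

type_synonym 'v cpoly = "('v \<Rightarrow>\<^sub>0 nat) \<Rightarrow>\<^sub>0 complex"

definition var :: "'v \<Rightarrow> 'v cpoly" where
  "var i = Poly_Mapping.single (Poly_Mapping.single i 1) 1"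

definition cscale :: "complex \<Rightarrow> 'v cpoly \<Rightarrow> 'v cpoly" where
  "cscale c p = Poly_Mapping.single 0 c * p"

definition peval :: "('v \<Rightarrow> complex) \<Rightarrow> 'v cpoly \<Rightarrow> complex" where
  "peval v p = (\<Sum>m\<in>Poly_Mapping.keys p. Poly_Mapping.lookup p m *
     (\<Prod>i\<in>Poly_Mapping.keys m. v i ^ Poly_Mapping.lookup m i))"

global_interpretation cpoly: vector_space "cscale :: complex \<Rightarrow> 'v cpoly \<Rightarrow> 'v cpoly"
  by unfold_locales
    (simp_all add: cscale_def algebra_simps single_add mult_single flip: mult.assoc)

definition polys :: "nat \<Rightarrow> nat cpoly set" where
  "polys n = {p. \<forall>m\<in>Poly_Mapping.keys p. Poly_Mapping.keys m \<subseteq> {..n}}"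

definition poly_ring :: "nat \<Rightarrow> nat cpoly ring" where
  "poly_ring n = \<lparr>carrier = polys n, monoid.mult = (*), one = 1, zero = 0, add = (+)\<rparr>"

lemma polys_closed:
  "0 \<in> polys n" "1 \<in> polys n" "p \<in> polys n \<Longrightarrow> q \<in> polys n \<Longrightarrow> p + q \<in> polys n"
  "p \<in> polys n \<Longrightarrow> - p \<in> polys n" "p \<in> polys n \<Longrightarrow> q \<in> polys n \<Longrightarrow> p * q \<in> polys n"
proof -
  show "0 \<in> polys n" "1 \<in> polys n" by (auto simp: polys_def)
  show "p \<in> polys n \<Longrightarrow> q \<in> polys n \<Longrightarrow> p + q \<in> polys n"
    using Poly_Mapping.keys_add[of p q] unfolding polys_def by blast
  show "p \<in> polys n \<Longrightarrow> - p \<in> polys n" by (auto simp: polys_def)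
  assume p: "p \<in> polys n" and q: "q \<in> polys n"
  show "p * q \<in> polys n" unfolding polys_def
  proof safe
    fix m i assume "m \<in> Poly_Mapping.keys (p*q)" and i: "i \<in> Poly_Mapping.keys m"
    then obtain a b where "a \<in> Poly_Mapping.keys p" "b \<in> Poly_Mapping.keys q" "m = a + b"
      using keys_mult[of p q] by auto
    then show "i \<le> n" using i p q Poly_Mapping.keys_add[of a b] unfolding polys_def by blast
  qed
qed

lemma poly_ring_cring: "cring (poly_ring n)"
proof (rule cringI)
  show "abelian_group (poly_ring n)"
  proof (rule abelian_groupI)
    fix x assume "x \<in> carrier (poly_ring n)"
    then show "\<exists>y\<in>carrier (poly_ring n). y \<oplus>\<^bsub>poly_ring n\<^esub> x = \<zero>\<^bsub>poly_ring n\<^esub>"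
      by (intro bexI[of _ "- x"]) (auto simp: poly_ring_def polys_closed)
  qed (auto simp: poly_ring_def polys_closed algebra_simps)
  show "Group.comm_monoid (poly_ring n)"
    by (rule comm_monoidI) (auto simp: poly_ring_def polys_closed algebra_simps)
qed (auto simp: poly_ring_def algebra_simps)

definition mon_degree :: "('v \<Rightarrow>\<^sub>0 nat) \<Rightarrow> nat" where
  "mon_degree m = (\<Sum>i\<in>Poly_Mapping.keys m. Poly_Mapping.lookup m i)"

definition hom_component :: "nat \<Rightarrow> 'v cpoly \<Rightarrow> 'v cpoly" where
  "hom_component e p = (\<Sum>m\<in>{m \<in> Poly_Mapping.keys p. mon_degree m = e}.
     Poly_Mapping.single m (Poly_Mapping.lookup p m))"

definition graded_part :: "'v cpoly set \<Rightarrow> nat \<Rightarrow> 'v cpoly set" where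
  "graded_part J e = {p \<in> J. \<forall>m\<in>Poly_Mapping.keys p. mon_degree m = e}"

definition homogeneous_ideal :: "nat \<Rightarrow> nat cpoly set \<Rightarrow> bool" where
  "homogeneous_ideal n J \<longleftrightarrow> ideal J (poly_ring n) \<and> (\<forall>p\<in>J. \<forall>e. hom_component e p \<in> J)"


text \<open>The Hilbert function \<open>dim (T/J)\<^sub>e\<close> of the quotient by a homogeneous ideal \<open>J \<subseteq> T\<close>, computed as
  \<open>dim T\<^sub>e - dim J\<^sub>e\<close>; the subtraction does not truncate because \<open>J\<^sub>e \<subseteq> T\<^sub>e\<close> and \<open>dim T\<^sub>e < \<infinity>\<close>.\<close>

definition hilbert_function :: "nat \<Rightarrow> nat cpoly set \<Rightarrow> nat \<Rightarrow> nat" where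
  "hilbert_function n J e = cpoly.dim (graded_part (polys n) e) - cpoly.dim (graded_part J e)"

definition generic_hf :: "nat \<Rightarrow> nat \<Rightarrow> nat \<Rightarrow> nat" where
  "generic_hf n r e = min r (cpoly.dim (graded_part (polys n) e))"

text \<open>The closed points of the multigraded Hilbert scheme for the function \<open>h\<^sub>r\<close>.\<close>

definition Hilb :: "nat \<Rightarrow> nat \<Rightarrow> nat cpoly set set" where
  "Hilb n r = {J. homogeneous_ideal n J \<and> (\<forall>e. hilbert_function n J e = generic_hf n r e)}"

text \<open>
  The Zariski topology on \<^const>\<open>Hilb\<close>. The map \<open>J \<mapsto> (J\<^sub>e)\<^sub>e\<close> embeds the Hilbert scheme as a closed
  subscheme of a product of Grassmannians \<open>Gr(m\<^sub>e, T\<^sub>e)\<close>, where \<open>e\<close> ranges over a suitable finite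
  set of degrees. Enlarging this finite set gives again a closed embedding, hence the same topology;
  so one may use polynomial conditions involving any finite number of degrees.

  The Grassmannian \<open>Gr(m, V)\<close> is the quotient by \<open>GL\<^sub>m\<close> of the Zariski open set of linearly
  independent \<open>m\<close>-tuples in \<open>V\<^sup>m\<close>, and the quotient map is open. A base of the topology on a product
  of Grassmannians is therefore given by the images of the principal open sets, i.e. by the sets of
  those tuples of subspaces having bases whose coordinates do not annihilate a given polynomial.
  A choice of bases of all \<open>J\<^sub>e\<close> is a \<open>graded_basis\<close>. Its coordinate with index \<open>(e, i, m)\<close> is
  the coefficient of the monomial \<open>m\<close> in the \<open>i\<close>-th basis vector of \<open>J\<^sub>e\<close>. Each polynomial
  \<open>f\<close> in these coordinates involves only finitely many degrees \<open>e\<close>.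
\<close>

definition graded_basis :: "nat cpoly set \<Rightarrow> (nat \<Rightarrow> nat \<Rightarrow> nat cpoly) \<Rightarrow> bool" where
  "graded_basis J B \<longleftrightarrow> (\<forall>e. let m = cpoly.dim (graded_part J e) in
     inj_on (B e) {..<m} \<and> cpoly.independent (B e ` {..<m}) \<and>
     cpoly.span (B e ` {..<m}) = graded_part J e \<and> (\<forall>i\<ge>m. B e i = 0))"

definition basis_coords ::
  "(nat \<Rightarrow> nat \<Rightarrow> nat cpoly) \<Rightarrow> nat \<times> nat \<times> (nat \<Rightarrow>\<^sub>0 nat) \<Rightarrow> complex" where
  "basis_coords B = (\<lambda>(e, i, m). Poly_Mapping.lookup (B e i) m)"

definition Hilb_basic_open ::
  "nat \<Rightarrow> nat \<Rightarrow> (nat \<times> nat \<times> (nat \<Rightarrow>\<^sub>0 nat)) cpoly \<Rightarrow> nat cpoly set set" where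
  "Hilb_basic_open n r f = {J \<in> Hilb n r. \<exists>B. graded_basis J B \<and> peval (basis_coords B) f \<noteq> 0}"

definition Hilb_top :: "nat \<Rightarrow> nat \<Rightarrow> nat cpoly set topology" where
  "Hilb_top n r = topology_generated_by (range (Hilb_basic_open n r))"


lemma cscale_lookup: "Poly_Mapping.lookup (cscale c p) m = c * Poly_Mapping.lookup p m"
proof -
  have "cscale c p = Poly_Mapping.map ((*) c) p" unfolding cscale_def
    by (rule Poly_Mapping.mult_map_scale_conv_mult[symmetric])
  then show ?thesis by (simp add: Poly_Mapping.map.rep_eq when_def)
qed

lemma finite_exps: "finite {m::nat \<Rightarrow>\<^sub>0 nat. Poly_Mapping.keys m \<subseteq> {..n} \<and> mon_degree m = e}" (is "finite ?S")
proof -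
  have "Poly_Mapping.lookup ` ?S \<subseteq> {f. \<forall>i. (i \<in> {..n} \<longrightarrow> f i \<in> {..e}) \<and> (i \<notin> {..n} \<longrightarrow> f i = 0)}"
  proof (intro image_subsetI)
    fix m assume m: "m \<in> ?S"
    have "Poly_Mapping.lookup m i \<le> mon_degree m" for i
      by (cases "i \<in> Poly_Mapping.keys m")
        (auto simp: mon_degree_def in_keys_iff intro: member_le_sum)
    moreover have "i > n \<Longrightarrow> Poly_Mapping.lookup m i = 0" for i
      using m by (metis (no_types, lifting) atMost_iff in_keys_iff mem_Collect_eq not_le subsetD)
    ultimately show "Poly_Mapping.lookup m \<in>
        {f. \<forall>i. (i \<in> {..n} \<longrightarrow> f i \<in> {..e}) \<and> (i \<notin> {..n} \<longrightarrow> f i = 0)}"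
      using m by auto
  qed
  moreover have "finite {f::nat\<Rightarrow>nat. \<forall>i. (i \<in> {..n} \<longrightarrow> f i \<in> {..e}) \<and> (i \<notin> {..n} \<longrightarrow> f i = 0)}"
    by (rule finite_set_of_finite_funs) auto
  ultimately have "finite (Poly_Mapping.lookup ` ?S)" by (rule finite_subset)
  then show ?thesis by (rule finite_imageD) (auto simp: inj_on_def poly_mapping_eqI)
qed

lemma fin_span: "\<exists>S. finite S \<and> graded_part (polys n) e \<subseteq> cpoly.span S"
proof (intro exI conjI)
  let ?M = "{m::nat \<Rightarrow>\<^sub>0 nat. Poly_Mapping.keys m \<subseteq> {..n} \<and> mon_degree m = e}"
  show "finite ((\<lambda>m. Poly_Mapping.single m (1::complex)) ` ?M)" using finite_exps by auto
  show "graded_part (polys n) e \<subseteq> cpoly.span ((\<lambda>m. Poly_Mapping.single m (1::complex)) ` ?M)"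
  proof
    fix p assume p: "p \<in> graded_part (polys n) e"
    have "p = (\<Sum>m\<in>Poly_Mapping.keys p. cscale (Poly_Mapping.lookup p m) (Poly_Mapping.single m 1))"
      by (rule poly_mapping_eqI) (auto simp: lookup_sum cscale_lookup lookup_single when_def in_keys_iff sum.delta if_distrib cong: if_cong)
    also have "\<dots> \<in> cpoly.span ((\<lambda>m. Poly_Mapping.single m (1::complex)) ` ?M)"
      using p by (intro cpoly.span_sum cpoly.span_scale cpoly.span_base) (auto simp: graded_part_def polys_def)
    finally show "p \<in> cpoly.span ((\<lambda>m. Poly_Mapping.single m (1::complex)) ` ?M)" .
  qed
qed

lemma topspace_Hilb: "topspace (Hilb_top n r) = Hilb n r"
proof -
  have "\<exists>B. graded_basis J B" if J: "J \<in> Hilb n r" for J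
  proof -
    interpret ideal J "poly_ring n" using J by (simp add: Hilb_def homogeneous_ideal_def)
    have sub: "J \<subseteq> polys n" using a_subset by (simp add: poly_ring_def)
    have J0: "0 \<in> J" using additive_subgroup.zero_closed[OF additive_subgroup_axioms] by (simp add: poly_ring_def)
    have Ja: "p \<in> J \<Longrightarrow> q \<in> J \<Longrightarrow> p + q \<in> J" for p q 
      using additive_subgroup.a_closed[OF additive_subgroup_axioms] by (simp add: poly_ring_def)
    have Js: "p \<in> J \<Longrightarrow> cscale c p \<in> J" for p c
      using I_l_closed[of p "Poly_Mapping.single 0 c"] by (auto simp: poly_ring_def cscale_def polys_def)
    have "\<exists>b. let m = cpoly.dim (graded_part J e) in
     inj_on b {..<m} \<and> cpoly.independent (b ` {..<m}) \<and>
     cpoly.span (b ` {..<m}) = graded_part J e \<and> (\<forall>i\<ge>m. b i = 0)" for e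
    proof -
      have ss: "cpoly.subspace (graded_part J e)"
        unfolding cpoly.subspace_def graded_part_def
        using J0 Ja Js by (auto simp: in_keys_iff cscale_lookup lookup_add)
      obtain B where B: "B \<subseteq> graded_part J e" "cpoly.independent B" "graded_part J e \<subseteq> cpoly.span B" "card B = cpoly.dim (graded_part J e)"
        using cpoly.basis_exists by blast
      obtain S where "finite S" "graded_part (polys n) e \<subseteq> cpoly.span S" using fin_span by blast
      moreover have "graded_part J e \<subseteq> graded_part (polys n) e" using sub by (auto simp: graded_part_def)
      ultimately have fB: "finite B" using cpoly.independent_span_bound[of S B] B by (meson subset_trans)
      have sp: "cpoly.span B = graded_part J e" using B ss by (meson cpoly.span_minimal subset_antisym)
      obtain h where h: "bij_betw h {..<card B} B"
        using fB by (metis ex_bij_betw_nat_finite atLeast0LessThan)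
      let ?b = "\<lambda>i. if i < card B then h i else 0"
      have b: "?b ` {..<card B} = B" "inj_on ?b {..<card B}"
        using h by (auto simp: bij_betw_def inj_on_def)
      show ?thesis
        unfolding Let_def B(4)[symmetric] by (rule exI[of _ ?b]) (use b B(2) sp in simp)
    qed
    then show ?thesis unfolding graded_basis_def by (metis (no_types))
  qed
  then have "Hilb_basic_open n r 1 = Hilb n r"
    by (auto simp: Hilb_basic_open_def peval_def)
  moreover have "Hilb_basic_open n r f \<subseteq> Hilb n r" for f by (auto simp: Hilb_basic_open_def)
  ultimately show ?thesis unfolding Hilb_top_def topology_generated_by_topspace by blast
qed


text \<open>Points of \<open>\<P>\<^sup>n\<close> are the lines through the origin of \<open>\<complex>\<^sup>n\<^sup>+\<^sup>1\<close>, the space of all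
  sequences vanishing beyond the index \<open>n\<close>.\<close>

definition proj_space :: "nat \<Rightarrow> (nat \<Rightarrow> complex) set set" where
  "proj_space n = {L. \<exists>v. (\<forall>i>n. v i = 0) \<and> v \<noteq> (\<lambda>_. 0) \<and> L = (\<lambda>c i. c * v i) ` UNIV}"

definition vanishing_ideal :: "nat \<Rightarrow> (nat \<Rightarrow> complex) set set \<Rightarrow> nat cpoly set" where
  "vanishing_ideal n \<Gamma> =
     {p \<in> polys n. \<forall>e. \<forall>L\<in>\<Gamma>. \<forall>v\<in>L. peval v (hom_component e p) = 0}"

definition Slip :: "nat \<Rightarrow> nat \<Rightarrow> nat cpoly set set" where
  "Slip n r = Hilb_top n r closure_of
     {J \<in> Hilb n r. \<exists>\<Gamma>\<subseteq>proj_space n. finite \<Gamma> \<and> card \<Gamma> = r \<and> J = vanishing_ideal n \<Gamma>}"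


definition pdiff :: "'v \<Rightarrow> 'v cpoly \<Rightarrow> 'v cpoly" where
  "pdiff i F = (\<Sum>m\<in>Poly_Mapping.keys F. Poly_Mapping.single (m - Poly_Mapping.single i 1)
     (of_nat (Poly_Mapping.lookup m i) * Poly_Mapping.lookup F m))"

text \<open>The partial derivatives commute, so the order of composition is immaterial.\<close>

definition mon_diff :: "(nat \<Rightarrow>\<^sub>0 nat) \<Rightarrow> nat cpoly \<Rightarrow> nat cpoly" where
  "mon_diff m F = fold (\<lambda>i. pdiff i ^^ Poly_Mapping.lookup m i)
     (sorted_list_of_set (Poly_Mapping.keys m)) F"

definition diff_act :: "nat cpoly \<Rightarrow> nat cpoly \<Rightarrow> nat cpoly" where
  "diff_act h F = (\<Sum>m\<in>Poly_Mapping.keys h. cscale (Poly_Mapping.lookup h m) (mon_diff m F))"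

definition Ann :: "nat \<Rightarrow> nat cpoly \<Rightarrow> nat cpoly set" where
  "Ann n F = {h \<in> polys n. diff_act h F = 0}"

definition border_VSP :: "nat \<Rightarrow> nat cpoly \<Rightarrow> nat \<Rightarrow> nat cpoly set set" where
  "border_VSP n F r = {J \<in> Slip n r. J \<subseteq> Ann n F}"

definition border_VSP_top :: "nat \<Rightarrow> nat cpoly \<Rightarrow> nat \<Rightarrow> nat cpoly set topology" where
  "border_VSP_top n F r = subtopology (Hilb_top n r) (border_VSP n F r)"

definition reducible_space :: "'a topology \<Rightarrow> bool" where
  "reducible_space X \<longleftrightarrow> (\<exists>Z1 Z2. closedin X Z1 \<and> closedin X Z2 \<and>
     Z1 \<noteq> topspace X \<and> Z2 \<noteq> topspace X \<and> Z1 \<union> Z2 = topspace X)"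

definition F_form :: "nat \<Rightarrow> nat cpoly" where
  "F_form k = (\<Sum>i=0..k. var (3*i) * var (3*i+1) ^ 2) +
     (\<Sum>i=1..k. var (3*i-2) * var (3*i-1) * var (3*i+1))"

end

theory Submission
  imports Defs "HOL-Library.Diagonal_Subsequence" "HOL-Computational_Algebra.Polynomial"
    "Jordan_Normal_Form.Determinant"
begin

text \<open>
  Write \<open>b\<^sub>i = x\<^sub>3\<^sub>i\<^sub>+\<^sub>1\<close>, let \<open>\<beta>\<^sub>i\<close> be the dual operator, and let \<open>L\<^sub>i\<close> be the line through the
  coordinate points of \<open>b\<^sub>i\<^sub>-\<^sub>1\<close> and \<open>b\<^sub>i\<close>. Up to scaling the variables, \<open>F\<close> is the tautological
  element \<open>\<Sum> q\<^sup>* \<otimes> q\<close> of the quadrics dual to the quadratic functions on the chain \<open>L\<^sub>1 \<union> \<dots> \<union> L\<^sub>k\<close>,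
  which is a degeneration of rational normal curves \<open>C\<^sub>t\<close> of degree \<open>k\<close>.

  The cubes of any \<open>3k + 2\<close> points of \<open>C\<^sub>t\<close> satisfy a relation with nonzero coefficients, so moving
  these points to first order out of the span of \<open>C\<^sub>t\<close> exhibits the analogue \<open>F\<^sub>t\<close> of \<open>F\<close> as a limit
  of sums of \<open>n + 1\<close> cubes. Letting \<open>t\<close> tend to \<open>0\<close> and using the compactness of the
  Hilbert scheme, every choice of \<open>3k + 2\<close> points on the lines \<open>L\<^sub>i\<close> away from the nodes, with at most
  five on each line, lies on the zero set of some \<open>J\<close> in the border variety.

  Five points on \<open>L\<^sub>1\<close> force \<open>J\<^sub>5\<close> to meet \<open>\<beta>\<^sub>0 \<complex>[\<beta>\<^sub>0, \<beta>\<^sub>1]\<^sub>4\<close> trivially. Three points on each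
  of \<open>L\<^sub>2, \<dots>, L\<^sub>k\<close> and a fourth one on \<open>L\<^sub>k\<close> force \<open>J\<^sub>4\<close> to meet trivially a space \<open>W\<close> spanned by
  \<open>3k - 2\<close> monomials. Both conditions are open, and both are satisfied somewhere. They are incompatible: by the
  Hilbert function, \<open>J\<^sub>4\<close> contains some nonzero \<open>g\<close> in \<open>\<complex>[\<beta>\<^sub>0, \<beta>\<^sub>1]\<^sub>4 \<oplus> W\<close>. As \<open>J\<^sub>2 = Ann(F)\<^sub>2\<close>
  contains \<open>\<beta>\<^sub>0\<beta>\<^sub>j\<close> for \<open>j \<ge> 2\<close>, multiplication by \<open>\<beta>\<^sub>0\<close> kills the second component modulo \<open>J\<close>, so the first
  condition makes the first component of \<open>g\<close> vanish and the second condition gives \<open>g = 0\<close>.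
\<close>

section \<open>Evaluation, degree and homogeneous components\<close>

abbreviation "lk \<equiv> Poly_Mapping.lookup"
abbreviation "sg \<equiv> Poly_Mapping.single"

definition mval :: "('v \<Rightarrow> complex) \<Rightarrow> ('v \<Rightarrow>\<^sub>0 nat) \<Rightarrow> complex" where
  "mval v m = (\<Prod>i\<in>Poly_Mapping.keys m. v i ^ lk m i)"

lemma mval_superset: "finite A \<Longrightarrow> Poly_Mapping.keys m \<subseteq> A \<Longrightarrow> mval v m = (\<Prod>i\<in>A. v i ^ lk m i)"
  unfolding mval_def by (rule prod.mono_neutral_left) (auto simp: in_keys_iff)

lemma mval_add: "mval v (a + b) = mval v a * mval v b"
proof -
  let ?A = "Poly_Mapping.keys a \<union> Poly_Mapping.keys b"
  have "Poly_Mapping.keys (a + b) \<subseteq> ?A" by (rule Poly_Mapping.keys_add)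
  then show ?thesis
    by (simp add: mval_superset[of ?A] lookup_add power_add prod.distrib)
qed

lemma mval_0 [simp]: "mval v 0 = 1" by (simp add: mval_def)

lemma mval_single [simp]: "mval v (sg i e) = v i ^ e"
  by (simp add: mval_superset[of "{i}"])

lemma mon_degree_superset: "finite A \<Longrightarrow> Poly_Mapping.keys m \<subseteq> A \<Longrightarrow> mon_degree m = (\<Sum>i\<in>A. lk m i)"
  unfolding mon_degree_def by (rule sum.mono_neutral_left) (auto simp: in_keys_iff)

lemma mon_degree_add: "mon_degree (a + b) = mon_degree a + mon_degree b"
proof -
  let ?A = "Poly_Mapping.keys a \<union> Poly_Mapping.keys b"
  have "Poly_Mapping.keys (a + b) \<subseteq> ?A" by (rule Poly_Mapping.keys_add)
  then show ?thesis
    by (simp add: mon_degree_superset[of ?A] lookup_add sum.distrib)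
qed

lemma mon_degree_0 [simp]: "mon_degree 0 = 0" by (simp add: mon_degree_def)

lemma mon_degree_single [simp]: "mon_degree (sg i e) = e"
  by (simp add: mon_degree_superset[of "{i}"])

lemma mval_scale: "mval (\<lambda>i. c * v i) m = c ^ mon_degree m * mval v m"
  by (simp add: mval_def mon_degree_def power_mult_distrib prod.distrib power_sum)

lemma peval_superset:
  "finite A \<Longrightarrow> Poly_Mapping.keys p \<subseteq> A \<Longrightarrow> peval v p = (\<Sum>m\<in>A. lk p m * mval v m)"
  unfolding peval_def mval_def by (rule sum.mono_neutral_left) (auto simp: in_keys_iff)

lemma peval_add: "peval v (p + q) = peval v p + peval v q"
proof -
  let ?A = "Poly_Mapping.keys p \<union> Poly_Mapping.keys q"
  have "Poly_Mapping.keys (p + q) \<subseteq> ?A" by (rule Poly_Mapping.keys_add)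
  then show ?thesis
    by (simp add: peval_superset[of ?A] lookup_add sum.distrib algebra_simps)
qed

lemma peval_0 [simp]: "peval v 0 = 0" by (simp add: peval_def)

lemma peval_sum: "peval v (sum f A) = (\<Sum>a\<in>A. peval v (f a))"
  by (induction A rule: infinite_finite_induct) (auto simp: peval_add)

lemma peval_single [simp]: "peval v (sg m c) = c * mval v m"
  by (simp add: peval_superset[of "{m}"])

lemma sum_singles: "p = (\<Sum>m\<in>Poly_Mapping.keys p. sg m (lk p m))"
  by (rule poly_mapping_eqI) (auto simp: lookup_sum lookup_single when_def in_keys_iff)

lemma peval_mult: "peval v (p * q) = peval v p * peval v q"
proof -
  have "peval v (sg a c * q) = c * mval v a * peval v q" for a c
  proof -
    have "sg a c * q = (\<Sum>m\<in>Poly_Mapping.keys q. sg (a + m) (c * lk q m))"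
      by (subst sum_singles[of q]) (simp add: sum_distrib_left mult_single)
    then show ?thesis
      by (simp add: peval_sum mval_add peval_superset[of "Poly_Mapping.keys q" q] sum_distrib_left algebra_simps)
  qed
  then show ?thesis
    by (subst sum_singles[of p])
       (simp add: sum_distrib_right peval_sum peval_superset[of "Poly_Mapping.keys p" p])
qed

lemma peval_1 [simp]: "peval v 1 = 1"
  using peval_single[of v 0 1] by (simp add: Poly_Mapping.single_one)

lemma peval_power: "peval v (p ^ e) = peval v p ^ e"
  by (induction e) (auto simp: peval_mult)

lemma peval_cscale [simp]: "peval v (cscale c p) = c * peval v p"
  by (simp add: cscale_def peval_mult)

lemma peval_var [simp]: "peval v (var i) = v i"
  by (simp add: var_def)

lemma lookup_hom: "lk (hom_component e p) m = (if mon_degree m = e then lk p m else 0)"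
  unfolding hom_component_def
  by (auto simp: lookup_sum lookup_single when_def in_keys_iff)

lemma hom_component_add: "hom_component e (p + q) = hom_component e p + hom_component e q"
  by (rule poly_mapping_eqI) (auto simp: lookup_hom lookup_add)

lemma hom_component_sum: "hom_component e (sum f A) = (\<Sum>a\<in>A. hom_component e (f a))"
  by (rule poly_mapping_eqI) (auto simp: lookup_hom lookup_sum)

lemma hom_component_self: "(\<And>m. lk p m \<noteq> 0 \<Longrightarrow> mon_degree m = e) \<Longrightarrow>
   hom_component d p = (if d = e then p else 0)"
  by (rule poly_mapping_eqI) (auto simp: lookup_hom)

lemma graded_part_iff: "p \<in> graded_part J e \<longleftrightarrow> p \<in> J \<and> (\<forall>m. lk p m \<noteq> 0 \<longrightarrow> mon_degree m = e)"
  by (auto simp: graded_part_def in_keys_iff)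

lemma lookup_single_mult: "lk (sg a c * q) (a + m) = c * lk q m"
  for q :: "('v \<Rightarrow>\<^sub>0 nat) \<Rightarrow>\<^sub>0 complex"
proof -
  have "sg a c * q = (\<Sum>m\<in>Poly_Mapping.keys q. sg (a + m) (c * lk q m))"
    by (subst sum_singles[of q]) (simp add: sum_distrib_left mult_single)
  then show ?thesis by (auto simp: lookup_sum lookup_single when_def in_keys_iff)
qed

lemma lookup_single_mult':
  fixes q :: "('v \<Rightarrow>\<^sub>0 nat) \<Rightarrow>\<^sub>0 complex"
  shows "(\<And>b. m \<noteq> a + b) \<Longrightarrow> lk (sg a c * q) m = 0"
proof -
  assume *: "\<And>b. m \<noteq> a + b"
  have "sg a c * q = (\<Sum>m\<in>Poly_Mapping.keys q. sg (a + m) (c * lk q m))"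
    by (subst sum_singles[of q]) (simp add: sum_distrib_left mult_single)
  moreover have "a + b \<noteq> m" for b using *[of b] by auto
  ultimately show ?thesis by (auto simp: lookup_sum lookup_single when_def in_keys_iff)
qed

section \<open>Homogeneous ideals in the variables \<open>0, ..., n\<close>\<close>

lemma polys_iff: "p \<in> polys n \<longleftrightarrow> (\<forall>m. lk p m \<noteq> 0 \<longrightarrow> Poly_Mapping.keys m \<subseteq> {..n})"
  by (auto simp: polys_def in_keys_iff)

lemma hom_component_polys: "p \<in> polys n \<Longrightarrow> hom_component e p \<in> polys n"
  by (auto simp: polys_iff lookup_hom split: if_splits)

lemma hom_component_mult:
  "hom_component e (p * q) = (\<Sum>i\<le>e. hom_component i p * hom_component (e - i) q)"
proof -
  have s: "hom_component e (sg a c) = (if mon_degree a = e then sg a c else 0)" for e a c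
    by (rule poly_mapping_eqI) (auto simp: lookup_hom lookup_single when_def)
  have 1: "hom_component e (sg a c * sg b d) = (\<Sum>i\<le>e. hom_component i (sg a c) * hom_component (e - i) (sg b d))"
    for a b c d
  proof -
    have "(\<Sum>i\<le>e. hom_component i (sg a c) * hom_component (e - i) (sg b d)) =
       (\<Sum>i\<in>{..e}. if i = mon_degree a then (if mon_degree b = e - mon_degree a then sg a c * sg b d else 0) else 0)"
      by (rule sum.cong) (auto simp: s)
    also have "\<dots> = hom_component e (sg a c * sg b d)"
      by (auto simp: mult_single s mon_degree_add)
    finally show ?thesis ..
  qed
  have 2: "hom_component e (sg a c * q) = (\<Sum>i\<le>e. hom_component i (sg a c) * hom_component (e - i) q)" for a c
  proof -
    have "hom_component e (sg a c * q) = (\<Sum>m\<in>Poly_Mapping.keys q. hom_component e (sg a c * sg m (lk q m)))"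
      by (subst sum_singles[of q]) (simp add: sum_distrib_left hom_component_sum)
    also have "\<dots> = (\<Sum>m\<in>Poly_Mapping.keys q. \<Sum>i\<le>e. hom_component i (sg a c) * hom_component (e - i) (sg m (lk q m)))"
      by (simp add: 1)
    also have "\<dots> = (\<Sum>i\<le>e. hom_component i (sg a c) * (\<Sum>m\<in>Poly_Mapping.keys q. hom_component (e - i) (sg m (lk q m))))"
      by (subst sum.swap) (simp add: sum_distrib_left)
    also have "\<dots> = (\<Sum>i\<le>e. hom_component i (sg a c) * hom_component (e - i) q)"
      by (simp add: hom_component_sum[symmetric] sum_singles[symmetric])
    finally show ?thesis .
  qed
  have "hom_component e (p * q) = (\<Sum>m\<in>Poly_Mapping.keys p. hom_component e (sg m (lk p m) * q))"
    by (subst sum_singles[of p]) (simp add: sum_distrib_right hom_component_sum)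
  also have "\<dots> = (\<Sum>i\<le>e. (\<Sum>m\<in>Poly_Mapping.keys p. hom_component i (sg m (lk p m))) * hom_component (e - i) q)"
    by (simp only: 2) (subst sum.swap, simp add: sum_distrib_right)
  finally show ?thesis
    by (simp add: hom_component_sum[symmetric] sum_singles[symmetric])
qed

text \<open>Replaces the algebraic structure by closure conditions that can be checked directly;
  closure under negation comes from multiplying by the constant \<open>- 1\<close>.\<close>

lemma ideal_poly_ring_iff:
  "ideal J (poly_ring n) \<longleftrightarrow> J \<subseteq> polys n \<and> 0 \<in> J \<and> (\<forall>p\<in>J. \<forall>q\<in>J. p + q \<in> J) \<and>
     (\<forall>p\<in>J. \<forall>h\<in>polys n. h * p \<in> J)" (is "?L \<longleftrightarrow> ?R")
proof
  assume ?L
  interpret ideal J "poly_ring n" by fact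
  show ?R
    using a_subset additive_subgroup.zero_closed[OF additive_subgroup_axioms]
      additive_subgroup.a_closed[OF additive_subgroup_axioms] I_l_closed
    by (auto simp: poly_ring_def)
next
  assume R: ?R
  interpret cring "poly_ring n" by (rule poly_ring_cring)
  have neg: "- p \<in> J" if "p \<in> J" for p
  proof -
    have "- 1 \<in> polys n" by (intro polys_closed)
    then have "(- 1) * p \<in> J" using R that by blast
    then show ?thesis by simp
  qed
  have inv: "a_inv (poly_ring n) p = - p" if "p \<in> polys n" for p
    by (rule minus_equality) (use that in \<open>auto simp: poly_ring_def polys_closed\<close>)
  show ?L
  proof (rule idealI)
    show "ring (poly_ring n)" by (rule ring_axioms)
    show "subgroup J (add_monoid (poly_ring n))"
    proof (rule group.subgroupI[OF a_group])
      show "J \<subseteq> carrier (add_monoid (poly_ring n))" using R by (auto simp: poly_ring_def)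
      show "J \<noteq> {}" using R by auto
      fix a assume a: "a \<in> J"
      then have "a \<in> polys n" using R by auto
      then show "inv\<^bsub>add_monoid (poly_ring n)\<^esub> a \<in> J" using neg[OF a] inv[of a] by (simp add: a_inv_def)
    next
      fix a b assume "a \<in> J" "b \<in> J"
      then show "a \<otimes>\<^bsub>add_monoid (poly_ring n)\<^esub> b \<in> J" using R by (simp add: poly_ring_def)
    qed
  qed (use R in \<open>auto simp: poly_ring_def mult.commute\<close>)
qed

lemma const_polys: "sg 0 c \<in> polys n"
  by (simp add: polys_def)

lemma ideal_cscale:
  assumes "ideal J (poly_ring n)" "p \<in> J" shows "cscale c p \<in> J"
proof -
  have "\<forall>p\<in>J. \<forall>h\<in>polys n. h * p \<in> J" using assms(1) unfolding ideal_poly_ring_iff by blast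
  then show ?thesis using assms(2) const_polys unfolding cscale_def by blast
qed

lemma subspace_graded_part:
  assumes "ideal J (poly_ring n)"
  shows "cpoly.subspace (graded_part J e)"
proof -
  have *: "0 \<in> J" "\<And>p q. p \<in> J \<Longrightarrow> q \<in> J \<Longrightarrow> p + q \<in> J"
    using assms unfolding ideal_poly_ring_iff by blast+
  have deg: "mon_degree m = e" if "p \<in> graded_part J e" "q \<in> graded_part J e" "lk (p + q) m \<noteq> 0" for p q m
  proof (cases "lk p m = 0")
    case True
    then show ?thesis using that(2,3) by (simp add: graded_part_iff lookup_add)
  next
    case False
    then show ?thesis using that(1) by (simp add: graded_part_iff)
  qed
  have add: "p + q \<in> graded_part J e" if pq: "p \<in> graded_part J e" "q \<in> graded_part J e" for p q
  proof -
    have "p + q \<in> J" using pq *(2) by (simp add: graded_part_iff)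
    then show ?thesis using deg[OF pq] by (simp add: graded_part_iff)
  qed
  have scale: "cscale c p \<in> graded_part J e" if "p \<in> graded_part J e" for c p
    using that ideal_cscale[OF assms, of p c] by (simp add: graded_part_iff cscale_lookup)
  have "0 \<in> graded_part J e" using *(1) by (simp add: graded_part_iff)
  with add scale show ?thesis unfolding cpoly.subspace_def by blast
qed

lemma polys_ideal: "ideal (polys n) (poly_ring n)"
  by (auto simp: ideal_poly_ring_iff polys_closed)

lemma subspace_polys: "cpoly.subspace (graded_part (polys n) e)"
  by (rule subspace_graded_part[OF polys_ideal])

lemma graded_part_mono: "J \<subseteq> K \<Longrightarrow> graded_part J e \<subseteq> graded_part K e"
  by (auto simp: graded_part_def)

subsection \<open>Linear algebra\<close>

context vector_space
begin

text \<open>The space of all polynomials is infinite dimensional, so finiteness enters through a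
  finite \<open>W\<close> whose span contains the subspace; only then does \<open>dim\<close>, a
  cardinality, carry information.\<close>

lemma fd_basis:
  assumes "subspace S" "S \<subseteq> span W" "finite W"
  obtains B where "finite B" "independent B" "span B = S" "card B = dim S"
proof -
  obtain B where B: "B \<subseteq> S" "independent B" "S \<subseteq> span B" "card B = dim S"
    using basis_exists by blast
  have "finite B" using independent_span_bound[OF assms(3) B(2)] B(1) assms(2) by blast
  moreover have "span B = S" using B(1,3) assms(1) by (simp add: span_minimal subset_antisym)
  ultimately show ?thesis using B that by blast
qed

lemma fd_independent:
  assumes "subspace S" "S \<subseteq> span W" "finite W" "independent B" "B \<subseteq> S"
  shows "finite B" "card B \<le> dim S"
proof -
  obtain C where C: "finite C" "independent C" "span C = S" "card C = dim S"
    using fd_basis[OF assms(1-3)] by blast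
  show "finite B" "card B \<le> dim S"
    using independent_span_bound[OF C(1) assms(4)] assms(5) C(3,4) by auto
qed

lemma span_image_finite:
  assumes "finite I" "y \<in> span (u ` I)"
  obtains c where "y = (\<Sum>i\<in>I. scale (c i) (u i))"
proof -
  let ?S = "{y. \<exists>c. y = (\<Sum>i\<in>I. scale (c i) (u i))}"
  have "subspace ?S"
  proof (rule subspaceI)
    show "0 \<in> ?S" by (auto intro!: exI[of _ "\<lambda>_. 0"])
    fix x y assume "x \<in> ?S" "y \<in> ?S"
    then obtain c d where "x = (\<Sum>i\<in>I. scale (c i) (u i))" "y = (\<Sum>i\<in>I. scale (d i) (u i))" by auto
    then have "x + y = (\<Sum>i\<in>I. scale (c i + d i) (u i))" by (simp add: scale_left_distrib sum.distrib)
    then show "x + y \<in> ?S" by auto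
  next
    fix a x assume "x \<in> ?S"
    then obtain c where "x = (\<Sum>i\<in>I. scale (c i) (u i))" by auto
    then have "scale a x = (\<Sum>i\<in>I. scale (a * c i) (u i))" by (simp add: scale_sum_right)
    then show "scale a x \<in> ?S" by auto
  qed
  moreover have "u ` I \<subseteq> ?S"
  proof clarify
    fix i assume "i \<in> I"
    then have "u i = (\<Sum>j\<in>I. scale (if j = i then 1 else 0) (u j))"
      using assms(1) by (simp add: if_distrib[of "\<lambda>c. scale c _"] cong: if_cong)
    then show "\<exists>c. u i = (\<Sum>j\<in>I. scale (c j) (u j))" by (rule exI[of _ "\<lambda>j. if j = i then 1 else 0"])
  qed
  ultimately have "span (u ` I) \<subseteq> ?S" by (rule span_minimal[rotated])
  with assms(2) that show ?thesis by blast
qed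

text \<open>The last hypothesis says that the family \<open>u\<close> is independent modulo
  \<open>span B\<close>. Counting by \<open>card I\<close> in the conclusion includes injectivity of
  \<open>u\<close> on \<open>I\<close> and disjointness of its image from \<open>B\<close>.\<close>

lemma independent_Un_family:
  assumes "independent B" "finite B" "finite I"
    and "\<And>c. (\<Sum>i\<in>I. scale (c i) (u i)) \<in> span B \<Longrightarrow> \<forall>i\<in>I. c i = 0"
  shows "independent (B \<union> u ` I) \<and> card (B \<union> u ` I) = card B + card I"
  using assms(3,4)
proof (induction I rule: finite_induct)
  case (insert j I)
  have "\<forall>i\<in>I. c i = 0" if "(\<Sum>i\<in>I. scale (c i) (u i)) \<in> span B" for c
  proof -
    let ?d = "\<lambda>i. if i = j then 0 else c i"
    have "(\<Sum>i\<in>I. scale (?d i) (u i)) = (\<Sum>i\<in>I. scale (c i) (u i))"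
      by (rule sum.cong) (use insert.hyps in auto)
    then have "(\<Sum>i\<in>insert j I. scale (?d i) (u i)) \<in> span B"
      using that insert.hyps by simp
    from insert.prems[OF this] insert.hyps show ?thesis by (metis insertCI)
  qed
  from insert.IH[OF this] have IH: "independent (B \<union> u ` I)" "card (B \<union> u ` I) = card B + card I" by blast+
  have nin: "u j \<notin> span (B \<union> u ` I)"
  proof
    assume "u j \<in> span (B \<union> u ` I)"
    then obtain b y where b: "b \<in> span B" and y: "y \<in> span (u ` I)" and uj: "u j = b + y"
      unfolding span_Un by blast
    obtain c where c: "y = (\<Sum>i\<in>I. scale (c i) (u i))"
      using span_image_finite[OF insert.hyps(1) y] by blast
    let ?d = "\<lambda>i. if i = j then 1 else - c i"
    have "(\<Sum>i\<in>I. scale (?d i) (u i)) = (\<Sum>i\<in>I. scale (- c i) (u i))"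
      by (rule sum.cong) (use insert.hyps in auto)
    also have "\<dots> = - y" by (simp add: c sum_negf)
    finally have "(\<Sum>i\<in>insert j I. scale (?d i) (u i)) = b" using uj insert.hyps by simp
    with b have "(\<Sum>i\<in>insert j I. scale (?d i) (u i)) \<in> span B" by simp
    from insert.prems[OF this] show False by (metis insertI1 zero_neq_one)
  qed
  have "u j \<notin> B \<union> u ` I" using nin span_base[of "u j" "B \<union> u ` I"] by (rule contrapos_nn)
  then show ?case
    using independent_insertI[OF nin IH(1)] IH(2) insert.hyps assms(2) by simp
qed (use assms in simp)

text \<open>A basis of \<open>S\<close> followed by the family is independent in \<open>V\<close>,
  so a family independent modulo \<open>S\<close> bounds the codimension of \<open>S\<close> from
  below.\<close>

lemma dim_add_family_le:
  assumes "subspace S" "subspace V" "S \<subseteq> V" "V \<subseteq> span W" "finite W" "finite I" "u ` I \<subseteq> V"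
    and "\<And>c. (\<Sum>i\<in>I. scale (c i) (u i)) \<in> S \<Longrightarrow> \<forall>i\<in>I. c i = 0"
  shows "dim S + card I \<le> dim V"
proof -
  have "S \<subseteq> span W" using assms by blast
  then obtain B where B: "finite B" "independent B" "span B = S" "card B = dim S"
    using fd_basis assms(1,5) by blast
  have "B \<subseteq> V" using B(3) assms(3) span_superset[of B] by simp
  with independent_Un_family[OF B(2,1) assms(6)] assms(7,8) B(3,4)
    fd_independent(2)[OF assms(2,4,5), of "B \<union> u ` I"]
  show ?thesis by auto
qed

text \<open>Spanning modulo \<open>S\<close> gives the reverse inequality; codimensions are thus
  computed without forming quotient spaces.\<close>

lemma dim_add_family_eq:
  assumes "subspace S" "subspace V" "S \<subseteq> V" "V \<subseteq> span W" "finite W" "finite I" "u ` I \<subseteq> V"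
    and "\<And>c. (\<Sum>i\<in>I. scale (c i) (u i)) \<in> S \<Longrightarrow> \<forall>i\<in>I. c i = 0"
    and "\<And>v. v \<in> V \<Longrightarrow> \<exists>c. v - (\<Sum>i\<in>I. scale (c i) (u i)) \<in> S"
  shows "dim V = dim S + card I"
proof -
  have "S \<subseteq> span W" using assms by blast
  then obtain B where B: "finite B" "independent B" "span B = S" "card B = dim S"
    using fd_basis assms(1,5) by blast
  have "V \<subseteq> span (B \<union> u ` I)"
  proof
    fix v assume "v \<in> V"
    then obtain c where c: "v - (\<Sum>i\<in>I. scale (c i) (u i)) \<in> S" using assms(9) by blast
    have "(\<Sum>i\<in>I. scale (c i) (u i)) \<in> span (u ` I)"
      by (intro span_sum span_scale span_base) auto
    then have "(\<Sum>i\<in>I. scale (c i) (u i)) \<in> span (B \<union> u ` I)"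
      using span_mono[of "u ` I" "B \<union> u ` I"] by blast
    moreover have "v - (\<Sum>i\<in>I. scale (c i) (u i)) \<in> span (B \<union> u ` I)"
      using c B(3) span_mono[of B "B \<union> u ` I"] by blast
    ultimately have "(v - (\<Sum>i\<in>I. scale (c i) (u i))) + (\<Sum>i\<in>I. scale (c i) (u i)) \<in> span (B \<union> u ` I)"
      by (rule span_add[rotated])
    then show "v \<in> span (B \<union> u ` I)" by simp
  qed
  then have "dim V \<le> card (B \<union> u ` I)" using B(1) assms(6) by (intro dim_le_card) auto
  with independent_Un_family[OF B(2,1) assms(6)] assms(8) B(3,4)
  have "dim V \<le> dim S + card I" by auto
  with dim_add_family_le[OF assms(1-8)] show ?thesis by simp
qed

lemma dim_mono_fd:
  assumes "subspace S" "subspace V" "S \<subseteq> V" "V \<subseteq> span W" "finite W"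
  shows "dim S \<le> dim V"
  using dim_add_family_le[OF assms, of "{}" undefined] by simp

text \<open>A vector of \<open>V\<close> outside \<open>S\<close> is a one-element family
  independent modulo \<open>S\<close>, which would force \<open>dim S < dim V\<close>.\<close>

lemma subspace_eq_fd:
  assumes "subspace S" "subspace V" "S \<subseteq> V" "V \<subseteq> span W" "finite W" "dim V \<le> dim S"
  shows "S = V"
proof (rule ccontr)
  assume "S \<noteq> V"
  then obtain x where x: "x \<in> V" "x \<notin> S" using assms(3) by blast
  have "\<forall>i\<in>{x}. c i = 0" if "(\<Sum>i\<in>{x}. scale (c i) i) \<in> S" for c
  proof (rule ccontr)
    assume "\<not> ?thesis"
    then have "scale (inverse (c x)) (scale (c x) x) = x" by simp
    moreover have "scale (c x) x \<in> S" using that by simp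
    ultimately show False using x subspace_scale[OF assms(1), of "scale (c x) x" "inverse (c x)"] by metis
  qed
  from dim_add_family_le[OF assms(1-5) _ _ this] x(1) assms(6) show False by simp
qed

text \<open>The chosen family need not be injective: a repeated vector already satisfies a nontrivial relation.\<close>

lemma basis_from_family:
  assumes "subspace V" "V \<subseteq> span W" "finite W" "finite I" "u ` I \<subseteq> V" "card I = dim V"
    and "\<And>c. (\<Sum>i\<in>I. scale (c i) (u i)) = 0 \<Longrightarrow> \<forall>i\<in>I. c i = 0"
  shows "inj_on u I" "independent (u ` I)" "span (u ` I) = V"
proof -
  have *: "independent ({} \<union> u ` I) \<and> card ({} \<union> u ` I) = card ({} :: 'b set) + card I"
  proof (rule independent_Un_family)
    fix c assume "(\<Sum>i\<in>I. scale (c i) (u i)) \<in> span {}"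
    then show "\<forall>i\<in>I. c i = 0" by (intro assms(7)) simp
  qed (use assms(4) independent_empty in auto)
  then show "inj_on u I" "independent (u ` I)" using assms(4) eq_card_imp_inj_on[of I u] by auto
  show "span (u ` I) = V"
  proof (rule subspace_eq_fd[OF _ assms(1) _ assms(2,3)])
    show "dim V \<le> dim (span (u ` I))" using * assms(6) by (simp add: dim_eq_card_independent)
    show "span (u ` I) \<subseteq> V" using assms(1,5) by (simp add: span_minimal)
  qed auto
qed

end

section \<open>Graded pieces of the points of the Hilbert scheme\<close>

abbreviation T :: "nat \<Rightarrow> nat \<Rightarrow> nat cpoly set" where "T n e \<equiv> graded_part (polys n) e"

lemma T_spanned: "\<exists>W. finite W \<and> T n e \<subseteq> cpoly.span W"
  by (rule fin_span)

lemma subspace_J: "J \<in> Hilb n r \<Longrightarrow> cpoly.subspace (graded_part J e)"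
  by (rule subspace_graded_part[of J n]) (simp add: Hilb_def homogeneous_ideal_def)

lemma HilbD:
  assumes "J \<in> Hilb n r"
  shows "ideal J (poly_ring n)" "J \<subseteq> polys n" "graded_part J e \<subseteq> T n e"
    "\<And>p q. p \<in> J \<Longrightarrow> q \<in> J \<Longrightarrow> p + q \<in> J" "\<And>p h. p \<in> J \<Longrightarrow> h \<in> polys n \<Longrightarrow> h * p \<in> J"
    "\<And>p c. p \<in> J \<Longrightarrow> cscale c p \<in> J" "0 \<in> J" "\<And>p e. p \<in> J \<Longrightarrow> hom_component e p \<in> J"
proof -
  show i: "ideal J (poly_ring n)" and "\<And>p e. p \<in> J \<Longrightarrow> hom_component e p \<in> J"
    using assms by (auto simp: Hilb_def homogeneous_ideal_def)
  show s: "J \<subseteq> polys n" and "\<And>p q. p \<in> J \<Longrightarrow> q \<in> J \<Longrightarrow> p + q \<in> J" "0 \<in> J"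
    "\<And>p h. p \<in> J \<Longrightarrow> h \<in> polys n \<Longrightarrow> h * p \<in> J"
    using i unfolding ideal_poly_ring_iff by blast+
  show "\<And>p c. p \<in> J \<Longrightarrow> cscale c p \<in> J" by (rule ideal_cscale[OF i])
  show "graded_part J e \<subseteq> T n e" using s by (rule graded_part_mono)
qed

lemma Hilb_dim:
  assumes "J \<in> Hilb n r"
  shows "cpoly.dim (graded_part J e) + min r (cpoly.dim (T n e)) = cpoly.dim (T n e)"
proof -
  obtain W where W: "finite W" "T n e \<subseteq> cpoly.span W" using T_spanned by blast
  have "cpoly.dim (graded_part J e) \<le> cpoly.dim (T n e)"
    by (rule cpoly.dim_mono_fd[OF subspace_J[OF assms] subspace_polys HilbD(3)[OF assms] W(2,1)])
  moreover have "hilbert_function n J e = generic_hf n r e" using assms by (simp add: Hilb_def)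
  ultimately show ?thesis by (simp add: hilbert_function_def generic_hf_def)
qed

text \<open>The quotient in degree \<open>e\<close> has dimension at most \<open>r\<close>, so more
  than \<open>r\<close> forms are dependent modulo \<open>J\<close>. This is how the Hilbert
  function produces elements of \<open>J\<close>.\<close>

lemma Hilb_relation:
  assumes J: "J \<in> Hilb n r" and I: "finite I" "card I > r" "u ` I \<subseteq> T n e"
  obtains c where "(\<Sum>i\<in>I. cscale (c i) (u i)) \<in> graded_part J e" "\<exists>i\<in>I. c i \<noteq> 0"
proof (rule ccontr)
  assume "\<not> thesis"
  then have *: "\<And>c. (\<Sum>i\<in>I. cscale (c i) (u i)) \<in> graded_part J e \<Longrightarrow> \<forall>i\<in>I. c i = 0"
    using that by blast
  obtain W where W: "finite W" "T n e \<subseteq> cpoly.span W" using T_spanned by blast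
  have "cpoly.dim (graded_part J e) + card I \<le> cpoly.dim (T n e)"
    by (rule cpoly.dim_add_family_le[OF subspace_J[OF J] subspace_polys HilbD(3)[OF J] W(2,1) I(1,3) *])
  with Hilb_dim[OF J, of e] I(2) show False by linarith
qed

lemma Hilb_graded_basis: "J \<in> Hilb n r \<Longrightarrow> \<exists>B. graded_basis J B"
  using topspace_Hilb[of n r] unfolding Hilb_top_def topology_generated_by_topspace
  by (auto simp: Hilb_basic_open_def)

subsection \<open>Coefficientwise limits of ideals\<close>

text \<open>Convergence of each coefficient separately, with no common bound on the supports. On
  forms of fixed degree in finitely many variables it is ordinary convergence in a
  finite-dimensional space.\<close>

definition coeff_lim :: "(nat \<Rightarrow> 'v cpoly) \<Rightarrow> 'v cpoly \<Rightarrow> bool" where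
  "coeff_lim q p \<longleftrightarrow> (\<forall>m. (\<lambda>s. lk (q s) m) \<longlonglongrightarrow> lk p m)"

lemma limit_of_constant:
  fixes l :: "'a :: t2_space"
  assumes "f \<longlonglongrightarrow> l" "\<And>s. f s = c" shows "l = c"
proof -
  have "f = (\<lambda>_. c)" using assms(2) by blast
  with assms(1) show ?thesis by (simp add: LIMSEQ_const_iff)
qed

lemma coeff_lim_const: "coeff_lim (\<lambda>_. p) p"
  by (simp add: coeff_lim_def)

lemma coeff_lim_add: "coeff_lim q p \<Longrightarrow> coeff_lim q' p' \<Longrightarrow> coeff_lim (\<lambda>s. q s + q' s) (p + p')"
  by (auto simp: coeff_lim_def lookup_add intro: tendsto_add)

lemma coeff_lim_cscale: "c \<longlonglongrightarrow> l \<Longrightarrow> coeff_lim q p \<Longrightarrow> coeff_lim (\<lambda>s. cscale (c s) (q s)) (cscale l p)"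
  by (auto simp: coeff_lim_def cscale_lookup intro: tendsto_mult)

lemma coeff_lim_sum:
  "(\<And>i. i \<in> I \<Longrightarrow> coeff_lim (\<lambda>s. q s i) (p i)) \<Longrightarrow> coeff_lim (\<lambda>s. \<Sum>i\<in>I. q s i) (\<Sum>i\<in>I. p i)"
  by (auto simp: coeff_lim_def lookup_sum intro!: tendsto_sum)

lemma coeff_lim_mult:
  fixes h :: "'v cpoly"
  assumes "coeff_lim q p" shows "coeff_lim (\<lambda>s. h * q s) (h * p)"
proof -
  have *: "coeff_lim (\<lambda>s. sg a c * q s) (sg a c * p)" for a c
    unfolding coeff_lim_def
  proof
    fix m
    show "(\<lambda>s. lk (sg a c * q s) m) \<longlonglongrightarrow> lk (sg a c * p) m"
    proof (cases "\<exists>b. m = a + b")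
      case True
      then obtain b where "m = a + b" by blast
      then show ?thesis using assms by (auto simp: lookup_single_mult coeff_lim_def intro: tendsto_mult)
    next
      case False
      then show ?thesis by (simp add: lookup_single_mult')
    qed
  qed
  have h: "h * f = (\<Sum>a\<in>Poly_Mapping.keys h. sg a (lk h a) * f)" for f
    by (subst sum_singles[of h]) (simp add: sum_distrib_right)
  show ?thesis by (subst (1 2) h) (intro coeff_lim_sum *)
qed

lemma coeff_lim_hom: "coeff_lim q p \<Longrightarrow> coeff_lim (\<lambda>s. hom_component e (q s)) (hom_component e p)"
  by (simp add: coeff_lim_def lookup_hom)

lemma coeff_lim_subseq: "coeff_lim q p \<Longrightarrow> strict_mono \<rho> \<Longrightarrow> coeff_lim (\<lambda>s. q (\<rho> s)) p"
  using LIMSEQ_subseq_LIMSEQ unfolding coeff_lim_def comp_def by blast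

lemma coeff_lim_unique: "coeff_lim q p \<Longrightarrow> coeff_lim q p' \<Longrightarrow> p = p'"
  by (rule poly_mapping_eqI) (auto simp: coeff_lim_def intro: LIMSEQ_unique)

text \<open>Only limits of full sequences count, as in a lower limit of sets; so passing to a
  subsequence of ideals can enlarge the result.\<close>

definition lim_ideal :: "nat \<Rightarrow> (nat \<Rightarrow> nat cpoly set) \<Rightarrow> nat cpoly set" where
  "lim_ideal n J = {p \<in> polys n. \<exists>q. (\<forall>s. q s \<in> J s) \<and> coeff_lim q p}"

lemma homogeneous_idealD:
  assumes "homogeneous_ideal n J"
  shows "J \<subseteq> polys n" "0 \<in> J" "\<And>p q. p \<in> J \<Longrightarrow> q \<in> J \<Longrightarrow> p + q \<in> J"
    "\<And>p h. p \<in> J \<Longrightarrow> h \<in> polys n \<Longrightarrow> h * p \<in> J" "\<And>p e. p \<in> J \<Longrightarrow> hom_component e p \<in> J"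
  using assms unfolding homogeneous_ideal_def ideal_poly_ring_iff by blast+

lemma homogeneous_lim_ideal:
  assumes J: "\<And>s. homogeneous_ideal n (J s)"
  shows "homogeneous_ideal n (lim_ideal n J)"
proof -
  have "0 \<in> lim_ideal n J"
    using homogeneous_idealD(2)[OF J] coeff_lim_const[of 0] polys_closed(1)[of n]
    unfolding lim_ideal_def by (intro CollectI conjI exI[of _ "\<lambda>_. 0"]) simp_all
  moreover have "p + p' \<in> lim_ideal n J" if pp: "p \<in> lim_ideal n J" "p' \<in> lim_ideal n J" for p p'
  proof -
    obtain q q' where "\<forall>s. q s \<in> J s" "coeff_lim q p" "\<forall>s. q' s \<in> J s" "coeff_lim q' p'"
      using pp by (auto simp: lim_ideal_def)
    then have "\<forall>s. q s + q' s \<in> J s" "coeff_lim (\<lambda>s. q s + q' s) (p + p')"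
      using homogeneous_idealD(3)[OF J] coeff_lim_add by auto
    then show ?thesis using pp polys_closed(3)[of p n p'] by (auto simp: lim_ideal_def)
  qed
  moreover have "h * p \<in> lim_ideal n J" if pp: "p \<in> lim_ideal n J" "h \<in> polys n" for p h
  proof -
    obtain q where "\<forall>s. q s \<in> J s" "coeff_lim q p"
      using pp by (auto simp: lim_ideal_def)
    then have "\<forall>s. h * q s \<in> J s" "coeff_lim (\<lambda>s. h * q s) (h * p)"
      using homogeneous_idealD(4)[OF J] coeff_lim_mult pp(2) by auto
    then show ?thesis using pp polys_closed(5)[of h n p] by (auto simp: lim_ideal_def)
  qed
  moreover have "hom_component e p \<in> lim_ideal n J" if pp: "p \<in> lim_ideal n J" for p e
  proof -
    obtain q where "\<forall>s. q s \<in> J s" "coeff_lim q p"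
      using pp by (auto simp: lim_ideal_def)
    then have "\<forall>s. hom_component e (q s) \<in> J s" "coeff_lim (\<lambda>s. hom_component e (q s)) (hom_component e p)"
      using homogeneous_idealD(5)[OF J] coeff_lim_hom by auto
    then show ?thesis using pp hom_component_polys[of p n e] by (auto simp: lim_ideal_def)
  qed
  moreover have "lim_ideal n J \<subseteq> polys n" by (auto simp: lim_ideal_def)
  ultimately show ?thesis unfolding homogeneous_ideal_def ideal_poly_ring_iff by blast
qed

text \<open>The ideals are homogeneous and taking components is continuous, so an approximating
  sequence may be replaced by its components of degree \<open>e\<close>.\<close>

lemma graded_part_lim_ideal:
  assumes J: "\<And>s. homogeneous_ideal n (J s)"
  shows "p \<in> graded_part (lim_ideal n J) e \<longleftrightarrow>
    p \<in> T n e \<and> (\<exists>q. (\<forall>s. q s \<in> graded_part (J s) e) \<and> coeff_lim q p)" (is "?L \<longleftrightarrow> ?R")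
proof
  assume L: ?L
  then obtain q where q: "\<forall>s. q s \<in> J s" "coeff_lim q p" and p: "p \<in> T n e"
    by (auto simp: lim_ideal_def graded_part_iff)
  have "hom_component e p = p" using p by (simp add: graded_part_iff hom_component_self[of p e])
  then have "coeff_lim (\<lambda>s. hom_component e (q s)) p" using coeff_lim_hom[OF q(2), of e] by simp
  moreover have "hom_component e (q s) \<in> graded_part (J s) e" for s
    using homogeneous_idealD(5)[OF J] q(1) by (auto simp: graded_part_iff lookup_hom)
  ultimately show ?R using p by (intro conjI exI[of _ "\<lambda>s. hom_component e (q s)"]) simp_all
next
  assume ?R
  then show ?L by (auto simp: lim_ideal_def graded_part_iff)
qed

lemma convergent_subsequence_finite:
  fixes f :: "nat \<Rightarrow> 'a \<Rightarrow> complex"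
  assumes "finite M" "\<And>s m. m \<in> M \<Longrightarrow> norm (f s m) \<le> 1"
  shows "\<exists>(\<rho> :: nat \<Rightarrow> nat) l. strict_mono \<rho> \<and> (\<forall>m\<in>M. (\<lambda>s. f (\<rho> s) m) \<longlonglongrightarrow> l m)"
  using assms
proof (induction M rule: finite_induct)
  case empty
  then show ?case using strict_mono_id by auto
next
  case (insert x M)
  then obtain \<rho> l where \<rho>: "strict_mono \<rho>" "\<forall>m\<in>M. (\<lambda>s. f (\<rho> s) m) \<longlonglongrightarrow> l m" by auto
  have "compact (cball (0::complex) 1)" by simp
  then have "seq_compact (cball (0::complex) 1)" by (simp add: compact_eq_seq_compact_metric)
  moreover have "\<forall>s. f (\<rho> s) x \<in> cball 0 1" using insert.prems by simp
  ultimately obtain a r where r: "strict_mono r" "((\<lambda>s. f (\<rho> s) x) \<circ> r) \<longlonglongrightarrow> a"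
    unfolding seq_compact_def by (metis (no_types, lifting))
  have "\<forall>m\<in>insert x M. (\<lambda>s. f ((\<rho> \<circ> r) s) m) \<longlonglongrightarrow> (l(x := a)) m"
  proof
    fix m assume "m \<in> insert x M"
    show "(\<lambda>s. f ((\<rho> \<circ> r) s) m) \<longlonglongrightarrow> (l(x := a)) m"
    proof (cases "m = x")
      case True then show ?thesis using r(2) by (simp add: comp_def)
    next
      case False
      then have "(\<lambda>s. f (\<rho> s) m) \<longlonglongrightarrow> l m" using \<rho> \<open>m \<in> insert x M\<close> by auto
      from LIMSEQ_subseq_LIMSEQ[OF this r(1)] False show ?thesis by (simp add: comp_def)
    qed
  qed
  then show ?case using strict_mono_o[OF \<rho>(1) r(1)] by blast
qed

text \<open>Independence is an open condition. If it failed infinitely often, relations normalised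
  to have coefficient norms summing to 1 would have a convergent subsequence, whose limit is a
  nontrivial relation among the \<open>v i\<close>.\<close>

lemma eventually_independent:
  assumes I: "finite I" and w: "\<And>i. i \<in> I \<Longrightarrow> coeff_lim (\<lambda>s. w s i) (v i)"
    and v: "\<And>c. (\<Sum>i\<in>I. cscale (c i) (v i)) = 0 \<Longrightarrow> \<forall>i\<in>I. c i = 0"
  shows "\<forall>\<^sub>F s in sequentially. \<forall>c. (\<Sum>i\<in>I. cscale (c i) (w s i)) = 0 \<longrightarrow> (\<forall>i\<in>I. c i = 0)"
proof (rule ccontr)
  assume "\<not> ?thesis"
  moreover define A where "A = {s. \<not> (\<forall>c. (\<Sum>i\<in>I. cscale (c i) (w s i)) = 0 \<longrightarrow> (\<forall>i\<in>I. c i = 0))}"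
  ultimately have "infinite A"
    by (simp add: eventually_cofinite flip: cofinite_eq_sequentially)
  then obtain r :: "nat \<Rightarrow> nat" where r: "strict_mono r" "\<forall>s. r s \<in> A" using infinite_enumerate[of A] by metis
  have "\<exists>c. (\<Sum>i\<in>I. cscale (c i) (w (r s) i)) = 0 \<and> (\<Sum>i\<in>I. norm (c i)) = 1" for s
  proof -
    obtain c where c: "(\<Sum>i\<in>I. cscale (c i) (w (r s) i)) = 0" "\<exists>i\<in>I. c i \<noteq> 0" using r(2)[rule_format, of s] unfolding A_def mem_Collect_eq by meson
    define N where "N = (\<Sum>i\<in>I. norm (c i))"
    have "N > 0" unfolding N_def using c(2) I by (metis norm_ge_zero sum_pos2 zero_less_norm_iff)
    have "(\<Sum>i\<in>I. cscale (c i / of_real N) (w (r s) i)) = cscale (1 / of_real N) (\<Sum>i\<in>I. cscale (c i) (w (r s) i))"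
      by (simp add: cpoly.scale_sum_right)
    also have "\<dots> = 0" by (simp add: c(1))
    finally have "(\<Sum>i\<in>I. cscale (c i / of_real N) (w (r s) i)) = 0" .
    moreover have "(\<Sum>i\<in>I. norm (c i / of_real N)) = 1"
    proof -
      have "(\<Sum>i\<in>I. norm (c i / of_real N)) = (\<Sum>i\<in>I. norm (c i) / N)"
        using \<open>N > 0\<close> by (simp add: norm_divide)
      also have "\<dots> = N / N" by (simp only: N_def sum_divide_distrib)
      finally show ?thesis using \<open>N > 0\<close> by simp
    qed
    ultimately show ?thesis by (intro exI[of _ "\<lambda>i. c i / of_real N"] conjI)
  qed
  then obtain c where c: "\<And>s. (\<Sum>i\<in>I. cscale (c s i) (w (r s) i)) = 0" "\<And>s. (\<Sum>i\<in>I. norm (c s i)) = 1"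
    by metis
  have "norm (c s i) \<le> 1" if "i \<in> I" for s i
    using member_le_sum[of i I "\<lambda>i. norm (c s i)"] c(2)[of s] I that by simp
  from convergent_subsequence_finite[of I c, OF I this] obtain \<rho> l where
    \<rho>: "strict_mono \<rho>" "\<forall>i\<in>I. (\<lambda>s. c (\<rho> s) i) \<longlonglongrightarrow> l i" by blast
  have "(\<lambda>s. \<Sum>i\<in>I. norm (c (\<rho> s) i)) \<longlonglongrightarrow> (\<Sum>i\<in>I. norm (l i))"
    using \<rho>(2) by (intro tendsto_sum tendsto_norm) auto
  then have l1: "(\<Sum>i\<in>I. norm (l i)) = 1"
    by (rule limit_of_constant) (rule c(2))
  have "coeff_lim (\<lambda>s. \<Sum>i\<in>I. cscale (c (\<rho> s) i) (w (r (\<rho> s)) i)) (\<Sum>i\<in>I. cscale (l i) (v i))"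
  proof (intro coeff_lim_sum coeff_lim_cscale)
    fix i assume i: "i \<in> I"
    show "(\<lambda>s. c (\<rho> s) i) \<longlonglongrightarrow> l i" using \<rho>(2) i by blast
    show "coeff_lim (\<lambda>s. w (r (\<rho> s)) i) (v i)"
      using coeff_lim_subseq[OF w[OF i] strict_mono_o[OF r(1) \<rho>(1)]] by (simp add: comp_def)
  qed
  then have "coeff_lim (\<lambda>s. 0) (\<Sum>i\<in>I. cscale (l i) (v i))" by (simp add: c(1))
  then have "(\<Sum>i\<in>I. cscale (l i) (v i)) = 0" by (rule coeff_lim_unique[OF _ coeff_lim_const])
  then have "\<forall>i\<in>I. l i = 0" by (rule v)
  then show False using l1 by simp
qed

lemma coeff_lim_total:
  assumes "\<And>m. m \<in> M \<Longrightarrow> (\<lambda>s. lk (q s) m) \<longlonglongrightarrow> l m" "finite M" "\<And>s. Poly_Mapping.keys (q s) \<subseteq> M"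
  shows "coeff_lim q (\<Sum>m\<in>M. sg m (l m))"
  unfolding coeff_lim_def
proof
  fix m
  show "(\<lambda>s. lk (q s) m) \<longlonglongrightarrow> lk (\<Sum>m\<in>M. sg m (l m)) m"
  proof (cases "m \<in> M")
    case True
    then show ?thesis using assms(1,2) by (simp add: lookup_sum lookup_single when_def)
  next
    case False
    then have "lk (q s) m = 0" for s using assms(3)[of s] by (auto simp: in_keys_iff)
    moreover have "lk (\<Sum>m\<in>M. sg m (l m)) m = 0" using False by (auto simp: lookup_sum lookup_single when_def intro!: sum.neutral)
    ultimately show ?thesis by simp
  qed
qed

text \<open>If some \<open>x\<close> in \<open>V\<close> has a nonzero coefficient at
  \<open>m\<close>, subtracting a multiple of \<open>x\<close> moves any vector of \<open>V\<close>
  into the kernel of that coefficient functional.\<close>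

lemma dim_coeff_zero:
  assumes "cpoly.subspace V" "V \<subseteq> T n e"
  shows "cpoly.dim V \<le> Suc (cpoly.dim {p \<in> V. lk p m = 0})"
proof (cases "\<exists>x\<in>V. lk x m \<noteq> 0")
  case False
  then have "{p \<in> V. lk p m = 0} = V" by auto
  then show ?thesis by simp
next
  case True
  then obtain x where x: "x \<in> V" "lk x m \<noteq> 0" by blast
  obtain W where W: "finite W" "T n e \<subseteq> cpoly.span W" using T_spanned by blast
  have "cpoly.dim V = cpoly.dim {p \<in> V. lk p m = 0} + card {x}"
  proof (rule cpoly.dim_add_family_eq[where u = "\<lambda>x. x"])
    show "cpoly.subspace {p \<in> V. lk p m = 0}"
      using assms(1) unfolding cpoly.subspace_def by (simp add: lookup_add cscale_lookup)
    show "V \<subseteq> cpoly.span W" using assms(2) W(2) by blast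
    fix c assume "(\<Sum>i\<in>{x}. cscale (c i) i) \<in> {p \<in> V. lk p m = 0}"
    then show "\<forall>i\<in>{x}. c i = 0" using x by (simp add: cscale_lookup)
  next
    fix v assume v: "v \<in> V"
    have "v - cscale (lk v m / lk x m) x \<in> V"
      using cpoly.subspace_diff[OF assms(1) v] cpoly.subspace_scale[OF assms(1) x(1)] by blast
    then have "v - (\<Sum>i\<in>{x}. cscale (lk v m / lk x m) i) \<in> {p \<in> V. lk p m = 0}"
      using x by (simp add: cscale_lookup lookup_minus)
    then show "\<exists>c. v - (\<Sum>i\<in>{x}. cscale (c i) i) \<in> {p \<in> V. lk p m = 0}"
      by (intro exI[of _ "\<lambda>_. lk v m / lk x m"])
  qed (use assms x W in auto)
  then show ?thesis by simp
qed

lemma T_keys: "p \<in> T n e \<Longrightarrow> Poly_Mapping.keys p \<subseteq> {m. Poly_Mapping.keys m \<subseteq> {..n} \<and> mon_degree m = e}"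
  by (auto simp: graded_part_def polys_def)

lemma coeff_lim_T:
  assumes "\<And>s. q s \<in> T n e" "coeff_lim q p"
  shows "p \<in> T n e"
proof -
  have "lk p m = 0" if "\<not> (Poly_Mapping.keys m \<subseteq> {..n} \<and> mon_degree m = e)" for m
  proof -
    have "lk (q s) m = 0" for s using T_keys[OF assms(1)[of s]] that by (auto simp: in_keys_iff)
    moreover have "(\<lambda>s. lk (q s) m) \<longlonglongrightarrow> lk p m" using assms(2) by (simp add: coeff_lim_def)
    ultimately show ?thesis by (rule limit_of_constant[rotated])
  qed
  then show ?thesis unfolding graded_part_iff polys_iff by blast
qed

text \<open>Compactness of the unit sphere: normalise a nonzero vector of each \<open>V s\<close> by
  the sum of its coefficient norms, which is preserved in the limit.\<close>

lemma exists_limit_vector: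
  fixes V :: "nat \<Rightarrow> nat cpoly set"
  assumes "\<And>s. cpoly.subspace (V s)" "\<And>s. V s \<subseteq> T n e" "\<And>s. cpoly.dim (V s) > 0"
  obtains \<rho> :: "nat \<Rightarrow> nat" and x q where "strict_mono \<rho>" "x \<noteq> 0" "\<And>s. q s \<in> V (\<rho> s)" "coeff_lim q x"
proof -
  let ?M = "{m::nat \<Rightarrow>\<^sub>0 nat. Poly_Mapping.keys m \<subseteq> {..n} \<and> mon_degree m = e}"
  have M: "finite ?M" by (rule finite_exps)
  have "\<exists>x\<in>V s. (\<Sum>m\<in>?M. norm (lk x m)) = 1" for s
  proof -
    have "V s \<noteq> {0}" using assms(3)[of s] by (metis cpoly.dim_eq_card_independent cpoly.dim_span cpoly.independent_empty cpoly.span_empty card.empty less_numeral_extra(3))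
    then obtain y where y: "y \<in> V s" "y \<noteq> 0" using cpoly.subspace_0[OF assms(1)[of s]] by blast
    define N where "N = (\<Sum>m\<in>?M. norm (lk y m))"
    obtain m where m: "m \<in> Poly_Mapping.keys y" using y(2) by (metis ex_in_conv keys_eq_empty)
    then have "m \<in> ?M" using T_keys y(1) assms(2) by blast
    then have "N > 0" unfolding N_def using m by (intro sum_pos2[OF M]) (auto simp: in_keys_iff)
    moreover have "cscale (1 / of_real N) y \<in> V s" using cpoly.subspace_scale[OF assms(1) y(1)] .
    moreover have "(\<Sum>m\<in>?M. norm (lk (cscale (1 / of_real N) y) m)) = 1"
    proof -
      have "(\<Sum>m\<in>?M. norm (lk (cscale (1 / of_real N) y) m)) = (\<Sum>m\<in>?M. norm (lk y m) / N)"
        using \<open>N > 0\<close> by (simp add: cscale_lookup norm_divide)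
      also have "\<dots> = N / N" by (simp only: N_def sum_divide_distrib)
      finally show ?thesis using \<open>N > 0\<close> by simp
    qed
    ultimately show ?thesis by blast
  qed
  then obtain x where x: "\<And>s. x s \<in> V s" "\<And>s. (\<Sum>m\<in>?M. norm (lk (x s) m)) = 1"
    unfolding Bex_def using choice[of "\<lambda>s x. x \<in> V s \<and> (\<Sum>m\<in>?M. norm (lk x m)) = 1"] by blast
  have "norm (lk (x s) m) \<le> 1" if "m \<in> ?M" for s m
    using member_le_sum[of m ?M "\<lambda>m. norm (lk (x s) m)"] x(2)[of s] M that by simp
  from convergent_subsequence_finite[of ?M "\<lambda>s. lk (x s)", OF M this] obtain \<rho> l where
    \<rho>: "strict_mono \<rho>" "\<forall>m\<in>?M. (\<lambda>s. lk (x (\<rho> s)) m) \<longlonglongrightarrow> l m" by blast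
  have "(\<lambda>s. \<Sum>m\<in>?M. norm (lk (x (\<rho> s)) m)) \<longlonglongrightarrow> (\<Sum>m\<in>?M. norm (l m))"
    using \<rho>(2) by (intro tendsto_sum tendsto_norm) auto
  then have l1: "(\<Sum>m\<in>?M. norm (l m)) = 1"
    by (rule limit_of_constant) (rule x(2))
  have "coeff_lim (\<lambda>s. x (\<rho> s)) (\<Sum>m\<in>?M. sg m (l m))"
    by (rule coeff_lim_total) (use \<rho>(2) M T_keys x(1) assms(2) in blast)+
  moreover have "(\<Sum>m\<in>?M. sg m (l m)) \<noteq> 0"
  proof
    assume 0: "(\<Sum>m\<in>?M. sg m (l m)) = 0"
    have "l m = 0" if "m \<in> ?M" for m
    proof -
      have "lk (\<Sum>m\<in>?M. sg m (l m)) m = l m" using that M by (simp add: lookup_sum lookup_single when_def)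
      then show ?thesis using 0 by simp
    qed
    then show False using l1 by simp
  qed
  ultimately show ?thesis by (intro that[OF \<rho>(1) _ x(1)])
qed

text \<open>Compactness of the Grassmannian, by induction on \<open>d\<close>. After a first limit
  vector \<open>x\<close> with nonzero coefficient at \<open>m\<close>, restrict to the vectors
  whose coefficient at \<open>m\<close> is zero: the dimension drops by at most one, and all later
  limits inherit the zero coefficient, so \<open>x\<close> is not in their span.\<close>

lemma limit_subspace_dim:
  fixes V :: "nat \<Rightarrow> nat cpoly set"
  assumes "\<And>s. cpoly.subspace (V s)" "\<And>s. V s \<subseteq> T n e" "\<And>s. d \<le> cpoly.dim (V s)"
  shows "\<exists>(\<rho> :: nat \<Rightarrow> nat) S. strict_mono \<rho> \<and> finite S \<and> card S = d \<and> cpoly.independent S \<and>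
    (\<forall>v\<in>S. \<exists>q. (\<forall>s. q s \<in> V (\<rho> s)) \<and> coeff_lim q v)"
  using assms
proof (induction d arbitrary: V)
  case 0
  show ?case
    by (rule exI[where x = "id :: nat \<Rightarrow> nat"], rule exI[where x = "{}"])
       (auto simp: strict_mono_def cpoly.independent_empty)
next
  case (Suc d)
  have pos: "cpoly.dim (V s) > 0" for s using Suc.prems(3)[of s] by simp
  obtain \<rho> x q where x: "strict_mono \<rho>" "x \<noteq> 0" "\<And>s. q s \<in> V (\<rho> s)" "coeff_lim q x"
    by (rule exists_limit_vector[of V n e, OF Suc.prems(1,2) pos]) (rule that)
  obtain m where m: "lk x m \<noteq> 0" using x(2) by (metis poly_mapping_eqI lookup_zero)
  let ?V = "\<lambda>s. {p \<in> V (\<rho> s). lk p m = 0}"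
  have sub: "cpoly.subspace (?V s)" for s
    using Suc.prems(1)[of "\<rho> s"] unfolding cpoly.subspace_def by (simp add: lookup_add cscale_lookup)
  have "d \<le> cpoly.dim (?V s)" for s
    using dim_coeff_zero[OF Suc.prems(1,2), of "\<rho> s" m] Suc.prems(3)[of "\<rho> s"] by simp
  moreover have "?V s \<subseteq> T n e" for s using Suc.prems(2) by blast
  ultimately obtain r S where S: "strict_mono r" "finite S" "card S = d" "cpoly.independent S"
    "\<And>v. v \<in> S \<Longrightarrow> \<exists>q. (\<forall>s. q s \<in> ?V (r s)) \<and> coeff_lim q v"
    using Suc.IH[of ?V, OF sub] by blast
  have zero: "lk v m = 0" if vS: "v \<in> S" for v
  proof -
    obtain q where q: "\<And>s. q s \<in> ?V (r s)" "coeff_lim q v" using S(5)[OF vS] by blast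
    have "lk (q s) m = 0" for s using q(1)[of s] by simp
    moreover have "(\<lambda>s. lk (q s) m) \<longlonglongrightarrow> lk v m" using q(2) by (simp add: coeff_lim_def)
    ultimately show ?thesis by (rule limit_of_constant[rotated])
  qed
  have "cpoly.subspace {p. lk p m = 0}" for m
    unfolding cpoly.subspace_def by (simp add: lookup_add cscale_lookup)
  then have "cpoly.span S \<subseteq> {p. lk p m = 0}" using zero by (intro cpoly.span_minimal) auto
  then have xS: "x \<notin> cpoly.span S" using m by blast
  then have "x \<notin> S" using cpoly.span_base by metis
  have "\<exists>q. (\<forall>s. q s \<in> V ((\<rho> \<circ> r) s)) \<and> coeff_lim q v" if v: "v \<in> insert x S" for v
  proof (cases "v = x")
    case True
    then show ?thesis using x(3) coeff_lim_subseq[OF x(4) S(1)] by (intro exI[of _ "\<lambda>s. q (r s)"]) simp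
  next
    case False
    then obtain q where "\<And>s. q s \<in> ?V (r s)" "coeff_lim q v" using S(5) v by blast
    then show ?thesis by (intro exI[of _ q]) simp
  qed
  moreover have "card (insert x S) = Suc d" using S(2,3) \<open>x \<notin> S\<close> by simp
  ultimately show ?case
    using strict_mono_o[OF x(1) S(1)] S(2) cpoly.independent_insertI[OF xS S(4)]
    by (intro exI[of _ "\<rho> \<circ> r"] exI[of _ "insert x S"]) (simp add: comp_def)
qed

subsection \<open>Sequential compactness\<close>

lemma Hilb_homogeneous: "J \<in> Hilb n r \<Longrightarrow> homogeneous_ideal n J"
  by (simp add: Hilb_def)

lemma Hilb_from_dim:
  assumes "homogeneous_ideal n J"
    and "\<And>e. cpoly.dim (graded_part J e) + min r (cpoly.dim (T n e)) = cpoly.dim (T n e)"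
  shows "J \<in> Hilb n r"
proof -
  have "cpoly.dim (T n e) - cpoly.dim (graded_part J e) = min r (cpoly.dim (T n e))" for e
    using assms(2)[of e] by linarith
  then show ?thesis using assms(1) by (simp add: Hilb_def hilbert_function_def generic_hf_def)
qed

lemma lim_ideal_shift:
  assumes "\<And>s. 0 \<in> J s"
  shows "lim_ideal n (\<lambda>s. J (N + s)) \<subseteq> lim_ideal n J"
proof
  fix p assume "p \<in> lim_ideal n (\<lambda>s. J (N + s))"
  then obtain q where q: "p \<in> polys n" "\<And>s. q s \<in> J (N + s)" "coeff_lim q p"
    by (auto simp: lim_ideal_def)
  define q' where "q' s = (if s < N then 0 else q (s - N))" for s
  have "q' s \<in> J s" for s using assms[of s] q(2)[of "s - N"] by (auto simp: q'_def)
  moreover have "coeff_lim q' p"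
    unfolding coeff_lim_def
  proof
    fix m
    have "(\<lambda>s. lk (q' (s + N)) m) \<longlonglongrightarrow> lk p m" using q(3) by (simp add: q'_def coeff_lim_def)
    then show "(\<lambda>s. lk (q' s) m) \<longlonglongrightarrow> lk p m" by (rule LIMSEQ_offset)
  qed
  ultimately show "p \<in> lim_ideal n J" using q(1) by (auto simp: lim_ideal_def)
qed

lemma lim_ideal_subseq:
  assumes "strict_mono (\<rho> :: nat \<Rightarrow> nat)"
  shows "lim_ideal n J \<subseteq> lim_ideal n (\<lambda>s. J (\<rho> s))"
proof
  fix p assume "p \<in> lim_ideal n J"
  then obtain q where q: "p \<in> polys n" "\<And>s. q s \<in> J s" "coeff_lim q p"
    by (auto simp: lim_ideal_def)
  have "coeff_lim (\<lambda>s. q (\<rho> s)) p" by (rule coeff_lim_subseq[OF q(3) assms])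
  then show "p \<in> lim_ideal n (\<lambda>s. J (\<rho> s))"
    using q(1,2) unfolding lim_ideal_def by (intro CollectI conjI exI[of _ "\<lambda>s. q (\<rho> s)"]) auto
qed

text \<open>Approximants of a basis of the limit lie in \<open>J s\<close> and are independent for
  large \<open>s\<close>, so the dimension cannot jump up in the limit.\<close>

lemma dim_lim_ideal_le:
  assumes J: "\<And>s. homogeneous_ideal n (J s)" and d: "\<And>s. cpoly.dim (graded_part (J s) e) = d"
  shows "cpoly.dim (graded_part (lim_ideal n J) e) \<le> d"
proof -
  obtain W where W: "finite W" "T n e \<subseteq> cpoly.span W" using T_spanned by blast
  have J': "ideal (J s) (poly_ring n)" "J s \<subseteq> polys n" for s
    using J[of s] homogeneous_idealD(1)[OF J] by (simp_all add: homogeneous_ideal_def)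
  have L: "homogeneous_ideal n (lim_ideal n J)" by (rule homogeneous_lim_ideal[OF J])
  have sL: "cpoly.subspace (graded_part (lim_ideal n J) e)"
    by (rule subspace_graded_part[of _ n]) (use L in \<open>simp add: homogeneous_ideal_def\<close>)
  have LT: "graded_part (lim_ideal n J) e \<subseteq> T n e"
    by (rule graded_part_mono[OF homogeneous_idealD(1)[OF L]])
  obtain B where B: "finite B" "cpoly.independent B" "cpoly.span B = graded_part (lim_ideal n J) e"
    "card B = cpoly.dim (graded_part (lim_ideal n J) e)"
    by (rule cpoly.fd_basis[OF sL _ W(1)]) (use LT W(2) in blast, rule that)
  have "\<forall>b\<in>B. \<exists>q. (\<forall>s. q s \<in> graded_part (J s) e) \<and> coeff_lim q b"
    using B(3) cpoly.span_superset[of B] graded_part_lim_ideal[of n J _ e, OF J] by auto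
  then obtain w where w: "\<And>b s. b \<in> B \<Longrightarrow> w b s \<in> graded_part (J s) e" "\<And>b. b \<in> B \<Longrightarrow> coeff_lim (w b) b"
    unfolding bchoice_iff by blast
  have "\<forall>\<^sub>F s in sequentially. \<forall>c. (\<Sum>b\<in>B. cscale (c b) (w b s)) = 0 \<longrightarrow> (\<forall>b\<in>B. c b = 0)"
  proof (rule eventually_independent[OF B(1)])
    fix c assume "(\<Sum>b\<in>B. cscale (c b) b) = 0"
    then show "\<forall>b\<in>B. c b = 0" using cpoly.independentD[OF B(2,1) subset_refl, of c] by blast
  qed (rule w(2))
  then obtain s where s: "\<And>c. (\<Sum>b\<in>B. cscale (c b) (w b s)) = 0 \<Longrightarrow> \<forall>b\<in>B. c b = 0"
    unfolding eventually_sequentially by blast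
  have "cpoly.dim {0 :: nat cpoly} + card B \<le> cpoly.dim (graded_part (J s) e)"
  proof (rule cpoly.dim_add_family_le[where u = "\<lambda>b. w b s"])
    show "cpoly.subspace (graded_part (J s) e)" by (rule subspace_graded_part[OF J'(1)])
    then show "{0} \<subseteq> graded_part (J s) e" using cpoly.subspace_0 by blast
    show "graded_part (J s) e \<subseteq> cpoly.span W" using graded_part_mono[OF J'(2)] W(2) by blast
    show "(\<lambda>b. w b s) ` B \<subseteq> graded_part (J s) e" using w(1) by blast
    fix c assume "(\<Sum>b\<in>B. cscale (c b) (w b s)) \<in> {0}"
    then show "\<forall>b\<in>B. c b = 0" using s[of c] by blast
  qed (use W B(1) cpoly.subspace_single_0 in auto)
  then show ?thesis using d[of s] B(4) by simp
qed

text \<open>Limits have at most the expected dimension in each degree. Equality in a single degree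
  is reached along a subsequence, and a diagonal sequence reaches it in all degrees at once.\<close>

theorem Hilb_seq_compact:
  assumes "\<And>s::nat. J s \<in> Hilb n r"
  obtains \<rho> :: "nat \<Rightarrow> nat" where "strict_mono \<rho>" "lim_ideal n (\<lambda>s. J (\<rho> s)) \<in> Hilb n r"
proof -
  define d where "d e = cpoly.dim (T n e) - min r (cpoly.dim (T n e))" for e
  have d: "cpoly.dim (graded_part (J s) e) = d e" for s e
    using Hilb_dim[OF assms[of s], of e] by (simp add: d_def)
  have hom: "homogeneous_ideal n (J s)" for s using assms by (rule Hilb_homogeneous)
  \<comment> \<open>\<open>P e \<rho>\<close> says that along \<open>\<rho>\<close> degree
    \<open>e\<close> already has enough independent limits. It persists under refinement, since the
    limit ideal only grows.\<close>
  define P where "P e \<rho> \<longleftrightarrow> (\<exists>S. finite S \<and> card S = d e \<and> cpoly.independent S \<and>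
     S \<subseteq> graded_part (lim_ideal n (\<lambda>s. J (\<rho> s))) e)" for e and \<rho> :: "nat \<Rightarrow> nat"
  have P_mono: "P e \<rho>'" if "lim_ideal n (\<lambda>s. J (\<rho> s)) \<subseteq> lim_ideal n (\<lambda>s. J (\<rho>' s))" "P e \<rho>" for e \<rho> \<rho>'
    using that(2) graded_part_mono[OF that(1), of e] unfolding P_def by (meson subset_trans)
  have "subseqs P"
  proof
    fix e :: nat and \<rho> :: "nat \<Rightarrow> nat"
    have 1: "cpoly.subspace (graded_part (J (\<rho> s)) e)" "graded_part (J (\<rho> s)) e \<subseteq> T n e" for s
      using subspace_J[OF assms] HilbD(3)[OF assms] by auto
    obtain r :: "nat \<Rightarrow> nat" and S where r: "strict_mono r" "finite S" "card S = d e" "cpoly.independent S"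
      "\<forall>v\<in>S. \<exists>q. (\<forall>s. q s \<in> graded_part (J (\<rho> (r s))) e) \<and> coeff_lim q v"
      using limit_subspace_dim[of "\<lambda>s. graded_part (J (\<rho> s)) e" n e "d e", OF 1] d by auto
    have "S \<subseteq> graded_part (lim_ideal n (\<lambda>s. J (\<rho> (r s)))) e"
    proof
      fix v assume "v \<in> S"
      then obtain q where q: "\<And>s. q s \<in> graded_part (J (\<rho> (r s))) e" "coeff_lim q v" using r(5) by blast
      have "v \<in> T n e" by (rule coeff_lim_T[OF _ q(2)]) (use q(1) 1 in blast)
      then show "v \<in> graded_part (lim_ideal n (\<lambda>s. J (\<rho> (r s)))) e"
        using q by (subst graded_part_lim_ideal[OF hom]) blast
    qed
    then show "\<exists>r'. strict_mono r' \<and> P e (\<rho> \<circ> r')" using r unfolding P_def by auto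
  qed
  then interpret subseqs P .
  have Pd: "P e diagseq" for e
  proof (rule P_mono)
    \<comment> \<open>The diagonal sequence is known to satisfy \<open>P e\<close> only after
      dropping its first \<open>Suc e\<close> terms; the shift below restores them.\<close>
    show "P e (diagseq \<circ> (+) (Suc e))"
    proof (rule diagseq_holds)
      fix r s :: "nat \<Rightarrow> nat" and n' assume r: "strict_mono r" "P n' s"
      show "P n' (s \<circ> r)" by (rule P_mono[OF _ r(2)]) (use lim_ideal_subseq[OF r(1), of n "\<lambda>x. J (s x)"] in simp)
    qed
    show "lim_ideal n (\<lambda>s. J ((diagseq \<circ> (+) (Suc e)) s)) \<subseteq> lim_ideal n (\<lambda>s. J (diagseq s))"
      using lim_ideal_shift[of "\<lambda>s. J (diagseq s)" n "Suc e"] HilbD(7)[OF assms] by simp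
  qed
  have L: "homogeneous_ideal n (lim_ideal n (\<lambda>s. J (diagseq s)))" by (rule homogeneous_lim_ideal[OF hom])
  have "cpoly.dim (graded_part (lim_ideal n (\<lambda>s. J (diagseq s))) e) = d e" for e
  proof (rule antisym)
    show "cpoly.dim (graded_part (lim_ideal n (\<lambda>s. J (diagseq s))) e) \<le> d e"
      by (rule dim_lim_ideal_le[OF hom d])
    obtain S where S: "finite S" "card S = d e" "cpoly.independent S"
      "S \<subseteq> graded_part (lim_ideal n (\<lambda>s. J (diagseq s))) e" using Pd[of e] unfolding P_def by auto
    obtain W where W: "finite W" "T n e \<subseteq> cpoly.span W" using T_spanned by blast
    have "card S \<le> cpoly.dim (graded_part (lim_ideal n (\<lambda>s. J (diagseq s))) e)"
    proof (rule cpoly.fd_independent(2)[OF _ _ W(1) S(3,4)])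
      show "cpoly.subspace (graded_part (lim_ideal n (\<lambda>s. J (diagseq s))) e)"
        by (rule subspace_graded_part[of _ n]) (use L in \<open>simp add: homogeneous_ideal_def\<close>)
      show "graded_part (lim_ideal n (\<lambda>s. J (diagseq s))) e \<subseteq> cpoly.span W"
        using graded_part_mono[OF homogeneous_idealD(1)[OF L], of e] W(2) by blast
    qed
    then show "d e \<le> cpoly.dim (graded_part (lim_ideal n (\<lambda>s. J (diagseq s))) e)" using S(2) by simp
  qed
  then have "lim_ideal n (\<lambda>s. J (diagseq s)) \<in> Hilb n r"
    by (intro Hilb_from_dim[OF L]) (simp add: d_def)
  then show ?thesis using that subseq_diagseq by blast
qed

text \<open>The polynomial \<open>f\<close> sees only finitely many degrees. In these, a basis of
  the limit lifts to bases of \<open>J s\<close> for large \<open>s\<close>, whose coordinates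
  converge, so \<open>f\<close> stays nonzero.\<close>

lemma basic_open_eventually:
  assumes J: "\<And>s. J s \<in> Hilb n r" and L: "lim_ideal n J \<in> Hilb_basic_open n r f"
  shows "\<forall>\<^sub>F s in sequentially. J s \<in> Hilb_basic_open n r f"
proof -
  let ?L = "lim_ideal n J"
  define d where "d e = cpoly.dim (T n e) - min r (cpoly.dim (T n e))" for e
  have dJ: "cpoly.dim (graded_part K e) = d e" if "K \<in> Hilb n r" for K e
    using Hilb_dim[OF that, of e] by (simp add: d_def)
  have LH: "?L \<in> Hilb n r" using L by (simp add: Hilb_basic_open_def)
  have hom: "homogeneous_ideal n (J s)" for s using J by (rule Hilb_homogeneous)
  obtain B where B: "graded_basis ?L B" "peval (basis_coords B) f \<noteq> 0"
    using L by (auto simp: Hilb_basic_open_def)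
  have gb: "graded_basis K C \<longleftrightarrow> (\<forall>e. inj_on (C e) {..<d e} \<and> cpoly.independent (C e ` {..<d e}) \<and>
     cpoly.span (C e ` {..<d e}) = graded_part K e \<and> (\<forall>i\<ge>d e. C e i = 0))" if "K \<in> Hilb n r" for K C
    unfolding graded_basis_def Let_def dJ[OF that] ..
  have B': "inj_on (B e) {..<d e}" "cpoly.independent (B e ` {..<d e})"
     "cpoly.span (B e ` {..<d e}) = graded_part ?L e" "\<And>i. i \<ge> d e \<Longrightarrow> B e i = 0" for e
    using B(1) unfolding gb[OF LH] by blast+
  have Bi: "B e i \<in> graded_part ?L e" if "i < d e" for e i
    using B'(3)[of e] that cpoly.span_superset[of "B e ` {..<d e}"] by auto
  have "\<exists>q. (\<forall>s. q s \<in> graded_part (J s) e) \<and> coeff_lim q (B e i)" if "i < d e" for e i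
    using Bi[OF that] graded_part_lim_ideal[of n J _ e, OF hom] by blast
  then have "\<forall>e i. \<exists>q. i < d e \<longrightarrow> (\<forall>s. q s \<in> graded_part (J s) e) \<and> coeff_lim q (B e i)" by blast
  then obtain w where w: "\<And>e i s. i < d e \<Longrightarrow> w e i s \<in> graded_part (J s) e"
    "\<And>e i. i < d e \<Longrightarrow> coeff_lim (w e i) (B e i)" unfolding choice_iff by blast
  have "\<exists>C. graded_basis (J s) C" for s by (rule Hilb_graded_basis[OF J])
  then obtain D where D: "\<And>s. graded_basis (J s) (D s)" by metis
  define X where "X = \<Union> (Poly_Mapping.keys ` Poly_Mapping.keys f)"
  define E where "E = fst ` X"
  have "finite E" by (simp add: E_def X_def)
  \<comment> \<open>Lifted bases in the degrees \<open>E\<close> seen by \<open>f\<close>, arbitrary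
    bases \<open>D\<close> elsewhere; the zero padding is the one required of a graded
    basis.\<close>
  define C where "C s e i = (if e \<in> E then if i < d e then w e i s else 0 else D s e i)" for s e i
  have ind: "\<forall>\<^sub>F s in sequentially. \<forall>c. (\<Sum>i<d e. cscale (c i) (w e i s)) = 0 \<longrightarrow> (\<forall>i\<in>{..<d e}. c i = 0)" for e
  proof (rule eventually_independent)
    fix c assume c: "(\<Sum>i<d e. cscale (c i) (B e i)) = 0"
    show "\<forall>i\<in>{..<d e}. c i = 0"
    proof
      fix i assume i: "i \<in> {..<d e}"
      let ?g = "the_inv_into {..<d e} (B e)"
      have "(\<Sum>v\<in>B e ` {..<d e}. cscale (c (?g v)) v) = (\<Sum>i<d e. cscale (c i) (B e i))"
        using B'(1) by (subst sum.reindex) (auto simp: the_inv_into_f_f intro!: sum.cong)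
      then have "c (?g (B e i)) = 0"
        using i c by (intro cpoly.independentD[OF B'(2)[of e] _ subset_refl]) auto
      then show "c i = 0" using B'(1) i by (simp add: the_inv_into_f_f)
    qed
  qed (use w(2) in auto)
  have ev1: "\<forall>\<^sub>F s in sequentially. graded_basis (J s) (C s)"
  proof -
    have "\<forall>\<^sub>F s in sequentially. \<forall>e\<in>E. \<forall>c. (\<Sum>i<d e. cscale (c i) (w e i s)) = 0 \<longrightarrow> (\<forall>i\<in>{..<d e}. c i = 0)"
      using \<open>finite E\<close> ind by (intro eventually_ball_finite) blast+
    then show ?thesis
    proof (rule eventually_mono)
      fix s assume s: "\<forall>e\<in>E. \<forall>c. (\<Sum>i<d e. cscale (c i) (w e i s)) = 0 \<longrightarrow> (\<forall>i\<in>{..<d e}. c i = 0)"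
      show "graded_basis (J s) (C s)"
        unfolding gb[OF J]
      proof
        fix e
        show "inj_on (C s e) {..<d e} \<and> cpoly.independent (C s e ` {..<d e}) \<and>
          cpoly.span (C s e ` {..<d e}) = graded_part (J s) e \<and> (\<forall>i\<ge>d e. C s e i = 0)"
        proof (cases "e \<in> E")
          case False
          then have "C s e = D s e" by (auto simp: C_def)
          then show ?thesis using D[of s] unfolding gb[OF J] by metis
        next
          case True
          obtain W where W: "finite W" "T n e \<subseteq> cpoly.span W" using T_spanned by blast
          have Cw: "C s e i = w e i s" if "i < d e" for i using that True by (simp add: C_def)
          have JW: "graded_part (J s) e \<subseteq> cpoly.span W" using HilbD(3)[OF J] W(2) by blast
          have img: "C s e ` {..<d e} \<subseteq> graded_part (J s) e" using w(1) Cw by auto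
          have crd: "card {..<d e} = cpoly.dim (graded_part (J s) e)" using dJ[OF J] by simp
          have rel: "\<forall>i\<in>{..<d e}. c i = 0" if "(\<Sum>i<d e. cscale (c i) (C s e i)) = 0" for c
            using s True that Cw by simp
          have "\<forall>i\<ge>d e. C s e i = 0" using True by (simp add: C_def)
          with cpoly.basis_from_family[OF subspace_J[OF J] JW W(1) finite_lessThan img crd rel]
          show ?thesis by blast
        qed
      qed
    qed
  qed
  have "(\<lambda>s. peval (basis_coords (C s)) f) \<longlonglongrightarrow> peval (basis_coords B) f"
    unfolding peval_def
  proof (intro tendsto_sum tendsto_mult tendsto_const tendsto_prod tendsto_power)
    fix m x assume mx: "m \<in> Poly_Mapping.keys f" "x \<in> Poly_Mapping.keys m"
    obtain e i a where x: "x = (e, i, a)" by (cases x) auto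
    have "e \<in> E" using mx x by (force simp: E_def X_def)
    show "(\<lambda>s. basis_coords (C s) x) \<longlonglongrightarrow> basis_coords B x"
    proof (cases "i < d e")
      case True
      then show ?thesis using w(2)[OF True] \<open>e \<in> E\<close> by (simp add: x basis_coords_def C_def coeff_lim_def)
    next
      case False
      then show ?thesis using B'(4)[of e i] \<open>e \<in> E\<close> by (simp add: x basis_coords_def C_def)
    qed
  qed
  then have ev2: "\<forall>\<^sub>F s in sequentially. peval (basis_coords (C s)) f \<noteq> 0"
    by (rule tendsto_imp_eventually_ne) (rule B(2))
  from ev1 ev2 show ?thesis
  proof eventually_elim
    case (elim s)
    then show ?case using J by (auto simp: Hilb_basic_open_def)
  qed
qed

text \<open>The topology is generated by the basic open sets, so eventual membership carries over to
  all open neighbourhoods by induction over their generation.\<close>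

theorem lim_ideal_in_closure:
  assumes J: "\<And>s. J s \<in> A" and A: "A \<subseteq> Hilb n r" and L: "lim_ideal n J \<in> Hilb n r"
  shows "lim_ideal n J \<in> Hilb_top n r closure_of A"
proof -
  have JH: "J s \<in> Hilb n r" for s using J A by blast
  have ev: "lim_ideal n J \<in> U \<longrightarrow> (\<forall>\<^sub>F s in sequentially. J s \<in> U)"
    if "generate_topology_on (range (Hilb_basic_open n r)) U" for U
    using that
  proof (induction U rule: generate_topology_on.induct)
    case Empty
    then show ?case by simp
  next
    case (Int a b)
    then show ?case by (auto intro: eventually_conj)
  next
    case (UN K)
    show ?case
    proof
      assume "lim_ideal n J \<in> \<Union>K"
      then obtain k where k: "k \<in> K" "lim_ideal n J \<in> k" by blast
      with UN have "\<forall>\<^sub>F s in sequentially. J s \<in> k" by blast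
      then show "\<forall>\<^sub>F s in sequentially. J s \<in> \<Union>K" by (rule eventually_mono) (use k in blast)
    qed
  next
    case (Basis s)
    then show ?case using basic_open_eventually[of J n r, OF JH] by blast
  qed
  show ?thesis
    unfolding in_closure_of topspace_Hilb
  proof (intro conjI L allI impI)
    fix U assume "lim_ideal n J \<in> U \<and> openin (Hilb_top n r) U"
    then have "\<forall>\<^sub>F s in sequentially. J s \<in> U"
      using ev[of U] unfolding Hilb_top_def openin_topology_generated_by_iff by blast
    then obtain s where "J s \<in> U" unfolding eventually_sequentially by blast
    then show "\<exists>y. y \<in> A \<and> y \<in> U" using J by blast
  qed
qed

subsection \<open>Rank conditions\<close>

lemma peval_det: "peval v (det A) = det (map_mat (peval v) A)"
proof -
  interpret comm_ring_hom "peval v :: 'a cpoly \<Rightarrow> complex"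
    by unfold_locales (simp_all add: peval_add peval_mult)
  show ?thesis by (rule hom_det[symmetric])
qed

lemma sum_singles_superset:
  fixes p :: "'v cpoly"
  assumes "finite M" "Poly_Mapping.keys p \<subseteq> M"
  shows "p = (\<Sum>m\<in>M. cscale (lk p m) (sg m 1))"
proof (rule poly_mapping_eqI)
  fix m
  have "lk (\<Sum>m\<in>M. cscale (lk p m) (sg m 1)) m = (\<Sum>a\<in>M. if a = m then lk p a else 0)"
    by (auto simp: lookup_sum cscale_lookup lookup_single when_def intro!: sum.cong)
  also have "\<dots> = lk p m" using assms by (auto simp: in_keys_iff)
  finally show "lk p m = lk (\<Sum>m\<in>M. cscale (lk p m) (sg m 1)) m" ..
qed

text \<open>Transversality to a fixed coordinate subspace is expressed by the nonvanishing of a maximal minor,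
  computed with respect to functionals adapted to the given ideal.\<close>

lemma openin_transversal:
  assumes "finite M"
  shows "openin (Hilb_top n r) {J \<in> Hilb n r. \<forall>p\<in>graded_part J e. Poly_Mapping.keys p \<subseteq> M \<longrightarrow> p = 0}"
    (is "openin _ ?U")
proof (subst openin_subopen, intro ballI)
  fix J assume "J \<in> ?U"
  then have J: "J \<in> Hilb n r" and JM: "\<And>p. p \<in> graded_part J e \<Longrightarrow> Poly_Mapping.keys p \<subseteq> M \<Longrightarrow> p = 0" by auto
  define N where "N = cpoly.dim (T n e) - min r (cpoly.dim (T n e))"
  have dJ: "cpoly.dim (graded_part K e) = N" if "K \<in> Hilb n r" for K
    using Hilb_dim[OF that, of e] by (simp add: N_def)
  obtain B where B: "graded_basis J B" using Hilb_graded_basis[OF J] by blast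
  define b where "b = B e"
  have b: "inj_on b {..<N}" "cpoly.independent (b ` {..<N})" "cpoly.span (b ` {..<N}) = graded_part J e"
    using B unfolding graded_basis_def Let_def b_def by (metis dJ[OF J])+
  define u :: "(nat \<Rightarrow>\<^sub>0 nat) \<Rightarrow> nat cpoly" where "u m = sg m 1" for m
  define S where "S = b ` {..<N} \<union> u ` M"
  \<comment> \<open>Transversality makes the basis of the degree \<open>e\<close> part of
    \<open>J\<close> and the monomials of \<open>M\<close> jointly independent.\<close>
  have rel: "\<forall>m\<in>M. c m = 0" if c: "(\<Sum>m\<in>M. cscale (c m) (u m)) \<in> cpoly.span (b ` {..<N})" for c
  proof
    fix m assume m: "m \<in> M"
    have lk: "lk (\<Sum>m\<in>M. cscale (c m) (u m)) a = (if a \<in> M then c a else 0)" for a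
      using assms by (auto simp: u_def lookup_sum cscale_lookup lookup_single when_def if_distrib[of "(*) _"] cong: if_cong)
    have "Poly_Mapping.keys (\<Sum>m\<in>M. cscale (c m) (u m)) \<subseteq> M"
      using lk by (auto simp: in_keys_iff split: if_splits)
    then have "(\<Sum>m\<in>M. cscale (c m) (u m)) = 0" using JM c b(3) by blast
    then show "c m = 0" using lk[of m] m by simp
  qed
  have S: "cpoly.independent S" "card S = N + card M"
    using cpoly.independent_Un_family[OF b(2) _ assms rel] card_image[OF b(1)] unfolding S_def by auto
  \<comment> \<open>The count \<open>card S = N + card M\<close> leaves no room for
    overlaps.\<close>
  have "card (u ` M) \<le> card M" by (rule card_image_le[OF assms])
  then have "card (b ` {..<N}) + card (u ` M) \<le> card S" using S(2) card_image[OF b(1)] by simp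
  moreover have "card S + card (b ` {..<N} \<inter> u ` M) = card (b ` {..<N}) + card (u ` M)"
    unfolding S_def using assms by (intro card_Un_Int[symmetric]) auto
  ultimately have "card (b ` {..<N} \<inter> u ` M) = 0" by linarith
  then have disj: "b ` {..<N} \<inter> u ` M = {}" by simp
  define E where "E = cpoly.extend_basis S"
  have E: "cpoly.independent E" "cpoly.span E = UNIV" "S \<subseteq> E"
    using cpoly.independent_extend_basis[OF S(1)] cpoly.span_extend_basis[OF S(1)]
      cpoly.extend_basis_superset[OF S(1)] by (simp_all add: E_def)
  \<comment> \<open>Coordinate functionals of the extended basis: \<open>l i\<close> is dual to
    \<open>b i\<close> and kills the monomials of \<open>M\<close>.\<close>
  define l where "l i p = cpoly.representation E p (b i)" for i p
  have l_sum: "l i (\<Sum>x\<in>X. cscale (c x) (g x)) = (\<Sum>x\<in>X. c x * l i (g x))" for i X c and g :: "'x \<Rightarrow> nat cpoly"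
    by (simp add: l_def cpoly.representation_sum[OF E(1)] cpoly.representation_scale[OF E(1)] E(2))
  have lb: "l i (b j) = (if i = j then 1 else 0)" if "i < N" "j < N" for i j
  proof -
    have "b j \<in> E" using that E(3) by (auto simp: S_def)
    then show ?thesis using b(1) that by (auto simp: l_def cpoly.representation_basis[OF E(1)] inj_on_def)
  qed
  have lu: "l i (u m) = 0" if "i < N" "m \<in> M" for i m
  proof -
    have "u m \<in> E" using that E(3) by (auto simp: S_def)
    moreover have "b i \<noteq> u m" using that disj by auto
    ultimately show ?thesis by (auto simp: l_def cpoly.representation_basis[OF E(1)])
  qed
  define X where "X = {m::nat \<Rightarrow>\<^sub>0 nat. Poly_Mapping.keys m \<subseteq> {..n} \<and> mon_degree m = e}"
  have X: "finite X" unfolding X_def by (rule finite_exps)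
  have lX: "l i p = (\<Sum>m\<in>X. lk p m * l i (u m))" if "p \<in> T n e" for i p
  proof -
    have "p = (\<Sum>m\<in>X. cscale (lk p m) (u m))"
      unfolding u_def by (rule sum_singles_superset[OF X]) (use T_keys[OF that] in \<open>simp add: X_def\<close>)
    then show ?thesis using l_sum[of i "lk p" u X] by metis
  qed
  \<comment> \<open>The matrix of the values \<open>l i (C e j)\<close> with the coordinates of the
    basis \<open>C\<close> left as variables; only the finitely many monomials in \<open>X\<close>
    occur.\<close>
  define A :: "(nat \<times> nat \<times> (nat \<Rightarrow>\<^sub>0 nat)) cpoly mat" where
    "A = mat N N (\<lambda>(i, j). \<Sum>m\<in>X. cscale (l i (u m)) (var (e, j, m)))"
  define f where "f = det A"
  have ev: "map_mat (peval (basis_coords C)) A = mat N N (\<lambda>(i, j). l i (C e j))"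
    if "\<And>j. j < N \<Longrightarrow> C e j \<in> T n e" for C
  proof (rule eq_matI)
    fix i j assume "i < dim_row (mat N N (\<lambda>(i, j). l i (C e j)))" "j < dim_col (mat N N (\<lambda>(i, j). l i (C e j)))"
    then have ij: "i < N" "j < N" by auto
    then show "map_mat (peval (basis_coords C)) A $$ (i, j) = mat N N (\<lambda>(i, j). l i (C e j)) $$ (i, j)"
      using lX[OF that[OF ij(2)], of i] by (simp add: A_def peval_sum basis_coords_def mult.commute)
  qed (auto simp: A_def)
  have basisT: "C e j \<in> T n e" if "graded_basis K C" "K \<in> Hilb n r" "j < N" for K C j
  proof -
    have "cpoly.span (C e ` {..<N}) = graded_part K e"
      using that(1) unfolding graded_basis_def Let_def by (metis dJ[OF that(2)])
    then have "C e j \<in> graded_part K e" using cpoly.span_superset[of "C e ` {..<N}"] that(3) by auto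
    then show ?thesis using HilbD(3)[OF that(2)] by blast
  qed
  have "J \<in> Hilb_basic_open n r f"
  proof -
    have "mat N N (\<lambda>(i, j). l i (B e j)) = 1\<^sub>m N" by (rule eq_matI) (auto simp: lb b_def[symmetric])
    then have "peval (basis_coords B) f = 1"
      unfolding f_def peval_det by (subst ev) (use basisT[OF B J] in auto)
    then show ?thesis using B J by (auto simp: Hilb_basic_open_def)
  qed
  moreover have "Hilb_basic_open n r f \<subseteq> ?U"
  proof
    fix K assume "K \<in> Hilb_basic_open n r f"
    then obtain C where K: "K \<in> Hilb n r" and C: "graded_basis K C" "peval (basis_coords C) f \<noteq> 0"
      by (auto simp: Hilb_basic_open_def)
    let ?A = "mat N N (\<lambda>(i, j). l i (C e j))"
    have det: "det ?A \<noteq> 0" using C(2) unfolding f_def peval_det by (subst (asm) ev) (use basisT[OF C(1) K] in auto)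
    have "p = 0" if p: "p \<in> graded_part K e" "Poly_Mapping.keys p \<subseteq> M" for p
    proof -
      have "cpoly.span (C e ` {..<N}) = graded_part K e"
        using C(1) unfolding graded_basis_def Let_def by (metis dJ[OF K])
      then obtain c where c: "p = (\<Sum>j<N. cscale (c j) (C e j))"
        using cpoly.span_image_finite[of "{..<N}" p "C e"] p(1) by auto
      \<comment> \<open>A form of \<open>K\<close> supported on \<open>M\<close> is killed by all
        \<open>l i\<close>, so its coefficient vector with respect to \<open>C\<close> lies in the
        kernel of an invertible matrix.\<close>
      have pM: "p = (\<Sum>m\<in>M. cscale (lk p m) (u m))"
        unfolding u_def by (rule sum_singles_superset[OF assms p(2)])
      have "l i p = 0" if "i < N" for i
        by (subst pM) (simp add: l_sum lu that)
      then have "?A *\<^sub>v vec N c = 0\<^sub>v N"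
        using c l_sum[of _ c "C e" "{..<N}"]
        by (intro eq_vecI) (auto simp: scalar_prod_def mult.commute lessThan_atLeast0)
      moreover have "vec N c = 0\<^sub>v N" if "?A *\<^sub>v vec N c = 0\<^sub>v N"
      proof -
        have A: "?A \<in> carrier_mat N N" by (rule mat_carrier)
        have v: "vec N c \<in> carrier_vec N" by (rule vec_carrier)
        show ?thesis
        proof (rule ccontr)
          assume "vec N c \<noteq> 0\<^sub>v N"
          with v that have "\<exists>v. v \<in> carrier_vec N \<and> v \<noteq> 0\<^sub>v N \<and> ?A *\<^sub>v v = 0\<^sub>v N"
            by (intro exI[of _ "vec N c"] conjI)
          from det_0_iff_vec_prod_zero_field[OF A, THEN iffD2, OF this] det show False by contradiction
        qed
      qed
      ultimately have "vec N c = 0\<^sub>v N" by blast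
      then have "c j = 0" if "j < N" for j using that by (metis index_vec index_zero_vec(1))
      then show "p = 0" by (simp add: c)
    qed
    then show "K \<in> ?U" using K by blast
  qed
  moreover have "openin (Hilb_top n r) (Hilb_basic_open n r f)"
    unfolding Hilb_top_def by (rule topology_generated_by_Basis) simp
  ultimately show "\<exists>V. openin (Hilb_top n r) V \<and> J \<in> V \<and> V \<subseteq> ?U" by blast
qed

subsection \<open>Apolarity\<close>

definition mfact :: "('v \<Rightarrow>\<^sub>0 nat) \<Rightarrow> complex" where
  "mfact m = (\<Prod>i\<in>Poly_Mapping.keys m. fact (lk m i))"

lemma mfact_superset: "finite A \<Longrightarrow> Poly_Mapping.keys m \<subseteq> A \<Longrightarrow> mfact m = (\<Prod>i\<in>A. fact (lk m i))"
  unfolding mfact_def by (rule prod.mono_neutral_left) (auto simp: in_keys_iff)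

lemma mfact_nonzero [simp]: "mfact m \<noteq> 0"
  by (simp add: mfact_def)

lemma lookup_pdiff:
  "lk (pdiff i F) m = of_nat (Suc (lk m i)) * lk F (m + sg i 1)"
proof -
  have "lk (pdiff i F) m = (\<Sum>a\<in>Poly_Mapping.keys F. if a = m + sg i 1 then of_nat (lk a i) * lk F a else 0)"
    unfolding pdiff_def lookup_sum
  proof (rule sum.cong)
    fix a
    show "lk (sg (a - sg i 1) (of_nat (lk a i) * lk F a)) m = (if a = m + sg i 1 then of_nat (lk a i) * lk F a else 0)"
    proof (cases "lk a i = 0")
      case True
      then have "a \<noteq> m + sg i 1" by (auto simp: lookup_add)
      then show ?thesis using True by simp
    next
      case False
      then have "(a - sg i 1) + sg i 1 = a"
        by (intro poly_mapping_eqI) (auto simp: lookup_add lookup_minus lookup_single when_def)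
      then have "a - sg i 1 = m \<longleftrightarrow> a = m + sg i 1" by (metis add_diff_cancel_right')
      then show ?thesis by (simp add: lookup_single when_def)
    qed
  qed simp
  also have "\<dots> = of_nat (Suc (lk m i)) * lk F (m + sg i 1)"
    by (auto simp: in_keys_iff lookup_add)
  finally show ?thesis .
qed

lemma lookup_pdiff_power:
  "lk ((pdiff i ^^ j) F) m = fact (lk m i + j) / fact (lk m i) * lk F (m + sg i j)"
proof (induction j arbitrary: m)
  case (Suc j)
  let ?a = "lk m i"
  have m: "m + sg i 1 + sg i j = m + sg i (Suc j)"
    by (simp add: add.assoc single_add[symmetric])
  have f: "fact (Suc ?a) = (of_nat (Suc ?a) * fact ?a :: complex)" by (rule fact_Suc)
  have "lk ((pdiff i ^^ Suc j) F) m = of_nat (Suc ?a) * (fact (Suc ?a + j) / fact (Suc ?a) * lk F (m + sg i (Suc j)))"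
    unfolding funpow.simps comp_def lookup_pdiff Suc.IH m by (simp only: lookup_add lookup_single_eq add_Suc add_Suc_right Nat.add_0_right One_nat_def)
  also have "of_nat (Suc ?a) * (fact (Suc ?a + j) / fact (Suc ?a) * lk F (m + sg i (Suc j))) =
      fact (?a + Suc j) / fact ?a * lk F (m + sg i (Suc j))"
    unfolding f using of_nat_neq_0[of ?a, where 'a = complex] by (simp del: of_nat_Suc fact_Suc)
  finally show ?case .
qed simp

lemma lookup_fold_pdiff:
  assumes "distinct xs"
  shows "lk (fold (\<lambda>i. pdiff i ^^ lk m i) xs F) a =
    (\<Prod>i\<in>set xs. fact (lk a i + lk m i) / fact (lk a i)) * lk F (a + (\<Sum>i\<in>set xs. sg i (lk m i)))"
  using assms
proof (induction xs arbitrary: F)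
  case (Cons x xs)
  let ?S = "\<Sum>i\<in>set xs. sg i (lk m i)"
  have x: "lk (a + ?S) x = lk a x"
    using Cons.prems by (auto simp: lookup_add lookup_sum lookup_single when_def)
  have "a + ?S + sg x (lk m x) = a + (\<Sum>i\<in>set (x # xs). sg i (lk m i))"
    using Cons.prems by (simp add: algebra_simps)
  then show ?case
    using Cons x by (simp add: lookup_pdiff_power)
qed simp

lemma lookup_mon_diff:
  "lk (mon_diff m F) a = mfact (a + m) / mfact a * lk F (a + m)"
proof -
  let ?K = "Poly_Mapping.keys a \<union> Poly_Mapping.keys m"
  have "(\<Prod>i\<in>Poly_Mapping.keys m. fact (lk a i + lk m i) / fact (lk a i) :: complex) =
    (\<Prod>i\<in>?K. fact (lk a i + lk m i) / fact (lk a i))"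
    by (rule prod.mono_neutral_left) (auto simp: in_keys_iff)
  also have "\<dots> = mfact (a + m) / mfact a"
    using Poly_Mapping.keys_add[of a m]
    by (simp add: mfact_superset[of ?K] lookup_add prod_dividef)
  finally have 1: "(\<Prod>i\<in>Poly_Mapping.keys m. fact (lk a i + lk m i) / fact (lk a i) :: complex) = mfact (a + m) / mfact a" .
  have "(\<Sum>i\<in>Poly_Mapping.keys m. sg i (lk m i)) = m"
    by (rule poly_mapping_eqI) (auto simp: lookup_sum lookup_single when_def in_keys_iff)
  with 1 show ?thesis
    unfolding mon_diff_def by (simp add: lookup_fold_pdiff)
qed

text \<open>The apolarity pairing, equal to the constant term of \<open>diff_act h F\<close>;
  \<open>mfact m\<close> arises from applying a differential monomial to the monomial with the same
  exponents.\<close>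

definition apolar :: "'v cpoly \<Rightarrow> 'v cpoly \<Rightarrow> complex" where
  "apolar F h = (\<Sum>m\<in>Poly_Mapping.keys h. lk h m * (mfact m * lk F m))"

lemma apolar_superset:
  "finite A \<Longrightarrow> Poly_Mapping.keys h \<subseteq> A \<Longrightarrow> apolar F h = (\<Sum>m\<in>A. lk h m * (mfact m * lk F m))"
  unfolding apolar_def by (rule sum.mono_neutral_left) (auto simp: in_keys_iff)

lemma apolar_0 [simp]: "apolar F 0 = 0" by (simp add: apolar_def)

lemma apolar_add: "apolar F (p + q) = apolar F p + apolar F q"
proof -
  let ?A = "Poly_Mapping.keys p \<union> Poly_Mapping.keys q"
  have "Poly_Mapping.keys (p + q) \<subseteq> ?A" by (rule Poly_Mapping.keys_add)
  then show ?thesis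
    by (simp add: apolar_superset[of ?A] lookup_add sum.distrib algebra_simps)
qed

lemma apolar_sum: "apolar F (sum f A) = (\<Sum>a\<in>A. apolar F (f a))"
  by (induction A rule: infinite_finite_induct) (auto simp: apolar_add)

lemma apolar_single [simp]: "apolar F (sg m c) = c * (mfact m * lk F m)"
  by (simp add: apolar_superset[of "{m}"])

lemma cscale_keys: "Poly_Mapping.keys (cscale c p) \<subseteq> Poly_Mapping.keys p"
  by (auto simp: in_keys_iff cscale_lookup)

lemma apolar_cscale: "apolar F (cscale c p) = c * apolar F p"
  using cscale_keys[of c p]
  by (simp add: apolar_superset[of "Poly_Mapping.keys p"] cscale_lookup sum_distrib_left mult.assoc)

lemma lookup_diff_act: "lk (diff_act h F) a = apolar F (sg a 1 * h) / mfact a"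
proof -
  have "sg a 1 * h = (\<Sum>m\<in>Poly_Mapping.keys h. sg (a + m) (lk h m))"
    by (subst sum_singles[of h]) (simp add: sum_distrib_left mult_single)
  then have "apolar F (sg a 1 * h) = (\<Sum>m\<in>Poly_Mapping.keys h. lk h m * (mfact (a + m) * lk F (a + m)))"
    by (simp add: apolar_sum)
  then show ?thesis
    by (simp add: diff_act_def lookup_sum cscale_lookup lookup_mon_diff sum_divide_distrib)
qed

text \<open>The coefficient of \<open>diff_act h F\<close> at \<open>a\<close> is, up to a nonzero
  factor, the pairing of \<open>F\<close> with a monomial multiple of \<open>h\<close>. Here
  \<open>a\<close> ranges over exponents in all variables.\<close>

lemma Ann_iff: "h \<in> Ann n F \<longleftrightarrow> h \<in> polys n \<and> (\<forall>a. apolar F (sg a 1 * h) = 0)"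
proof -
  have "diff_act h F = 0 \<longleftrightarrow> (\<forall>a. lk (diff_act h F) a = 0)"
    by (metis lookup_zero poly_mapping_eqI)
  then show ?thesis by (simp add: Ann_def lookup_diff_act)
qed

section \<open>The coefficients of the cubic \<open>F_form\<close>\<close>

definition tri :: "nat \<Rightarrow> nat \<Rightarrow> nat \<Rightarrow> nat \<Rightarrow>\<^sub>0 nat" where
  "tri u v w = sg u 1 + sg v 1 + sg w 1"

lemma lookup_tri: "lk (tri u v w) x = (if x = u then 1 else 0) + (if x = v then 1 else 0) + (if x = w then 1 else 0)"
  by (auto simp: tri_def lookup_add lookup_single when_def)

lemma tri_commute: "tri u v w = tri v u w" "tri u v w = tri u w v"
  by (auto simp: tri_def algebra_simps)

lemma mon_degree_tri [simp]: "mon_degree (tri u v w) = 3"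
  by (simp add: tri_def mon_degree_add)

lemma mval_tri: "mval x (tri u v w) = x u * x v * x w"
  by (simp add: tri_def mval_add)

lemma keys_tri: "Poly_Mapping.keys (tri u v w) = {u, v, w}"
  by (auto simp: in_keys_iff lookup_tri split: if_splits)

lemma split_monomial:
  assumes "mon_degree m = Suc d" "Poly_Mapping.keys m \<subseteq> {..n}"
  obtains i m' where "i \<le> n" "m = m' + sg i 1" "mon_degree m' = d" "Poly_Mapping.keys m' \<subseteq> {..n}"
proof -
  have "Poly_Mapping.keys m \<noteq> {}" using assms(1) by (auto simp: mon_degree_def)
  then obtain i where i: "i \<in> Poly_Mapping.keys m" by blast
  define m' where "m' = m - sg i 1"
  have m: "m = m' + sg i 1"
    using i unfolding m'_def by (intro poly_mapping_eqI) (auto simp: lookup_add lookup_minus lookup_single when_def in_keys_iff)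
  have "Poly_Mapping.keys m' \<subseteq> Poly_Mapping.keys m" by (auto simp: m in_keys_iff lookup_add)
  moreover have "mon_degree m' = d" using assms(1) by (simp add: m mon_degree_add)
  ultimately show ?thesis using that[of i m'] i m assms(2) by auto
qed

lemma cubic_monomial:
  assumes "mon_degree m = 3" "Poly_Mapping.keys m \<subseteq> {..n}"
  obtains u v w where "u \<le> n" "v \<le> n" "w \<le> n" "m = tri u v w"
proof -
  obtain u m1 where u: "u \<le> n" "m = m1 + sg u 1" "mon_degree m1 = 2" "Poly_Mapping.keys m1 \<subseteq> {..n}"
    using split_monomial[of m 2 n] assms by (metis eval_nat_numeral(3))
  obtain v m2 where v: "v \<le> n" "m1 = m2 + sg v 1" "mon_degree m2 = 1" "Poly_Mapping.keys m2 \<subseteq> {..n}"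
    using split_monomial[of m1 1 n] u by (metis Suc_1)
  obtain w m3 where w: "w \<le> n" "m2 = m3 + sg w 1" "mon_degree m3 = 0" "Poly_Mapping.keys m3 \<subseteq> {..n}"
    using split_monomial[of m2 0 n] v by (metis One_nat_def)
  have "lk m3 i = 0" for i using w(3) by (auto simp: mon_degree_def in_keys_iff)
  then have "m3 = 0" by (intro poly_mapping_eqI) simp
  then have "m = tri u v w" using u v w by (simp add: tri_def algebra_simps)
  then show ?thesis using that u v w by blast
qed

lemma lookup_F_form:
  "lk (F_form k) m = (\<Sum>i=0..k. if m = tri (3*i) (3*i+1) (3*i+1) then 1 else 0) +
     (\<Sum>i<k. if m = tri (3*i+2) (3*i+1) (3*i+4) then 1 else 0)"
proof -
  have 1: "var (3*i) * var (3*i+1) ^ 2 = sg (tri (3*i) (3*i+1) (3*i+1)) (1::complex)" for i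
    by (simp add: var_def power2_eq_square mult_single tri_def algebra_simps)
  have 2: "var (3*Suc i-2) * var (3*Suc i-1) * var (3*Suc i+1) = sg (tri (3*i+2) (3*i+1) (3*i+4)) (1::complex)" for i
  proof -
    have "3*Suc i-2 = 3*i+1" "3*Suc i-1 = 3*i+2" "3*Suc i+1 = 3*i+4" by simp_all
    then show ?thesis unfolding var_def by (simp only: mult_single tri_def) (simp add: algebra_simps)
  qed
  have "F_form k = (\<Sum>i=0..k. sg (tri (3*i) (3*i+1) (3*i+1)) 1) + (\<Sum>i<k. sg (tri (3*i+2) (3*i+1) (3*i+4)) 1)"
    unfolding F_form_def 1
    by (simp only: 2[symmetric]) (simp add: sum.atLeast1_atMost_eq)
  then show ?thesis by (simp add: lookup_add lookup_sum lookup_single when_def eq_commute)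
qed

text \<open>The degree in the variables
  \<open>b\<^sub>i = x\<^sub>3\<^sub>i\<^sub>+\<^sub>1\<close>. It is 2 on every monomial of the
  cubic, which is therefore linear in the remaining variables.\<close>

definition bcount :: "(nat \<Rightarrow>\<^sub>0 nat) \<Rightarrow> nat" where
  "bcount m = (\<Sum>v | v \<in> Poly_Mapping.keys m \<and> v mod 3 = 1. lk m v)"

lemma bcount_tri:
  "bcount (tri u v w) = (if u mod 3 = 1 then 1 else 0) + (if v mod 3 = 1 then 1 else 0) + (if w mod 3 = 1 then 1 else 0)"
proof -
  have "bcount (tri u v w) = (\<Sum>x\<in>{u,v,w}. if x mod 3 = 1 then lk (tri u v w) x else 0)"
    unfolding bcount_def keys_tri by (rule sum.inter_filter) simp
  also have "\<dots> = (\<Sum>x\<in>{u,v,w}. (if x = u then (if u mod 3 = 1 then 1 else 0) else 0) +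
     (if x = v then (if v mod 3 = 1 then 1 else 0) else 0) + (if x = w then (if w mod 3 = 1 then 1 else 0) else 0))"
    by (rule sum.cong) (auto simp: lookup_tri)
  also have "\<dots> = (if u mod 3 = 1 then 1 else 0) + (if v mod 3 = 1 then 1 else 0) + (if w mod 3 = 1 then 1 else 0)"
    unfolding sum.distrib by simp
  finally show ?thesis .
qed

lemma F_form_monomials:
  assumes "lk (F_form k) m \<noteq> 0"
  obtains i where "i \<le> k" "m = tri (3*i) (3*i+1) (3*i+1)" | i where "i < k" "m = tri (3*i+2) (3*i+1) (3*i+4)"
proof (cases "\<exists>i\<le>k. m = tri (3*i) (3*i+1) (3*i+1)")
  case False
  then have "(\<Sum>i=0..k. if m = tri (3*i) (3*i+1) (3*i+1) then 1 else 0 :: complex) = 0"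
    by (intro sum.neutral) auto
  then have l: "lk (F_form k) m = (\<Sum>i<k. if m = tri (3*i+2) (3*i+1) (3*i+4) then 1 else 0)"
    unfolding lookup_F_form by (simp only: add_0)
  have "\<exists>i<k. m = tri (3*i+2) (3*i+1) (3*i+4)"
  proof (rule ccontr)
    assume "\<not> ?thesis"
    then have "lk (F_form k) m = 0" unfolding l by (intro sum.neutral) auto
    with assms show False by contradiction
  qed
  then show ?thesis using that(2) by blast
qed (use that(1) in blast)

lemma F_form_bcount: "lk (F_form k) m \<noteq> 0 \<Longrightarrow> bcount m = 2"
proof (erule F_form_monomials)
  have mods: "(3 * i + 2) mod 3 = 2" "(3 * i + 1) mod 3 = 1" "(3 * i + 4) mod 3 = 1" for i :: nat by presburger+
  show "bcount m = 2" if "m = tri (3*i) (3*i+1) (3*i+1)" for i using mods(2)[of i] that by (simp add: bcount_tri)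
  show "bcount m = 2" if "m = tri (3*i+2) (3*i+1) (3*i+4)" for i using mods[of i] that by (simp add: bcount_tri)
qed

lemma F_form_degree: "lk (F_form k) m \<noteq> 0 \<Longrightarrow> mon_degree m = 3 \<and> Poly_Mapping.keys m \<subseteq> {..3*k+1}"
  by (erule F_form_monomials) (auto simp: keys_tri)

lemma mfact_tri:
  assumes "u \<noteq> v" "u \<noteq> w"
  shows "mfact (tri u v w) = (if v = w then 2 else 1)"
proof -
  have "mfact (tri u v w) = (\<Prod>x\<in>{u, v, w}. fact (lk (tri u v w) x))"
    by (simp add: mfact_def keys_tri)
  also have "\<dots> = (if v = w then 2 else 1)"
    using assms by (auto simp: lookup_tri)
  finally show ?thesis .
qed

text \<open>These are the third derivatives of the cubic by one variable outside the
  \<open>b\<^sub>i\<close> and two of the \<open>b\<^sub>i\<close>. The value 2 for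
  \<open>i = j\<close> is the factorial of the square; the two off-diagonal cases express the
  symmetry in \<open>i\<close> and \<open>j\<close>.\<close>

lemma apolar_F_form_tri:
  assumes "i \<le> k" "j \<le> k" "a mod 3 \<noteq> 1"
  shows "mfact (tri a (3*i+1) (3*j+1)) * lk (F_form k) (tri a (3*i+1) (3*j+1)) =
    (if i = j \<and> a = 3*i then 2 else if (j = Suc i \<and> a = 3*i+2) \<or> (i = Suc j \<and> a = 3*j+2) then 1 else 0)"
proof -
  have ne: "a \<noteq> 3*x+1" "a \<noteq> 3*x+4" for x using assms(3) by presburger+
  have 1: "tri a (3*i+1) (3*j+1) = tri (3*l) (3*l+1) (3*l+1) \<longleftrightarrow> i = l \<and> j = l \<and> a = 3*l" for l
  proof
    assume eq: "tri a (3*i+1) (3*j+1) = tri (3*l) (3*l+1) (3*l+1)"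
    have "lk (tri a (3*i+1) (3*j+1)) (3*l+1) = 2" unfolding eq by (simp add: lookup_tri)
    then have "i = l \<and> j = l" using ne[of l] by (auto simp: lookup_tri split: if_splits)
    moreover have "lk (tri a (3*i+1) (3*j+1)) (3*l) = 1" unfolding eq by (simp add: lookup_tri)
    moreover have "3*l \<noteq> 3*i+1" "3*l \<noteq> 3*j+1" by presburger+
    ultimately show "i = l \<and> j = l \<and> a = 3*l" by (auto simp: lookup_tri split: if_splits)
  qed auto
  \<comment> \<open>The exponents at \<open>3*l+1\<close>, \<open>3*l+4\<close> and
    \<open>3*l+2\<close> recover the factors; \<open>a\<close> cannot account for the first two, as
    it is not 1 modulo 3.\<close>
  have 2: "tri a (3*i+1) (3*j+1) = tri (3*l+2) (3*l+1) (3*l+4) \<longleftrightarrow>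
     (i = l \<and> j = Suc l \<or> i = Suc l \<and> j = l) \<and> a = 3*l+2" for l
  proof
    assume eq: "tri a (3*i+1) (3*j+1) = tri (3*l+2) (3*l+1) (3*l+4)"
    have sym: "3*l+1 \<noteq> a" "3*l+4 \<noteq> a" using ne[of l] by auto
    have "lk (tri a (3*i+1) (3*j+1)) (3*l+1) = 1" unfolding eq by (simp add: lookup_tri)
    then have e1: "(if l = i then 1 else 0) + (if l = j then 1 else 0) = (1::nat)"
      unfolding lookup_tri using sym(1) by simp
    have "lk (tri a (3*i+1) (3*j+1)) (3*l+4) = 1" unfolding eq by (simp add: lookup_tri)
    moreover have "3*l+4 = 3*i+1 \<longleftrightarrow> Suc l = i" "3*l+4 = 3*j+1 \<longleftrightarrow> Suc l = j" by presburger+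
    ultimately have e2: "(if Suc l = i then 1 else 0) + (if Suc l = j then 1 else 0) = (1::nat)"
      unfolding lookup_tri using sym(2) by simp
    have "(i = l \<and> j = Suc l \<or> i = Suc l \<and> j = l)"
      using e1 e2 by (cases "l = i"; cases "l = j"; cases "Suc l = i"; cases "Suc l = j") simp_all
    moreover have "lk (tri a (3*i+1) (3*j+1)) (3*l+2) = 1" unfolding eq by (simp add: lookup_tri)
    moreover have "3*l+2 \<noteq> 3*i+1" "3*l+2 \<noteq> 3*j+1" by presburger+
    ultimately show "(i = l \<and> j = Suc l \<or> i = Suc l \<and> j = l) \<and> a = 3*l+2"
      by (auto simp: lookup_tri split: if_splits)
  next
    have "3 * Suc l + 1 = 3*l+4" by simp
    then show "(i = l \<and> j = Suc l \<or> i = Suc l \<and> j = l) \<and> a = 3*l+2 \<Longrightarrow>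
        tri a (3*i+1) (3*j+1) = tri (3*l+2) (3*l+1) (3*l+4)"
      using tri_commute(2)[of a "3*l+4" "3*l+1"] by (auto simp: add.commute)
  qed
  have 3: "(\<Sum>l=0..k. if i = l \<and> j = l \<and> a = 3*l then 1 else 0) = (if i = j \<and> a = 3*i then 1 else 0 :: complex)"
  proof -
    have "(\<Sum>l=0..k. if i = l \<and> j = l \<and> a = 3*l then 1 else 0) = (\<Sum>l=0..k. if l = i then (if i = j \<and> a = 3*i then 1 else 0) else 0 :: complex)"
      by (rule sum.cong) auto
    then show ?thesis using assms(1) by simp
  qed
  have 4: "(\<Sum>l<k. if (i = l \<and> j = Suc l \<or> i = Suc l \<and> j = l) \<and> a = 3*l+2 then 1 else 0) =
    (if (j = Suc i \<and> a = 3*i+2) \<or> (i = Suc j \<and> a = 3*j+2) then 1 else 0 :: complex)"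
  proof -
    \<comment> \<open>Only the summand \<open>l = min i j\<close> can contribute.\<close>
    have "(\<Sum>l<k. if (i = l \<and> j = Suc l \<or> i = Suc l \<and> j = l) \<and> a = 3*l+2 then 1 else 0) =
      (\<Sum>l<k. if l = min i j then (if (j = Suc i \<and> a = 3*i+2) \<or> (i = Suc j \<and> a = 3*j+2) then 1 else 0) else 0 :: complex)"
      by (rule sum.cong) auto
    then show ?thesis using assms(1,2) by auto
  qed
  have "lk (F_form k) (tri a (3*i+1) (3*j+1)) = (if i = j \<and> a = 3*i then 1 else 0) +
    (if (j = Suc i \<and> a = 3*i+2) \<or> (i = Suc j \<and> a = 3*j+2) then 1 else 0)"
    unfolding lookup_F_form 1 2 3 4 ..
  then show ?thesis using mfact_tri[of a "3*i+1" "3*j+1"] ne by auto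
qed

subsection \<open>Ideals of points\<close>

definition line :: "(nat \<Rightarrow> complex) \<Rightarrow> (nat \<Rightarrow> complex) set" where
  "line v = (\<lambda>c i. c * v i) ` UNIV"

lemma peval_homogeneous:
  assumes "\<And>m. lk p m \<noteq> 0 \<Longrightarrow> mon_degree m = e"
  shows "peval (\<lambda>i. c * v i) p = c ^ e * peval v p"
proof -
  have "peval (\<lambda>i. c * v i) p = (\<Sum>m\<in>Poly_Mapping.keys p. lk p m * (c ^ e * mval v m))"
    unfolding peval_superset[OF finite_keys subset_refl]
    by (rule sum.cong) (use assms in \<open>auto simp: mval_scale in_keys_iff\<close>)
  also have "\<dots> = c ^ e * peval v p"
    by (simp add: peval_superset[OF finite_keys subset_refl] sum_distrib_left algebra_simps)
  finally show ?thesis .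
qed

text \<open>Homogeneity allows testing on one representative vector per point.\<close>

lemma vanishing_ideal_lines:
  "p \<in> vanishing_ideal n (line ` V) \<longleftrightarrow> p \<in> polys n \<and> (\<forall>e. \<forall>v\<in>V. peval v (hom_component e p) = 0)"
    (is "?L \<longleftrightarrow> ?R")
proof
  assume L: ?L
  have "v \<in> line v" for v using rangeI[of "\<lambda>c i. c * v i" 1] by (simp add: line_def)
  then show ?R using L by (auto simp: vanishing_ideal_def)
next
  assume R: ?R
  have "peval (\<lambda>i. c * v i) (hom_component e p) = 0" if "v \<in> V" for c v e
    using R that by (subst peval_homogeneous[where e = e]) (auto simp: lookup_hom split: if_splits)
  then show ?L using R by (auto simp: vanishing_ideal_def line_def)
qed

lemma homogeneous_vanishing_ideal: "homogeneous_ideal n (vanishing_ideal n (line ` V))"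
proof -
  let ?I = "vanishing_ideal n (line ` V)"
  have "?I \<subseteq> polys n" by (auto simp: vanishing_ideal_def)
  moreover have "hom_component e (0::nat cpoly) = 0" for e by (rule poly_mapping_eqI) (simp add: lookup_hom)
  then have "0 \<in> ?I" by (simp add: vanishing_ideal_lines polys_closed)
  moreover have "p + q \<in> ?I" if "p \<in> ?I" "q \<in> ?I" for p q
    using that by (simp add: vanishing_ideal_lines polys_closed hom_component_add peval_add)
  moreover have "h * p \<in> ?I" if "p \<in> ?I" "h \<in> polys n" for p h
    using that by (simp add: vanishing_ideal_lines polys_closed hom_component_mult peval_sum peval_mult)
  moreover have "hom_component e p \<in> ?I" if "p \<in> ?I" for p e
  proof -
    have "hom_component d (hom_component e p) = (if d = e then hom_component e p else 0)" for d
      by (rule hom_component_self) (simp add: lookup_hom split: if_splits)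
    then show ?thesis using that by (simp add: vanishing_ideal_lines hom_component_polys)
  qed
  ultimately show ?thesis unfolding homogeneous_ideal_def ideal_poly_ring_iff by blast
qed

lemma lookup_mult_degree:
  assumes "\<And>m. lk p m \<noteq> 0 \<Longrightarrow> mon_degree m = d" "\<And>m. lk q m \<noteq> 0 \<Longrightarrow> mon_degree m = e"
  shows "lk (p * q) m \<noteq> 0 \<Longrightarrow> mon_degree m = d + e"
proof -
  assume "lk (p * q) m \<noteq> 0"
  then have "m \<in> Poly_Mapping.keys (p * q)" by (simp add: in_keys_iff)
  then obtain a b where "m = a + b" "a \<in> Poly_Mapping.keys p" "b \<in> Poly_Mapping.keys q"
    using keys_mult[of p q] by blast
  then show ?thesis using assms(1)[of a] assms(2)[of b] by (simp add: mon_degree_add in_keys_iff)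
qed

lemma T_mult: "p \<in> T n d \<Longrightarrow> q \<in> T n e \<Longrightarrow> p * q \<in> T n (d + e)"
  using lookup_mult_degree[of p d q e] by (auto simp: graded_part_iff polys_closed)

lemma T_1: "1 \<in> T n 0"
  by (auto simp: graded_part_iff polys_closed lookup_one when_def)

lemma T_power: "p \<in> T n 1 \<Longrightarrow> p ^ e \<in> T n e"
  by (induction e) (use T_1 T_mult[of p n 1] in auto)

lemma T_var: "i \<le> n \<Longrightarrow> var i \<in> T n 1"
  by (auto simp: graded_part_iff polys_iff var_def lookup_single when_def split: if_splits)

lemma T_sum: "(\<And>a. a \<in> A \<Longrightarrow> f a \<in> T n e) \<Longrightarrow> sum f A \<in> T n e"
  by (rule cpoly.subspace_sum[OF subspace_polys])

lemma T_cscale: "p \<in> T n e \<Longrightarrow> cscale c p \<in> T n e"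
  by (rule cpoly.subspace_scale[OF subspace_polys])

lemma dim_T_0: "cpoly.dim (T n 0) \<le> 1"
proof -
  have "T n 0 \<subseteq> cpoly.span {1}"
  proof
    fix p assume p: "p \<in> T n 0"
    have "mon_degree m = 0 \<Longrightarrow> m = 0" for m :: "nat \<Rightarrow>\<^sub>0 nat"
      by (rule poly_mapping_eqI) (auto simp: mon_degree_def in_keys_iff)
    then have "lk p m \<noteq> 0 \<Longrightarrow> m = 0" for m using p by (auto simp: graded_part_iff)
    then have "p = cscale (lk p 0) 1"
      by (intro poly_mapping_eqI) (auto simp: cscale_lookup lookup_one when_def)
    then show "p \<in> cpoly.span {1}" by (metis cpoly.span_base cpoly.span_scale singletonI)
  qed
  then show ?thesis using cpoly.dim_le_card[of "T n 0" "{1}"] by simp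
qed

text \<open>Linear forms \<open>L x\<close> dual to the points express that their representatives
  are linearly independent. In degree \<open>e > 0\<close> the powers \<open>L x ^ e\<close> are
  again dual to the points, so the \<open>r\<close> points impose independent conditions on
  forms.\<close>

lemma vanishing_ideal_Hilb:
  assumes X: "finite X" "card X = r" "X \<noteq> {}"
    and L: "\<And>x. x \<in> X \<Longrightarrow> L x \<in> T n 1" "\<And>x y. x \<in> X \<Longrightarrow> y \<in> X \<Longrightarrow> peval (P y) (L x) = (if x = y then 1 else 0)"
  shows "vanishing_ideal n (line ` (P ` X)) \<in> Hilb n r"
proof (rule Hilb_from_dim[OF homogeneous_vanishing_ideal])
  fix e
  let ?I = "vanishing_ideal n (line ` (P ` X))"
  have id: "ideal ?I (poly_ring n)" using homogeneous_vanishing_ideal by (simp add: homogeneous_ideal_def)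
  have I: "p \<in> graded_part ?I e \<longleftrightarrow> p \<in> T n e \<and> (\<forall>x\<in>X. peval (P x) p = 0)" for p e
  proof -
    have "p \<in> ?I \<longleftrightarrow> (\<forall>x\<in>X. peval (P x) p = 0)" if pT: "p \<in> T n e"
    proof -
      have h: "hom_component d p = (if d = e then p else 0)" for d
        using pT by (intro hom_component_self) (simp add: graded_part_iff)
      have "(\<forall>d. \<forall>v\<in>P ` X. peval v (hom_component d p) = 0) \<longleftrightarrow> (\<forall>x\<in>X. peval (P x) p = 0)"
        unfolding h by auto
      then show ?thesis using pT unfolding vanishing_ideal_lines graded_part_iff by blast
    qed
    moreover have "?I \<subseteq> polys n" by (auto simp: vanishing_ideal_def)
    ultimately show ?thesis unfolding graded_part_iff by blast
  qed
  obtain W where W: "finite W" "T n e \<subseteq> cpoly.span W" using T_spanned by blast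
  have sub: "graded_part ?I e \<subseteq> T n e" using I by blast
  have pw: "(0::complex) ^ e = 0" if "e \<noteq> 0" using that by simp
  show "cpoly.dim (graded_part ?I e) + min r (cpoly.dim (T n e)) = cpoly.dim (T n e)"
  \<comment> \<open>In degree 0 the powers are all 1 and no longer separate points; there the ideal
    is zero, and the dimension of \<open>T n 0\<close> is at most 1 and hence at most
    \<open>r\<close>.\<close>
  proof (cases "e = 0")
    case True
    have "p = 0" if "p \<in> graded_part ?I 0" for p
    proof (rule poly_mapping_eqI)
      fix m
      have p: "p \<in> T n 0" "\<forall>x\<in>X. peval (P x) p = 0" using I that by blast+
      have d0: "mon_degree m = 0 \<Longrightarrow> m = 0" for m :: "nat \<Rightarrow>\<^sub>0 nat"
        by (rule poly_mapping_eqI) (auto simp: mon_degree_def in_keys_iff)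
      have "Poly_Mapping.keys p \<subseteq> {0}" using p(1) d0 by (auto simp: graded_part_def)
      then have "peval v p = lk p 0" for v by (simp add: peval_superset[of "{0}"])
      then have "lk p 0 = 0" using p(2) X(3) by auto
      moreover have "lk p m = 0" if "m \<noteq> 0" using p(1) d0 that by (auto simp: graded_part_iff)
      ultimately show "lk p m = lk 0 m" by auto
    qed
    then have "graded_part ?I 0 \<subseteq> cpoly.span {}" by auto
    then have "cpoly.dim (graded_part ?I 0) = 0" using cpoly.dim_le_card[of "graded_part ?I 0" "{}"] by simp
    moreover have "r \<ge> 1" using X by (simp add: Suc_leI card_gt_0_iff flip: X(2))
    ultimately show ?thesis using dim_T_0[of n] True by simp
  next
    case False
    have ev: "peval (P y) (L x ^ e) = (if x = y then 1 else 0)" if "x \<in> X" "y \<in> X" for x y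
      using L(2)[OF that] False by (simp add: peval_power)
    have evs: "peval (P y) (\<Sum>x\<in>X. cscale (c x) (L x ^ e)) = c y" if "y \<in> X" for c y
    proof -
      have "peval (P y) (\<Sum>x\<in>X. cscale (c x) (L x ^ e)) = (\<Sum>x\<in>X. if x = y then c x else 0)"
        unfolding peval_sum by (rule sum.cong) (use ev that in auto)
      then show ?thesis using X(1) that by simp
    qed
    have "cpoly.dim (T n e) = cpoly.dim (graded_part ?I e) + card X"
    proof (rule cpoly.dim_add_family_eq[OF subspace_graded_part[OF id] subspace_polys sub W(2,1) X(1)])
      show "(\<lambda>x. L x ^ e) ` X \<subseteq> T n e" using L(1) T_power by blast
      fix c assume "(\<Sum>x\<in>X. cscale (c x) (L x ^ e)) \<in> graded_part ?I e"
      then show "\<forall>x\<in>X. c x = 0" using I evs by auto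
    next
      fix v assume v: "v \<in> T n e"
      let ?s = "\<Sum>x\<in>X. cscale (peval (P x) v) (L x ^ e)"
      have "?s \<in> T n e" using L(1) by (intro T_sum T_cscale T_power)
      then have "v - ?s \<in> T n e" using v cpoly.subspace_diff[OF subspace_polys] by blast
      moreover have "peval (P y) (v - ?s) = 0" if "y \<in> X" for y
        using evs[OF that, of "\<lambda>x. peval (P x) v"] peval_add[of "P y" "v - ?s" ?s] by simp
      ultimately show "\<exists>c. v - (\<Sum>x\<in>X. cscale (c x) (L x ^ e)) \<in> graded_part ?I e"
        using I by (intro exI[of _ "\<lambda>x. peval (P x) v"]) auto
    qed
    then show ?thesis using X(2) by simp
  qed
qed

text \<open>The dual forms show that the representatives are nonzero and that no two of them are
  proportional.\<close>

lemma lines_proj_space: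
  assumes X: "finite X" "card X = r"
    and P: "\<And>x i. x \<in> X \<Longrightarrow> i > n \<Longrightarrow> P x i = 0"
    and L: "\<And>x. x \<in> X \<Longrightarrow> L x \<in> T n 1" "\<And>x y. x \<in> X \<Longrightarrow> y \<in> X \<Longrightarrow> peval (P y) (L x) = (if x = y then 1 else 0)"
  shows "line ` (P ` X) \<subseteq> proj_space n" "card (line ` (P ` X)) = r"
proof -
  have scale: "peval (\<lambda>i. c * v i) (L x) = c * peval v (L x)" if "x \<in> X" for c v x
    using peval_homogeneous[of "L x" 1 c v] L(1)[OF that] by (simp add: graded_part_iff)
  have zero: "peval (\<lambda>_. 0) (L x) = 0" if "x \<in> X" for x
    using scale[OF that, of 0 "\<lambda>_. 0"] by simp
  have nz: "P x \<noteq> (\<lambda>_. 0)" if "x \<in> X" for x using zero[OF that] L(2)[OF that that] by auto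
  show "line ` (P ` X) \<subseteq> proj_space n"
    using P nz unfolding proj_space_def line_def by blast
  have "x = y" if xy: "x \<in> X" "y \<in> X" "line (P x) = line (P y)" for x y
  proof (rule ccontr)
    assume "x \<noteq> y"
    have "P x \<in> line (P x)" using rangeI[of "\<lambda>c i. c * P x i" 1] by (simp add: line_def)
    then obtain c where "P x = (\<lambda>i. c * P y i)" using xy(3) by (auto simp: line_def)
    then have "peval (P x) (L x) = c * peval (P y) (L x)" using scale[OF xy(1)] by metis
    then show False using L(2)[OF xy(1)] xy \<open>x \<noteq> y\<close> by simp
  qed
  then have "inj_on (\<lambda>x. line (P x)) X" by (auto simp: inj_on_def)
  then have "card ((\<lambda>x. line (P x)) ` X) = r" using X by (simp add: card_image)
  then show "card (line ` (P ` X)) = r" by (simp add: image_image)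
qed

text \<open>The sums in the last hypothesis pair \<open>m\<close> with one sixth of the combination,
  with coefficients \<open>c s x\<close>, of the cubes of the linear forms with coefficient vectors
  \<open>P s x\<close>. Cubics vanishing at the points pair to zero with it, so convergence to the
  pairings of \<open>F\<close> puts the limit ideal inside \<open>Ann n F\<close>. Vanishing at the
  points passes to the limit as well.\<close>

lemma lim_ideal_Slip_Ann:
  fixes P :: "nat \<Rightarrow> 'x \<Rightarrow> nat \<Rightarrow> complex"
  assumes X: "finite X" "card X = r" "X \<noteq> {}"
    and P: "\<And>s x i. x \<in> X \<Longrightarrow> i > n \<Longrightarrow> P s x i = 0"
    and L: "\<And>s x. x \<in> X \<Longrightarrow> L s x \<in> T n 1"
      "\<And>s x y. x \<in> X \<Longrightarrow> y \<in> X \<Longrightarrow> peval (P s y) (L s x) = (if x = y then 1 else 0)"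
    and V: "\<And>x i. x \<in> X \<Longrightarrow> (\<lambda>s. P s x i) \<longlonglongrightarrow> V x i"
    and F: "\<And>m. lk F m \<noteq> 0 \<Longrightarrow> mon_degree m = 3 \<and> Poly_Mapping.keys m \<subseteq> {..n}"
    and M: "\<And>m. mon_degree m = 3 \<Longrightarrow> Poly_Mapping.keys m \<subseteq> {..n} \<Longrightarrow>
       (\<lambda>s. \<Sum>x\<in>X. c s x * mval (P s x) m) \<longlonglongrightarrow> mfact m * lk F m"
  obtains J where "J \<in> border_VSP n F r" "\<And>p e x. p \<in> graded_part J e \<Longrightarrow> x \<in> X \<Longrightarrow> peval (V x) p = 0"
proof -
  define I where "I s = vanishing_ideal n (line ` (P s ` X))" for s
  define A where "A = {J \<in> Hilb n r. \<exists>\<Gamma>\<subseteq>proj_space n. finite \<Gamma> \<and> card \<Gamma> = r \<and> J = vanishing_ideal n \<Gamma>}"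
  have IH: "I s \<in> Hilb n r" for s
    unfolding I_def by (rule vanishing_ideal_Hilb[of X r "L s" n "P s"]) (use X L in auto)
  have IA: "I s \<in> A" for s
  proof -
    have "line ` (P s ` X) \<subseteq> proj_space n" "card (line ` (P s ` X)) = r"
      by (rule lines_proj_space[of X r n "P s" "L s", OF X(1,2) P L]; assumption)+
    then show ?thesis using IH[of s] X(1) unfolding A_def I_def by blast
  qed
  obtain \<rho> :: "nat \<Rightarrow> nat" where \<rho>: "strict_mono \<rho>" "lim_ideal n (\<lambda>s. I (\<rho> s)) \<in> Hilb n r"
    by (rule Hilb_seq_compact[of I n r, OF IH]) (rule that)
  define J where "J = lim_ideal n (\<lambda>s. I (\<rho> s))"
  have JH: "J \<in> Hilb n r" using \<rho>(2) by (simp add: J_def)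
  have "J \<in> Slip n r"
    unfolding Slip_def A_def[symmetric] J_def by (rule lim_ideal_in_closure[OF IA _ \<rho>(2)]) (auto simp: A_def)
  moreover have "J \<subseteq> Ann n F"
  proof
    fix h assume h: "h \<in> J"
    have hn: "h \<in> polys n" using HilbD(2)[OF JH] h by blast
    have "apolar F (sg a 1 * h) = 0" for a
    proof (cases "Poly_Mapping.keys a \<subseteq> {..n}")
      case False
      have "lk F m = 0" if mk: "m \<in> Poly_Mapping.keys (sg a 1 * h)" for m
      proof -
        obtain b where "m = a + b" using mk keys_mult[of "sg a 1" h] by auto
        then have "Poly_Mapping.keys a \<subseteq> Poly_Mapping.keys m" by (auto simp: in_keys_iff lookup_add)
        then show ?thesis using F[of m] False by blast
      qed
      then show ?thesis by (simp add: apolar_def)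
    next
      case True
      define g where "g = sg a 1 * h"
      have "sg a (1::complex) \<in> polys n" using True by (simp add: polys_def)
      then have "g \<in> J" using HilbD(5)[OF JH h] by (simp add: g_def)
      then obtain q where q: "\<And>s. q s \<in> I (\<rho> s)" "coeff_lim q g" and gn: "g \<in> polys n"
        by (auto simp: J_def lim_ideal_def)
      \<comment> \<open>As \<open>F\<close> is a cubic, only the coefficients in degree 3 enter the
        pairing.\<close>
      let ?M = "{m::nat \<Rightarrow>\<^sub>0 nat. Poly_Mapping.keys m \<subseteq> {..n} \<and> mon_degree m = 3}"
      have finM: "finite ?M" by (rule finite_exps)
      have "(\<Sum>m\<in>?M. lk (q s) m * (\<Sum>x\<in>X. c (\<rho> s) x * mval (P (\<rho> s) x) m)) = 0" for s
      proof -
        have qn: "q s \<in> polys n" "\<And>x. x \<in> X \<Longrightarrow> peval (P (\<rho> s) x) (hom_component 3 (q s)) = 0"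
          using q(1)[of s] unfolding I_def vanishing_ideal_lines by auto
        have k: "Poly_Mapping.keys (hom_component 3 (q s)) \<subseteq> ?M"
          using qn(1) by (auto simp: in_keys_iff lookup_hom polys_iff split: if_splits)
        have "peval (P (\<rho> s) x) (hom_component 3 (q s)) = (\<Sum>m\<in>?M. lk (q s) m * mval (P (\<rho> s) x) m)" for x
          unfolding peval_superset[OF finM k] by (rule sum.cong) (auto simp: lookup_hom)
        then have z: "(\<Sum>m\<in>?M. lk (q s) m * mval (P (\<rho> s) x) m) = 0" if "x \<in> X" for x
          using qn(2)[OF that] by simp
        have "(\<Sum>m\<in>?M. lk (q s) m * (\<Sum>x\<in>X. c (\<rho> s) x * mval (P (\<rho> s) x) m)) =
          (\<Sum>m\<in>?M. \<Sum>x\<in>X. c (\<rho> s) x * (lk (q s) m * mval (P (\<rho> s) x) m))"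
          by (simp add: sum_distrib_left mult.left_commute)
        also have "\<dots> = (\<Sum>x\<in>X. c (\<rho> s) x * (\<Sum>m\<in>?M. lk (q s) m * mval (P (\<rho> s) x) m))"
          by (subst sum.swap) (simp add: sum_distrib_left)
        also have "\<dots> = 0" using z by simp
        finally show ?thesis .
      qed
      moreover have "(\<lambda>s. \<Sum>m\<in>?M. lk (q s) m * (\<Sum>x\<in>X. c (\<rho> s) x * mval (P (\<rho> s) x) m)) \<longlonglongrightarrow>
        (\<Sum>m\<in>?M. lk g m * (mfact m * lk F m))"
      proof (intro tendsto_sum tendsto_mult)
        fix m assume m: "m \<in> ?M"
        show "(\<lambda>s. lk (q s) m) \<longlonglongrightarrow> lk g m" using q(2) by (simp add: coeff_lim_def)
        have "(\<lambda>s. \<Sum>x\<in>X. c s x * mval (P s x) m) \<longlonglongrightarrow> mfact m * lk F m" using M m by blast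
        from LIMSEQ_subseq_LIMSEQ[OF this \<rho>(1)]
        show "(\<lambda>s. \<Sum>x\<in>X. c (\<rho> s) x * mval (P (\<rho> s) x) m) \<longlonglongrightarrow> mfact m * lk F m" by (simp add: comp_def)
      qed
      ultimately have z: "(\<Sum>m\<in>?M. lk g m * (mfact m * lk F m)) = 0" by (rule limit_of_constant[rotated])
      have "(\<Sum>m\<in>?M. lk g m * (mfact m * lk F m)) = (\<Sum>m\<in>?M \<union> Poly_Mapping.keys g. lk g m * (mfact m * lk F m))"
        using finM F by (intro sum.mono_neutral_left) auto
      then have "apolar F g = 0"
        using z finM by (subst apolar_superset[of "?M \<union> Poly_Mapping.keys g"]) auto
      then show ?thesis by (simp add: g_def)
    qed
    then show "h \<in> Ann n F" using hn by (simp add: Ann_iff)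
  qed
  moreover have "peval (V x) p = 0" if p: "p \<in> graded_part J e" and x: "x \<in> X" for p e x
  proof -
    have hom: "homogeneous_ideal n (I (\<rho> s))" for s by (rule Hilb_homogeneous[OF IH])
    obtain q where q: "\<And>s. q s \<in> graded_part (I (\<rho> s)) e" "coeff_lim q p" and pT: "p \<in> T n e"
      using p unfolding J_def by (subst (asm) graded_part_lim_ideal[of n "\<lambda>s. I (\<rho> s)", OF hom]) blast
    let ?M = "{m::nat \<Rightarrow>\<^sub>0 nat. Poly_Mapping.keys m \<subseteq> {..n} \<and> mon_degree m = e}"
    have finM: "finite ?M" by (rule finite_exps)
    have qT: "q s \<in> T n e" for s using q(1) HilbD(3)[OF IH] by blast
    have "(\<lambda>s. \<Sum>m\<in>?M. lk (q s) m * mval (P (\<rho> s) x) m) \<longlonglongrightarrow> (\<Sum>m\<in>?M. lk p m * mval (V x) m)"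
      unfolding mval_def
    proof (intro tendsto_sum tendsto_mult tendsto_prod tendsto_power)
      fix m i
      show "(\<lambda>s. lk (q s) m) \<longlonglongrightarrow> lk p m" using q(2) by (simp add: coeff_lim_def)
      show "(\<lambda>s. P (\<rho> s) x i) \<longlonglongrightarrow> V x i"
        using LIMSEQ_subseq_LIMSEQ[OF V[OF x, of i] \<rho>(1)] by (simp add: comp_def)
    qed
    then have "(\<lambda>s. peval (P (\<rho> s) x) (q s)) \<longlonglongrightarrow> peval (V x) p"
      by (simp add: peval_superset[OF finM T_keys[OF qT]] peval_superset[OF finM T_keys[OF pT]])
    moreover have "peval (P (\<rho> s) x) (q s) = 0" for s
    proof -
      have "q s \<in> I (\<rho> s)" using q(1)[of s] by (simp add: graded_part_iff)
      moreover have "hom_component e (q s) = q s"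
        using qT[of s] by (simp add: graded_part_iff hom_component_self[of "q s" e])
      ultimately show ?thesis using x unfolding I_def vanishing_ideal_lines by (metis image_eqI)
    qed
    ultimately show ?thesis by (rule limit_of_constant)
  qed
  ultimately show ?thesis using that[of J] by (simp add: border_VSP_def)
qed

subsection \<open>Interpolation\<close>

definition lagrange :: "('x \<Rightarrow> complex) \<Rightarrow> 'x set \<Rightarrow> 'x \<Rightarrow> complex poly" where
  "lagrange u X x = (\<Prod>y\<in>X - {x}. Polynomial.smult (1 / (u x - u y)) [:- u y, 1:])"

lemma poly_lagrange:
  assumes "finite X" "inj_on u X" "x \<in> X" "y \<in> X"
  shows "poly (lagrange u X x) (u y) = (if x = y then 1 else 0)"
proof -
  have f: "poly (lagrange u X x) w = (\<Prod>z\<in>X - {x}. (w - u z) / (u x - u z))" for w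
    by (simp add: lagrange_def poly_prod diff_divide_distrib)
  show ?thesis
  proof (cases "x = y")
    case True
    have "(u x - u z) / (u x - u z) = 1" if "z \<in> X - {x}" for z
      using assms that by (auto simp: inj_on_def)
    then have "(\<Prod>z\<in>X - {x}. (u x - u z) / (u x - u z)) = 1" by (intro prod.neutral ballI)
    then have "poly (lagrange u X x) (u x) = 1" by (simp only: f)
    then show ?thesis using True by simp
  next
    case False
    then show ?thesis using assms by (auto simp: f intro!: prod_zero)
  qed
qed

lemma degree_lagrange:
  assumes "finite X" "x \<in> X"
  shows "Polynomial.degree (lagrange u X x) < card X"
proof -
  have "Polynomial.degree (lagrange u X x) \<le> (\<Sum>y\<in>X - {x}. Polynomial.degree (Polynomial.smult (1 / (u x - u y)) [:- u y, 1:]))"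
    using degree_prod_sum_le[of "X - {x}" "\<lambda>y. Polynomial.smult (1 / (u x - u y)) [:- u y, 1:]"] assms(1)
    by (simp only: lagrange_def comp_def finite_Diff)
  also have "\<dots> \<le> (\<Sum>y\<in>X - {x}. 1)"
    by (rule sum_mono, rule order_trans[OF degree_smult_le]) simp
  also have "\<dots> < card X" using assms card_Diff1_less[of X x] by simp
  finally show ?thesis .
qed

lemma lagrange_interpolation:
  assumes "finite X" "inj_on u X" "Polynomial.degree f < card X"
  shows "f = (\<Sum>x\<in>X. Polynomial.smult (poly f (u x)) (lagrange u X x))"
proof (rule poly_eqI_degree)
  have "card (u ` X) = card X" using assms(2) by (rule card_image)
  then show "card (u ` X) > Polynomial.degree f" using assms(3) by simp
  have "Polynomial.degree (\<Sum>x\<in>X. Polynomial.smult (poly f (u x)) (lagrange u X x)) < card X"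
    using assms degree_lagrange[OF assms(1)]
    by (intro degree_sum_less le_less_trans[OF degree_smult_le]) auto
  then show "card (u ` X) > Polynomial.degree (\<Sum>x\<in>X. Polynomial.smult (poly f (u x)) (lagrange u X x))"
    using \<open>card (u ` X) = card X\<close> by simp
  fix z assume "z \<in> u ` X"
  then obtain y where y: "y \<in> X" "z = u y" by blast
  have "poly (\<Sum>x\<in>X. Polynomial.smult (poly f (u x)) (lagrange u X x)) z = (\<Sum>x\<in>X. if x = y then poly f (u x) else 0)"
    unfolding poly_sum y(2) by (rule sum.cong) (use poly_lagrange[OF assms(1,2) _ y(1)] in auto)
  then show "poly f z = poly (\<Sum>x\<in>X. Polynomial.smult (poly f (u x)) (lagrange u X x)) z"
    using assms(1) y by simp
qed

text \<open>The leading coefficients of the Lagrange polynomials, that is, the weights of the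
  divided difference at the nodes. They give a linear relation between points on a curve
  parametrised by polynomials of degree below \<open>card X - 1\<close>.\<close>

definition top_weight :: "('x \<Rightarrow> complex) \<Rightarrow> 'x set \<Rightarrow> 'x \<Rightarrow> complex" where
  "top_weight u X x = Polynomial.coeff (lagrange u X x) (card X - 1)"

text \<open>Compare the coefficients of degree \<open>card X - 1\<close> in the interpolation
  formula; in particular polynomials of smaller degree are annihilated.\<close>

lemma sum_top_weight:
  assumes "finite X" "inj_on u X" "Polynomial.degree f < card X"
  shows "(\<Sum>x\<in>X. top_weight u X x * poly f (u x)) = Polynomial.coeff f (card X - 1)"
  by (subst (2) lagrange_interpolation[OF assms])
     (simp add: top_weight_def coeff_sum mult.commute)

definition node_poly :: "('x \<Rightarrow> complex) \<Rightarrow> 'x set \<Rightarrow> complex poly" where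
  "node_poly u X = (\<Prod>x\<in>X. [:- u x, 1:])"

text \<open>The quotient of the node polynomial on division by the power \<open>Suc m\<close> of the
  variable. For \<open>m < card X\<close> it is monic of degree \<open>card X - Suc m\<close>, and
  these quotients are dual to the powers under the weights.\<close>

definition dual_poly :: "('x \<Rightarrow> complex) \<Rightarrow> 'x set \<Rightarrow> nat \<Rightarrow> complex poly" where
  "dual_poly u X m = poly_shift (Suc m) (node_poly u X)"

lemma node_poly:
  assumes "finite X"
  shows "Polynomial.degree (node_poly u X) = card X" "Polynomial.coeff (node_poly u X) (card X) = 1"
    "x \<in> X \<Longrightarrow> poly (node_poly u X) (u x) = 0"
proof -
  show "Polynomial.degree (node_poly u X) = card X"
    unfolding node_poly_def by (subst degree_prod_eq_sum_degree) auto
  moreover have "lead_coeff (node_poly u X) = 1"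
    unfolding node_poly_def lead_coeff_prod by simp
  ultimately show "Polynomial.coeff (node_poly u X) (card X) = 1" by simp
  show "x \<in> X \<Longrightarrow> poly (node_poly u X) (u x) = 0"
    using assms by (auto simp: node_poly_def poly_prod intro!: prod_zero)
qed

text \<open>The weights annihilate every polynomial of degree below \<open>card X - 1\<close>, and unless \<open>q = m\<close> the
  product of the \<open>m\<close>-th dual polynomial with the \<open>q\<close>-th power agrees at the nodes with such a polynomial.\<close>

lemma dual_poly_pairing:
  assumes X: "finite X" "inj_on u X" and mq: "m < card X" "q < card X"
  shows "(\<Sum>x\<in>X. top_weight u X x * (poly (dual_poly u X m) (u x) * u x ^ q)) = (if q = m then 1 else 0)"
proof (cases "q \<le> m")
  case True
  let ?f = "Polynomial.monom 1 q * dual_poly u X m"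
  have c: "Polynomial.coeff ?f i = (if q \<le> i then Polynomial.coeff (node_poly u X) (i - q + Suc m) else 0)" for i
    by (simp add: coeff_monom_mult dual_poly_def coeff_poly_shift)
  have "Polynomial.degree ?f < card X"
  proof -
    have "Polynomial.coeff ?f i = 0" if "i \<ge> card X" for i
      unfolding c using True that node_poly(1)[OF X(1), of u] by (auto intro!: coeff_eq_0)
    then have "Polynomial.degree ?f \<le> card X - 1" by (intro degree_le) auto
    then show ?thesis using mq by simp
  qed
  then have "(\<Sum>x\<in>X. top_weight u X x * poly ?f (u x)) = Polynomial.coeff ?f (card X - 1)"
    by (rule sum_top_weight[OF X])
  also have "\<dots> = Polynomial.coeff (node_poly u X) (card X - 1 - q + Suc m)"
    using mq by (subst c) simp
  also have "\<dots> = (if q = m then 1 else 0)"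
  proof (cases "q = m")
    case True
    then have "card X - 1 - q + Suc m = card X" using mq by simp
    then show ?thesis using True node_poly(2)[OF X(1), of u] by simp
  next
    case False
    then have "card X - 1 - q + Suc m > card X" using mq \<open>q \<le> m\<close> by simp
    then show ?thesis using False node_poly(1)[OF X(1), of u] by (simp add: coeff_eq_0)
  qed
  finally show ?thesis by (simp add: poly_monom mult.commute)
next
  case False
  \<comment> \<open>The node polynomial vanishes at the nodes, so there its high part may be traded
    for minus its remainder \<open>?R\<close>, which has degree at most \<open>m\<close>.\<close>
  let ?R = "poly_cutoff (Suc m) (node_poly u X)"
  let ?f = "Polynomial.monom 1 (q - Suc m) * ?R"
  have c: "Polynomial.coeff ?f i = 0" if "i \<ge> card X - 1" for i
    using that mq False by (simp add: coeff_monom_mult coeff_poly_cutoff)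
  have "poly (dual_poly u X m) (u x) * u x ^ q = - poly ?f (u x)" if "x \<in> X" for x
  proof -
    have "node_poly u X = Polynomial.monom 1 (Suc m) * dual_poly u X m + ?R"
      by (rule poly_eqI) (simp add: coeff_monom_mult coeff_poly_cutoff dual_poly_def coeff_poly_shift)
    then have "u x ^ Suc m * poly (dual_poly u X m) (u x) + poly ?R (u x) = 0"
      using node_poly(3)[OF X(1) that, of u] by (metis poly_add poly_monom poly_mult mult_1)
    then have D: "u x ^ Suc m * poly (dual_poly u X m) (u x) = - poly ?R (u x)" by (simp add: eq_neg_iff_add_eq_0)
    have "u x ^ q = u x ^ (q - Suc m) * u x ^ Suc m" using False by (simp only: power_add[symmetric]) simp
    then have "poly (dual_poly u X m) (u x) * u x ^ q = u x ^ (q - Suc m) * (u x ^ Suc m * poly (dual_poly u X m) (u x))"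
      by (simp only: mult_ac)
    then show ?thesis unfolding D by (simp add: poly_monom)
  qed
  then have "(\<Sum>x\<in>X. top_weight u X x * (poly (dual_poly u X m) (u x) * u x ^ q)) =
      - (\<Sum>x\<in>X. top_weight u X x * poly ?f (u x))"
    by (simp add: sum_negf)
  also have "(\<Sum>x\<in>X. top_weight u X x * poly ?f (u x)) = Polynomial.coeff ?f (card X - 1)"
  proof (rule sum_top_weight[OF X])
    have "Polynomial.degree ?f \<le> card X - 1" by (intro degree_le) (use c in auto)
    then show "Polynomial.degree ?f < card X" using mq by simp
  qed
  also have "\<dots> = 0" by (rule c) simp
  finally show ?thesis using False by simp
qed

section \<open>Sums of cubes of points near a rational normal curve\<close>

lemma triangular_family_spans:
  fixes G :: "'i \<Rightarrow> 'a::field poly"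
  assumes "finite I" "\<And>d. d < r \<Longrightarrow> \<exists>v\<in>I. Polynomial.coeff (G v) d \<noteq> 0 \<and> (\<forall>i>d. Polynomial.coeff (G v) i = 0)"
    and "\<And>i. i \<ge> r \<Longrightarrow> Polynomial.coeff f i = 0"
  shows "\<exists>a. f = (\<Sum>v\<in>I. Polynomial.smult (a v) (G v))"
  using assms(2,3)
proof (induction r arbitrary: f)
  case 0
  then have "f = 0" by (intro poly_eqI) simp
  then show ?case by (intro exI[of _ "\<lambda>_. 0"]) simp
next
  case (Suc r)
  obtain v where v: "v \<in> I" "Polynomial.coeff (G v) r \<noteq> 0" "\<And>i. i > r \<Longrightarrow> Polynomial.coeff (G v) i = 0"
    using Suc.prems(1)[of r] by auto
  define c where "c = Polynomial.coeff f r / Polynomial.coeff (G v) r"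
  have "Polynomial.coeff (f - Polynomial.smult c (G v)) i = 0" if "i \<ge> r" for i
    using that v Suc.prems(2)[of i] by (cases "i = r") (auto simp: c_def)
  then obtain a where a: "f - Polynomial.smult c (G v) = (\<Sum>v\<in>I. Polynomial.smult (a v) (G v))"
    using Suc.IH[of "f - Polynomial.smult c (G v)"] Suc.prems(1) by (meson less_Suc_eq)
  have "(\<Sum>w\<in>I. Polynomial.smult ((a(v := a v + c)) w) (G w)) = (\<Sum>w\<in>I. Polynomial.smult (a w) (G w) + (if w = v then Polynomial.smult c (G v) else 0))"
    by (rule sum.cong) (auto simp: smult_add_left)
  also have "\<dots> = f - Polynomial.smult c (G v) + Polynomial.smult c (G v)" unfolding a sum.distrib using assms(1) v(1) by simp
  finally show ?case by (intro exI[of _ "a(v := a v + c)"]) simp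
qed

text \<open>Numbers the variables outside the \<open>b\<^sub>i\<close>:
  \<open>x\<^sub>3\<^sub>i\<close> gets \<open>2 * i\<close> and
  \<open>x\<^sub>3\<^sub>i\<^sub>+\<^sub>2\<close> gets \<open>2 * i + 1\<close>. In every monomial
  of the cubic this number is the sum of the indices of the two \<open>b\<close> factors, so it acts
  as a degree on the curve.\<close>

definition aindex :: "nat \<Rightarrow> nat" where
  "aindex v = 2 * (v div 3) + (if v mod 3 = 2 then 1 else 0)"

lemma aindex_le: "v \<le> 3 * k + 1 \<Longrightarrow> v mod 3 \<noteq> 1 \<Longrightarrow> aindex v \<le> 2 * k"
  unfolding aindex_def by presburger

text \<open>The \<open>b\<close> coordinates put the point with parameter \<open>u x\<close> on a
  scaled rational normal curve of degree \<open>k\<close>; the other \<open>2 * k + 1\<close>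
  coordinates are small multiples of dual polynomials. The coordinate functions have degrees 0 to
  \<open>3 * k + 1\<close>, one each, so the points are independent. The weights kill products of
  three \<open>b\<close> coordinates, whose degree is at most \<open>3 * k\<close>, and dual
  polynomials extract the prescribed values from products with two of them.\<close>

lemma configuration:
  fixes u \<mu> :: "'x \<Rightarrow> complex" and \<tau> \<sigma> :: "nat \<Rightarrow> complex" and \<delta> :: real
  assumes X: "finite X" "card X = 3 * k + 2" "inj_on u X" and n: "n = 3 * k + 1"
    and nz: "\<And>l. \<tau> l \<noteq> 0" "\<And>v. \<sigma> v \<noteq> 0" "\<And>x. x \<in> X \<Longrightarrow> \<mu> x \<noteq> 0" and \<delta>: "\<delta> > 0"
  shows "\<exists>P c L.
    (\<forall>x\<in>X. \<forall>i>n. P x i = 0) \<and>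
    (\<forall>x\<in>X. L x \<in> T n 1 \<and> (\<forall>y\<in>X. peval (P y) (L x) = (if x = y then 1 else 0))) \<and>
    (\<forall>x\<in>X. \<forall>l\<le>k. P x (3*l+1) = \<mu> x * \<tau> l * u x ^ l) \<and>
    (\<forall>x\<in>X. \<forall>a\<le>n. a mod 3 \<noteq> 1 \<longrightarrow> norm (P x a) \<le> \<delta>) \<and>
    (\<forall>i\<le>k. \<forall>j\<le>k. \<forall>l\<le>k. (\<Sum>x\<in>X. c x * mval (P x) (tri (3*i+1) (3*j+1) (3*l+1))) = 0) \<and>
    (\<forall>a\<le>n. \<forall>i\<le>k. \<forall>j\<le>k. a mod 3 \<noteq> 1 \<longrightarrow> (\<Sum>x\<in>X. c x * mval (P x) (tri a (3*i+1) (3*j+1))) =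
       (if aindex a = i + j then \<sigma> a * \<tau> i * \<tau> j else 0)) \<and>
    (\<forall>a\<le>n. \<forall>a'\<le>n. \<forall>v\<le>n. a mod 3 \<noteq> 1 \<longrightarrow> a' mod 3 \<noteq> 1 \<longrightarrow>
       norm (\<Sum>x\<in>X. c x * mval (P x) (tri a a' v)) \<le> \<delta>)"
proof -
  define H where "H v = (if v mod 3 = 1 then Polynomial.smult (\<tau> (v div 3)) (Polynomial.monom 1 (v div 3))
     else Polynomial.smult (\<sigma> v) (dual_poly u X (aindex v)))" for v
  define w where "w = top_weight u X"
  define K where "K a a' v = (\<Sum>x\<in>X. w x * (poly (H a) (u x) * poly (H a') (u x) * poly (H v) (u x)))" for a a' v
  \<comment> \<open>A common bound for all coordinates and triple moments before scaling; the
    summand 1 makes it positive.\<close>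
  define B where "B = 1 + (\<Sum>x\<in>X. \<Sum>a\<le>n. norm (\<mu> x * poly (H a) (u x))) + (\<Sum>a\<le>n. \<Sum>a'\<le>n. \<Sum>v\<le>n. norm (K a a' v))"
  have s1: "norm (\<mu> x * poly (H a) (u x)) \<le> (\<Sum>x\<in>X. \<Sum>a\<le>n. norm (\<mu> x * poly (H a) (u x)))" if "x \<in> X" "a \<le> n" for x a
  proof -
    have "norm (\<mu> x * poly (H a) (u x)) \<le> (\<Sum>a\<le>n. norm (\<mu> x * poly (H a) (u x)))"
      using that by (intro member_le_sum) auto
    also have "\<dots> \<le> (\<Sum>x\<in>X. \<Sum>a\<le>n. norm (\<mu> x * poly (H a) (u x)))"
      using that X(1) by (intro member_le_sum) (auto intro: sum_nonneg)
    finally show ?thesis .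
  qed
  have s2: "norm (K a a' v) \<le> (\<Sum>a\<le>n. \<Sum>a'\<le>n. \<Sum>v\<le>n. norm (K a a' v))" if "a \<le> n" "a' \<le> n" "v \<le> n" for a a' v
  proof -
    have "norm (K a a' v) \<le> (\<Sum>v\<le>n. norm (K a a' v))" using that by (intro member_le_sum) auto
    also have "\<dots> \<le> (\<Sum>a'\<le>n. \<Sum>v\<le>n. norm (K a a' v))" using that by (intro member_le_sum) (auto intro!: sum_nonneg)
    also have "\<dots> \<le> (\<Sum>a\<le>n. \<Sum>a'\<le>n. \<Sum>v\<le>n. norm (K a a' v))" using that by (intro member_le_sum) (auto intro!: sum_nonneg)
    finally show ?thesis .
  qed
  have nn: "(\<Sum>x\<in>X. \<Sum>a\<le>n. norm (\<mu> x * poly (H a) (u x))) \<ge> 0" "(\<Sum>a\<le>n. \<Sum>a'\<le>n. \<Sum>v\<le>n. norm (K a a' v)) \<ge> 0"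
    by (intro sum_nonneg norm_ge_zero)+
  have B1: "B \<ge> 1" and Bx: "\<And>x a. x \<in> X \<Longrightarrow> a \<le> n \<Longrightarrow> norm (\<mu> x * poly (H a) (u x)) \<le> B"
    and BK: "\<And>a a' v. a \<le> n \<Longrightarrow> a' \<le> n \<Longrightarrow> v \<le> n \<Longrightarrow> norm (K a a' v) \<le> B"
    using nn s1 s2 unfolding B_def by (fastforce, fastforce, fastforce)
  define \<epsilon> where "\<epsilon> = min 1 (\<delta> / B)"
  have \<epsilon>: "\<epsilon> > 0" "\<epsilon> \<le> 1" "\<epsilon> * B \<le> \<delta>"
    using \<delta> B1 by (auto simp: \<epsilon>_def min_def field_simps)
  have small: "\<epsilon> * z \<le> \<delta>" if "z \<le> B" for z
    using mult_left_mono[OF that, of \<epsilon>] \<epsilon> by linarith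
  define G where "G v = Polynomial.smult (if v mod 3 = 1 then 1 else of_real \<epsilon>) (H v)" for v
  define P where "P x v = (if v \<le> n then \<mu> x * poly (G v) (u x) else 0)" for x v
  \<comment> \<open>Dividing by \<open>\<epsilon>\<close> normalises the terms with one small
    coordinate; the power of \<open>\<mu>\<close> undoes the rescaling of the point.\<close>
  define c where "c x = w x / (of_real \<epsilon> * \<mu> x ^ 3)" for x
  have span: "\<exists>a. f = (\<Sum>v\<le>n. Polynomial.smult (a v) (G v))" if "Polynomial.degree f < 3 * k + 2" for f
  proof (rule triangular_family_spans)
    fix d assume d: "d < 3 * k + 2"
    show "\<exists>v\<in>{..n}. Polynomial.coeff (G v) d \<noteq> 0 \<and> (\<forall>i>d. Polynomial.coeff (G v) i = 0)"
    proof (cases "d \<le> k")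
      case True
      have "(3*d+1) mod 3 = 1" "(3*d+1) div 3 = d" by presburger+
      then have "G (3*d+1) = Polynomial.smult (\<tau> d) (Polynomial.monom 1 d)" by (simp add: G_def H_def)
      then show ?thesis using True nz(1) n by (intro bexI[of _ "3*d+1"]) auto
    next
      case False
      \<comment> \<open>A degree \<open>d > k\<close> is that of the dual polynomial with index
        \<open>m\<close>, and \<open>v\<close> below is the variable with
        \<open>aindex v = m\<close>.\<close>
      define m where "m = 3 * k + 1 - d"
      have m: "m \<le> 2 * k" "m < card X" "card X = Suc m + d" using False d X(2) by (auto simp: m_def)
      define v where "v = (if even m then 3 * (m div 2) else 3 * (m div 2) + 2)"
      define b where "b = m div 2"
      have b: "(3*b+2) mod 3 = 2" "(3*b+2) div 3 = b" by presburger+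
      have v: "v \<le> n \<and> v mod 3 \<noteq> 1 \<and> aindex v = m"
      proof (cases "even m")
        case True
        then have "m = 2 * b" "v = 3 * b" by (simp_all add: b_def v_def)
        then show ?thesis using m(1) n by (simp add: aindex_def)
      next
        case False
        then have mv: "m = 2 * b + 1" "v = 3 * b + 2" by (simp_all add: b_def v_def)
        have "v \<le> n" using m(1) n mv by linarith
        moreover have "v mod 3 = 2" "v div 3 = b" unfolding mv(2) by (rule b)+
        ultimately show ?thesis using mv(1) by (simp add: aindex_def)
      qed
      have "G v = Polynomial.smult (of_real \<epsilon> * \<sigma> v) (dual_poly u X m)" using v by (simp add: G_def H_def)
      moreover have "Polynomial.coeff (dual_poly u X m) d = 1"
        using node_poly(2)[OF X(1), of u] m(3) by (simp add: dual_poly_def coeff_poly_shift add.commute)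
      moreover have "Polynomial.coeff (dual_poly u X m) i = 0" if "i > d" for i
        using node_poly(1)[OF X(1), of u] m(3) that by (simp add: dual_poly_def coeff_poly_shift coeff_eq_0)
      ultimately show ?thesis using v(1) nz(2)[of v] \<epsilon>(1) by (intro bexI[of _ v]) auto
    qed
  qed (use that in \<open>auto intro: coeff_eq_0\<close>)
  have "\<exists>a. lagrange u X x = (\<Sum>v\<le>n. Polynomial.smult (a v) (G v))" if "x \<in> X" for x
    using span[of "lagrange u X x"] degree_lagrange[OF X(1) that, of u] X(2) by simp
  then obtain A where A: "\<And>x. x \<in> X \<Longrightarrow> lagrange u X x = (\<Sum>v\<le>n. Polynomial.smult (A x v) (G v))" by metis
  \<comment> \<open>The coefficients express the Lagrange polynomial in the coordinate functions, so
    evaluating \<open>L x\<close> at \<open>P y\<close> evaluates it at \<open>u y\<close>, up to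
    the factors \<open>\<mu>\<close>.\<close>
  define L where "L x = (\<Sum>v\<le>n. cscale (A x v / \<mu> x) (var v))" for x
  have L1: "L x \<in> T n 1" for x unfolding L_def by (intro T_sum T_cscale T_var) auto
  have L2: "peval (P y) (L x) = (if x = y then 1 else 0)" if "x \<in> X" "y \<in> X" for x y
  proof -
    have "peval (P y) (L x) = (\<Sum>v\<le>n. A x v / \<mu> x * (\<mu> y * poly (G v) (u y)))"
      by (simp add: L_def peval_sum P_def)
    also have "\<dots> = \<mu> y / \<mu> x * poly (lagrange u X x) (u y)"
      by (simp add: A[OF that(1)] poly_sum sum_distrib_left mult_ac)
    finally show ?thesis using poly_lagrange[OF X(1,3) that] nz(3)[OF that(1)] by auto
  qed
  have Pb: "P x (3*l+1) = \<mu> x * \<tau> l * u x ^ l" if "l \<le> k" for x l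
  proof -
    have "(3*l+1) mod 3 = 1" "(3*l+1) div 3 = l" by presburger+
    then show ?thesis using that n by (simp add: P_def G_def H_def poly_monom)
  qed
  have Pa: "norm (P x a) \<le> \<delta>" if "x \<in> X" "a \<le> n" "a mod 3 \<noteq> 1" for x a
  proof -
    have "norm (P x a) = \<epsilon> * norm (\<mu> x * poly (H a) (u x))"
      using that \<epsilon>(1) by (simp add: P_def G_def norm_mult)
    then show ?thesis using small[OF Bx[OF that(1,2)]] by simp
  qed
  have mom: "(\<Sum>x\<in>X. c x * mval (P x) (tri a b d)) =
     (\<Sum>x\<in>X. w x * (poly (G a) (u x) * poly (G b) (u x) * poly (G d) (u x))) / of_real \<epsilon>"
    if "a \<le> n" "b \<le> n" "d \<le> n" for a b d
    unfolding sum_divide_distrib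
  proof (rule sum.cong)
    fix x assume "x \<in> X"
    then show "c x * mval (P x) (tri a b d) = w x * (poly (G a) (u x) * poly (G b) (u x) * poly (G d) (u x)) / of_real \<epsilon>"
      using that nz(3)[of x] \<epsilon>(1) by (simp add: c_def mval_tri P_def power3_eq_cube field_simps)
  qed simp
  have Gb: "poly (G (3*l+1)) z = \<tau> l * z ^ l" for l z
  proof -
    have "(3*l+1) mod 3 = 1" "(3*l+1) div 3 = l" by presburger+
    then show ?thesis by (simp add: G_def H_def poly_monom)
  qed
  have M5: "(\<Sum>x\<in>X. c x * mval (P x) (tri (3*i+1) (3*j+1) (3*l+1))) = 0" if "i \<le> k" "j \<le> k" "l \<le> k" for i j l
  proof -
    let ?f = "Polynomial.monom (\<tau> i * \<tau> j * \<tau> l) (i + j + l)"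
    have deg: "Polynomial.degree ?f \<le> i + j + l" by (rule degree_monom_le)
    have "(\<Sum>x\<in>X. w x * (poly (G (3*i+1)) (u x) * poly (G (3*j+1)) (u x) * poly (G (3*l+1)) (u x))) =
      (\<Sum>x\<in>X. top_weight u X x * poly ?f (u x))"
      unfolding Gb w_def by (rule sum.cong) (auto simp: poly_monom power_add mult_ac)
    also have "\<dots> = Polynomial.coeff ?f (card X - 1)"
      by (rule sum_top_weight[OF X(1,3)]) (use deg that X(2) in linarith)
    also have "\<dots> = 0" using that X(2) by simp
    finally show ?thesis using that n by (subst mom) auto
  qed
  have M6: "(\<Sum>x\<in>X. c x * mval (P x) (tri a (3*i+1) (3*j+1))) =
       (if aindex a = i + j then \<sigma> a * \<tau> i * \<tau> j else 0)" if "a \<le> n" "i \<le> k" "j \<le> k" "a mod 3 \<noteq> 1" for a i j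
  proof -
    have "(\<Sum>x\<in>X. w x * (poly (G a) (u x) * poly (G (3*i+1)) (u x) * poly (G (3*j+1)) (u x))) =
      (\<Sum>x\<in>X. of_real \<epsilon> * \<sigma> a * \<tau> i * \<tau> j * (top_weight u X x * (poly (dual_poly u X (aindex a)) (u x) * u x ^ (i + j))))"
      unfolding Gb w_def using that(4) by (intro sum.cong) (auto simp: G_def H_def power_add mult_ac)
    also have "\<dots> = of_real \<epsilon> * \<sigma> a * \<tau> i * \<tau> j * (if i + j = aindex a then 1 else 0)"
      unfolding sum_distrib_left[symmetric]
      by (subst dual_poly_pairing[OF X(1,3)]) (use aindex_le[of a k] that n X(2) in auto)
    finally show ?thesis using that n \<epsilon>(1) by (subst mom) auto
  qed
  have M7: "norm (\<Sum>x\<in>X. c x * mval (P x) (tri a a' v)) \<le> \<delta>"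
    if "a \<le> n" "a' \<le> n" "v \<le> n" "a mod 3 \<noteq> 1" "a' mod 3 \<noteq> 1" for a a' v
  proof -
    \<comment> \<open>Two small coordinates give \<open>\<epsilon> * \<epsilon>\<close>, of which
      the division in \<open>c\<close> removes one factor.\<close>
    let ?e = "if v mod 3 = 1 then 1 else \<epsilon>"
    have "(\<Sum>x\<in>X. w x * (poly (G a) (u x) * poly (G a') (u x) * poly (G v) (u x))) =
      of_real (\<epsilon> * \<epsilon> * ?e) * K a a' v"
      unfolding K_def sum_distrib_left using that(4,5) by (intro sum.cong) (auto simp: G_def mult_ac)
    then have "(\<Sum>x\<in>X. c x * mval (P x) (tri a a' v)) = of_real (\<epsilon> * \<epsilon> * ?e) * K a a' v / of_real \<epsilon>"
      using mom[OF that(1-3)] by simp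
    also have "\<dots> = of_real (\<epsilon> * ?e) * K a a' v" using \<epsilon>(1) by simp
    finally have "norm (\<Sum>x\<in>X. c x * mval (P x) (tri a a' v)) = \<epsilon> * (?e * norm (K a a' v))"
      using \<epsilon>(1) by (simp add: norm_mult)
    moreover have "?e * norm (K a a' v) \<le> 1 * norm (K a a' v)"
      using \<epsilon> by (intro mult_right_mono) auto
    ultimately show ?thesis using small[of "?e * norm (K a a' v)"] BK[OF that(1-3)] by simp
  qed
  show ?thesis
    by (rule exI[of _ P], rule exI[of _ c], rule exI[of _ L])
       (use L1 L2 Pb Pa M5 M6 M7 in \<open>simp add: P_def\<close>)
qed

subsection \<open>Degenerating points on rational normal curves\<close>

lemma inverse_power_tendsto_0:
  assumes "a < b"
  shows "(\<lambda>s. of_nat (s + N) ^ a / of_nat (s + N) ^ b :: complex) \<longlonglongrightarrow> 0"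
proof -
  have "(\<lambda>s. inverse (of_nat s) :: complex) \<longlonglongrightarrow> 0" by (rule lim_inverse_n)
  then have "(\<lambda>s. inverse (of_nat (s + N)) :: complex) \<longlonglongrightarrow> 0" by (rule LIMSEQ_ignore_initial_segment)
  then have l: "(\<lambda>s. inverse (of_nat (s + N)) ^ (b - a) :: complex) \<longlonglongrightarrow> 0"
    using assms by (intro tendsto_null_power) auto
  have "\<forall>\<^sub>F s in sequentially. inverse (of_nat (s + N)) ^ (b - a) = (of_nat (s + N) ^ a / of_nat (s + N) ^ b :: complex)"
  proof (rule eventually_sequentiallyI[of 1])
    fix s :: nat assume "s \<ge> 1"
    then have nz: "(of_nat (s + N) :: complex) \<noteq> 0" by (simp del: of_nat_add)
    have e: "of_nat (s + N) ^ b = of_nat (s + N) ^ a * (of_nat (s + N) ^ (b - a) :: complex)"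
      using assms by (simp flip: power_add)
    show "inverse (of_nat (s + N)) ^ (b - a) = (of_nat (s + N) ^ a / of_nat (s + N) ^ b :: complex)"
      unfolding e using nz by (auto simp: power_one_over inverse_eq_divide simp del: of_nat_add)
  qed
  then show ?thesis using l by (rule Lim_transform_eventually[rotated])
qed

text \<open>For \<open>i \<ge> 1\<close> the right side minus the left is
  \<open>(l - i) * (l - i + 1)\<close> over the integers; it vanishes only for \<open>l = i\<close>
  and \<open>l = i - 1\<close> and is positive otherwise.\<close>

lemma square_gap:
  fixes i l :: nat
  assumes "l \<noteq> i" "Suc l \<noteq> i"
  shows "(2 * i - 1) * l < l\<^sup>2 + i * (i - 1)"
proof (cases "l < i")
  case True
  then obtain d where "i = l + 2 + d" using assms(2) by (metis Suc_leI add_2_eq_Suc' add_Suc_right le_iff_add le_neq_implies_less)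
  then show ?thesis by (simp add: power2_eq_square algebra_simps)
next
  case False
  then obtain d where d: "l = Suc (i + d)" using assms(1) by (metis less_imp_Suc_add nat_neq_iff)
  show ?thesis
  proof (cases i)
    case (Suc i')
    then show ?thesis unfolding d by (simp add: power2_eq_square algebra_simps)
  qed (simp add: d)
qed

lemma square_exact:
  fixes i l :: nat
  assumes "l = i \<or> Suc l = i"
  shows "(2 * i - 1) * l = l\<^sup>2 + i * (i - 1)"
proof (cases i)
  case (Suc i')
  then have "l = Suc i' \<or> l = i'" using assms by auto
  then show ?thesis unfolding Suc by (elim disjE) (simp_all add: power2_eq_square algebra_simps)
qed (use assms in simp)

text \<open>The point with parameter \<open>c\<close> on the line joining the coordinate points of \<open>x\<^sub>3\<^sub>i\<^sub>-\<^sub>2\<close> and \<open>x\<^sub>3\<^sub>i\<^sub>+\<^sub>1\<close>.\<close>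

definition chain_point :: "nat \<times> nat \<Rightarrow> nat \<Rightarrow> complex" where
  "chain_point = (\<lambda>(i, c) v. if v = 3 * i + 1 then of_nat c else if v + 2 = 3 * i then 1 else 0)"

text \<open>As \<open>S\<close> grows, the curve degenerates to the chain. The parameter of the
  point \<open>(i, c)\<close> has order \<open>S ^ (2 * i - 1)\<close>, so its coordinate
  \<open>b\<^sub>l\<close> has order \<open>S ^ ((2 * i - 1) * l - l\<^sup>2)\<close>, with the
  exponent read in the integers. This is largest exactly at \<open>l = i - 1\<close> and
  \<open>l = i\<close>, where the exponent is \<open>i * (i - 1)\<close>; \<open>point_scale\<close>
  divides by that power and makes the coordinate \<open>b\<^sub>i\<^sub>-\<^sub>1\<close> equal to
  1.\<close>

definition node_scale :: "complex \<Rightarrow> nat \<times> nat \<Rightarrow> complex" where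
  "node_scale S = (\<lambda>(i, c). of_nat c * S ^ (2 * i - 1))"

definition point_scale :: "complex \<Rightarrow> nat \<times> nat \<Rightarrow> complex" where
  "point_scale S = (\<lambda>(i, c). 1 / (S ^ (i * (i - 1)) * of_nat c ^ (i - 1)))"

definition beta_scale :: "complex \<Rightarrow> nat \<Rightarrow> complex" where
  "beta_scale S l = 1 / S ^ l\<^sup>2"

text \<open>Chosen to cancel the two \<open>beta_scale\<close> factors exactly for the pairs of
  indices occurring in the cubic, leaving 2 for a square and 1 for a product of neighbours.\<close>

definition alpha_scale :: "complex \<Rightarrow> nat \<Rightarrow> complex" where
  "alpha_scale S v = (if v mod 3 = 2 then S ^ ((v div 3)\<^sup>2 + (Suc (v div 3))\<^sup>2) else 2 * S ^ (2 * (v div 3)\<^sup>2))"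

lemma chain_limit:
  assumes "i \<ge> 1" "c \<ge> 1"
  shows "(\<lambda>s. point_scale (of_nat (s + 6)) (i, c) * beta_scale (of_nat (s + 6)) l *
      node_scale (of_nat (s + 6)) (i, c) ^ l) \<longlonglongrightarrow> chain_point (i, c) (3 * l + 1)" (is "?f \<longlonglongrightarrow> _")
proof -
  define C where "C = (of_nat c ^ l / of_nat c ^ (i - 1) :: complex)"
  have f: "?f s = C * (of_nat (s + 6) ^ ((2 * i - 1) * l) / of_nat (s + 6) ^ (l\<^sup>2 + i * (i - 1)))" for s
    by (simp add: C_def point_scale_def beta_scale_def node_scale_def power_mult_distrib power_mult power_add del: of_nat_add)
  show ?thesis
  proof (cases "l = i \<or> Suc l = i")
    case True
    have "?f s = C" for s
      unfolding f square_exact[OF True] by (simp del: of_nat_add)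
    moreover have "C = chain_point (i, c) (3 * l + 1)"
    proof (cases "l = i")
      case True
      then obtain i' where "i = Suc i'" using assms(1) by (cases i) auto
      then show ?thesis using True assms(2) by (simp add: C_def chain_point_def)
    next
      case False
      then have "i = Suc l" using \<open>l = i \<or> Suc l = i\<close> by auto
      then show ?thesis using assms(2) by (simp add: C_def chain_point_def)
    qed
    ultimately show ?thesis by simp
  next
    case False
    then have "(\<lambda>s. of_nat (s + 6) ^ ((2 * i - 1) * l) / of_nat (s + 6) ^ (l\<^sup>2 + i * (i - 1)) :: complex) \<longlonglongrightarrow> 0"
      by (intro inverse_power_tendsto_0 square_gap) auto
    then have "(\<lambda>s. C * (of_nat (s + 6) ^ ((2 * i - 1) * l) / of_nat (s + 6) ^ (l\<^sup>2 + i * (i - 1)))) \<longlonglongrightarrow> C * 0"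
      by (intro tendsto_mult tendsto_const)
    moreover have "chain_point (i, c) (3 * l + 1) = 0" using False by (auto simp: chain_point_def)
    ultimately show ?thesis unfolding f by simp
  qed
qed

text \<open>Since \<open>c \<le> 5 < S\<close>, the nodes for line \<open>i\<close> lie below
  \<open>S ^ (2 * i)\<close>, hence below all nodes for later lines. This is why the scales are
  taken at \<open>s + 6\<close>.\<close>

lemma node_scale_inj:
  assumes "X \<subseteq> {1..k} \<times> {1..5}" "S \<ge> 6"
  shows "inj_on (node_scale (of_nat S)) X"
proof (rule inj_onI)
  fix x y assume x: "x \<in> X" and y: "y \<in> X" and eq: "node_scale (of_nat S) x = node_scale (of_nat S) y"
  obtain i c j d where xy: "x = (i, c)" "y = (j, d)" by (cases x, cases y) auto
  have b: "1 \<le> i" "1 \<le> c" "c \<le> 5" "1 \<le> j" "1 \<le> d" "d \<le> 5" using x y assms(1) xy by auto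
  have "(of_nat (c * S ^ (2 * i - 1)) :: complex) = of_nat (d * S ^ (2 * j - 1))"
    using eq by (simp add: node_scale_def xy)
  then have e: "c * S ^ (2 * i - 1) = d * S ^ (2 * j - 1)" by (simp only: of_nat_eq_iff)
  have lt: "c * S ^ (2 * i - 1) < d * S ^ (2 * j - 1)" if "i < j" "c \<le> 5" "1 \<le> d" for i j c d :: nat
  proof -
    have "c * S ^ (2 * i - 1) < S * S ^ (2 * i - 1)" using that assms(2) by (intro mult_strict_right_mono) auto
    also have "\<dots> = S ^ Suc (2 * i - 1)" by simp
    also have "\<dots> \<le> S ^ (2 * j - 1)" using that assms(2) by (intro power_increasing) auto
    also have "\<dots> \<le> d * S ^ (2 * j - 1)" using that by simp
    finally show ?thesis .
  qed
  have "i = j" using lt[of i j c d] lt[of j i d c] b e by (cases i j rule: linorder_cases) auto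
  then have "c = d" using e assms(2) by simp
  then show "x = y" using \<open>i = j\<close> xy by simp
qed

text \<open>Among pairs with a given sum \<open>i + j\<close>, the quantity
  \<open>i\<^sup>2 + j\<^sup>2\<close> is smallest for the most balanced ones. Those are the pairs
  of the cubic; all others acquire a negative power of the scale.\<close>

lemma alpha_beta_limit:
  assumes a: "a mod 3 \<noteq> 1"
  shows "(\<lambda>s. if aindex a = i + j then alpha_scale (of_nat (s + 6)) a * beta_scale (of_nat (s + 6)) i *
      beta_scale (of_nat (s + 6)) j else 0) \<longlonglongrightarrow>
    (if i = j \<and> a = 3*i then 2 else if (j = Suc i \<and> a = 3*i+2) \<or> (i = Suc j \<and> a = 3*j+2) then 1 else 0)"
    (is "?f \<longlonglongrightarrow> ?R i j")
proof (cases "aindex a = i + j")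
  case False
  have "(3*i+2) div 3 = i" "(3*i+2) mod 3 = 2" for i :: nat by presburger+
  then have "?R i j = 0" using False by (auto simp: aindex_def)
  then show ?thesis using False by simp
next
  case True
  have sym: "?R i j = ?R j i" by auto
  define l where "l = a div 3"
  show ?thesis
  proof (cases "a mod 3 = 2")
    case odd: True
    have ij: "i + j = 2 * l + 1" using True odd by (simp add: aindex_def l_def)
    have al: "a = 3 * l + 2" using odd unfolding l_def by presburger
    have f: "?f s = of_nat (s + 6) ^ (l\<^sup>2 + (Suc l)\<^sup>2) / of_nat (s + 6) ^ (i\<^sup>2 + j\<^sup>2)" for s
      using True odd by (simp add: alpha_scale_def beta_scale_def power_add l_def del: of_nat_add)
    show ?thesis
    proof (cases "i = l \<or> j = l")
      case True
      then have ij': "i = l \<and> j = Suc l \<or> j = l \<and> i = Suc l" using ij by auto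
      have eq: "(of_nat (s + 6) :: complex) ^ (l\<^sup>2 + (Suc l)\<^sup>2) / of_nat (s + 6) ^ (i\<^sup>2 + j\<^sup>2) = 1" for s
        using ij' by (elim disjE) (simp_all add: add.commute del: of_nat_add power_Suc)
      have R: "?R i j = 1" using ij' al by auto
      show ?thesis unfolding f R eq by (rule tendsto_const)
    next
      case False
      have gap: "l\<^sup>2 + (Suc l)\<^sup>2 < i\<^sup>2 + j\<^sup>2" if "i < l" "i + j = 2 * l + 1" for i j
      proof -
        obtain d where "l = i + Suc d" using \<open>i < l\<close> by (metis add_Suc_right less_imp_Suc_add)
        moreover from this have "j = i + 2 * Suc d + 1" using that by simp
        ultimately show ?thesis by (simp add: power2_eq_square algebra_simps)
      qed
      have "i < l \<or> j < l" using ij False by linarith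
      then have "l\<^sup>2 + (Suc l)\<^sup>2 < i\<^sup>2 + j\<^sup>2"
        using gap[of i j] gap[of j i] ij by (auto simp: add.commute)
      then have "?f \<longlonglongrightarrow> 0" unfolding f by (rule inverse_power_tendsto_0)
      moreover have "?R i j = 0" using False al by auto
      ultimately show ?thesis by simp
    qed
  next
    case even: False
    have ij: "i + j = 2 * l" using True even by (simp add: aindex_def l_def)
    have al: "a = 3 * l" using even a unfolding l_def by presburger
    have f: "?f s = 2 * (of_nat (s + 6) ^ (2 * l\<^sup>2) / of_nat (s + 6) ^ (i\<^sup>2 + j\<^sup>2))" for s
      using True even by (simp add: alpha_scale_def beta_scale_def power_add l_def del: of_nat_add)
    show ?thesis
    proof (cases "i = l")
      case True
      then have "j = l" using ij by auto
      have eq: "2 * ((of_nat (s + 6) :: complex) ^ (2 * l\<^sup>2) / of_nat (s + 6) ^ (i\<^sup>2 + j\<^sup>2)) = 2" for s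
        using True \<open>j = l\<close> by (simp add: mult_2 del: of_nat_add)
      have R: "?R i j = 2" using True \<open>j = l\<close> al by auto
      show ?thesis unfolding f R eq by (rule tendsto_const)
    next
      case False
      have gap: "2 * l\<^sup>2 < i\<^sup>2 + j\<^sup>2" if "i < l" "i + j = 2 * l" for i j
      proof -
        obtain d where "l = i + Suc d" using \<open>i < l\<close> by (metis add_Suc_right less_imp_Suc_add)
        moreover from this have "j = i + 2 * Suc d" using that by simp
        ultimately show ?thesis by (simp add: power2_eq_square algebra_simps)
      qed
      have "i < l \<or> j < l" using ij False by linarith
      then have "2 * l\<^sup>2 < i\<^sup>2 + j\<^sup>2"
        using gap[of i j] gap[of j i] ij by (auto simp: add.commute)
      then have "?f \<longlonglongrightarrow> 2 * 0" unfolding f by (intro tendsto_mult tendsto_const inverse_power_tendsto_0)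
      moreover have "?R i j = 0" using False al ij by auto
      ultimately show ?thesis by simp
    qed
  qed
qed

text \<open>Sorts cubic monomials by their number of \<open>b\<close> factors: three, two, or at
  most one. In the last case the third index is unrestricted.\<close>

lemma cubic_kinds:
  assumes "mon_degree m = 3" "Poly_Mapping.keys m \<subseteq> {..3 * k + 1}"
  obtains
    (bbb) i j l where "i \<le> k" "j \<le> k" "l \<le> k" "m = tri (3*i+1) (3*j+1) (3*l+1)"
  | (abb) a i j where "a \<le> 3*k+1" "a mod 3 \<noteq> 1" "i \<le> k" "j \<le> k" "m = tri a (3*i+1) (3*j+1)"
  | (aa) a a' v where "a \<le> 3*k+1" "a' \<le> 3*k+1" "v \<le> 3*k+1" "a mod 3 \<noteq> 1" "a' mod 3 \<noteq> 1" "m = tri a a' v"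
proof -
  obtain u v w where uvw: "u \<le> 3*k+1" "v \<le> 3*k+1" "w \<le> 3*k+1" "m = tri u v w"
    by (rule cubic_monomial[OF assms]) (rule that)
  have b: "\<exists>i\<le>k. v = 3*i+1" if "v \<le> 3*k+1" "v mod 3 = 1" for v
  proof (intro exI conjI)
    show "v = 3 * (v div 3) + 1" using that(2) by presburger
    then show "v div 3 \<le> k" using that(1) by linarith
  qed
  have abb': thesis if "a mod 3 \<noteq> 1" "x mod 3 = 1" "y mod 3 = 1" "a \<le> 3*k+1" "x \<le> 3*k+1" "y \<le> 3*k+1" "m = tri a x y" for a x y
    using b[OF that(5,2)] b[OF that(6,3)] abb[of a] that by blast
  show thesis
  proof (cases "u mod 3 = 1")
    case u: True
    show thesis
    proof (cases "v mod 3 = 1")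
      case v: True
      show thesis
      proof (cases "w mod 3 = 1")
        case True
        then show thesis using b[OF uvw(1) u] b[OF uvw(2) v] b[OF uvw(3)] bbb uvw(4) by blast
      next
        case False
        have "m = tri w u v" using uvw(4) tri_commute by metis
        then show thesis using abb'[of w u v] uvw u v False by blast
      qed
    next
      case v: False
      show thesis
      proof (cases "w mod 3 = 1")
        case True
        have "m = tri v u w" using uvw(4) tri_commute by metis
        then show thesis using abb'[of v u w] uvw u v True by blast
      next
        case False
        have "m = tri v w u" using uvw(4) tri_commute by metis
        then show thesis using aa[of v w u] uvw v False by blast
      qed
    qed
  next
    case u: False
    show thesis
    proof (cases "v mod 3 = 1")
      case v: True
      show thesis
      proof (cases "w mod 3 = 1")
        case True
        then show thesis using abb'[of u v w] uvw u v by blast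
      next
        case False
        have "m = tri u w v" using uvw(4) tri_commute by metis
        then show thesis using aa[of u w v] uvw u False by blast
      qed
    next
      case False
      then show thesis using aa[of u v w] uvw u by blast
    qed
  qed
qed

text \<open>Apply \<open>configuration\<close> with the scales at \<open>s + 6\<close> and tolerance
  \<open>1 / (s + 1)\<close>, and let \<open>s\<close> grow. One sequence of configurations thus
  performs both limits, the first-order motion towards the curve and the degeneration of the curve
  to the chain.\<close>

theorem chain_points_in_border_VSP:
  assumes X: "X \<subseteq> {1..k} \<times> {1..5}" "card X = 3 * k + 2" and n: "n = 3 * k + 1"
  obtains J where "J \<in> border_VSP n (F_form k) (n + 1)"
    "\<And>p e x. p \<in> graded_part J e \<Longrightarrow> x \<in> X \<Longrightarrow> peval (chain_point x) p = 0"
proof -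
  have fX: "finite X" using X(1) by (rule finite_subset) simp
  have X0: "X \<noteq> {}" using X(2) by auto
  define S :: "nat \<Rightarrow> complex" where "S s = of_nat (s + 6)" for s
  have S0: "S s \<noteq> 0" for s by (simp add: S_def del: of_nat_add)
  define Q where "Q s P c L \<longleftrightarrow>
    (\<forall>x\<in>X. \<forall>i>n. P x i = 0) \<and>
    (\<forall>x\<in>X. L x \<in> T n 1 \<and> (\<forall>y\<in>X. peval (P y) (L x) = (if x = y then 1 else 0))) \<and>
    (\<forall>x\<in>X. \<forall>l\<le>k. P x (3*l+1) = point_scale (S s) x * beta_scale (S s) l * node_scale (S s) x ^ l) \<and>
    (\<forall>x\<in>X. \<forall>a\<le>n. a mod 3 \<noteq> 1 \<longrightarrow> norm (P x a) \<le> inverse (Suc s)) \<and>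
    (\<forall>i\<le>k. \<forall>j\<le>k. \<forall>l\<le>k. (\<Sum>x\<in>X. c x * mval (P x) (tri (3*i+1) (3*j+1) (3*l+1))) = 0) \<and>
    (\<forall>a\<le>n. \<forall>i\<le>k. \<forall>j\<le>k. a mod 3 \<noteq> 1 \<longrightarrow> (\<Sum>x\<in>X. c x * mval (P x) (tri a (3*i+1) (3*j+1))) =
       (if aindex a = i + j then alpha_scale (S s) a * beta_scale (S s) i * beta_scale (S s) j else 0)) \<and>
    (\<forall>a\<le>n. \<forall>a'\<le>n. \<forall>v\<le>n. a mod 3 \<noteq> 1 \<longrightarrow> a' mod 3 \<noteq> 1 \<longrightarrow>
       norm (\<Sum>x\<in>X. c x * mval (P x) (tri a a' v)) \<le> inverse (Suc s))" for s :: nat and P c L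
  have "\<exists>P c L. Q s P c L" for s
    unfolding Q_def
  proof (rule configuration[OF fX X(2) _ n])
    show "inj_on (node_scale (S s)) X" unfolding S_def by (rule node_scale_inj[OF X(1)]) simp
    show "beta_scale (S s) l \<noteq> 0" "alpha_scale (S s) v \<noteq> 0" for l v
      using S0 by (simp_all add: beta_scale_def alpha_scale_def)
    show "point_scale (S s) x \<noteq> 0" if "x \<in> X" for x
      using S0 that X(1) by (auto simp: point_scale_def)
  qed simp
  then obtain P c L where Q: "\<And>s. Q s (P s) (c s) (L s)" by metis
  note q = Q[unfolded Q_def]
  note q1 = q[THEN conjunct1, rule_format]
  note q2 = bspec[OF q[THEN conjunct2, THEN conjunct1]]
  note q3 = q[THEN conjunct2, THEN conjunct2, THEN conjunct1, rule_format]
  note q4 = q[THEN conjunct2, THEN conjunct2, THEN conjunct2, THEN conjunct1, rule_format]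
  note q5 = q[THEN conjunct2, THEN conjunct2, THEN conjunct2, THEN conjunct2, THEN conjunct1, rule_format]
  note q6 = q[THEN conjunct2, THEN conjunct2, THEN conjunct2, THEN conjunct2, THEN conjunct2, THEN conjunct1, rule_format]
  note q7 = q[THEN conjunct2, THEN conjunct2, THEN conjunct2, THEN conjunct2, THEN conjunct2, THEN conjunct2, rule_format]
  have conf:
    "\<And>s x i. x \<in> X \<Longrightarrow> i > n \<Longrightarrow> P s x i = 0"
    "\<And>s x. x \<in> X \<Longrightarrow> L s x \<in> T n 1"
    "\<And>s x y. x \<in> X \<Longrightarrow> y \<in> X \<Longrightarrow> peval (P s y) (L s x) = (if x = y then 1 else 0)"
    "\<And>s x l. x \<in> X \<Longrightarrow> l \<le> k \<Longrightarrow> P s x (3*l+1) = point_scale (S s) x * beta_scale (S s) l * node_scale (S s) x ^ l"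
    "\<And>s x a. x \<in> X \<Longrightarrow> a \<le> n \<Longrightarrow> a mod 3 \<noteq> 1 \<Longrightarrow> norm (P s x a) \<le> inverse (Suc s)"
    "\<And>s i j l. i \<le> k \<Longrightarrow> j \<le> k \<Longrightarrow> l \<le> k \<Longrightarrow> (\<Sum>x\<in>X. c s x * mval (P s x) (tri (3*i+1) (3*j+1) (3*l+1))) = 0"
    "\<And>s a i j. a \<le> n \<Longrightarrow> i \<le> k \<Longrightarrow> j \<le> k \<Longrightarrow> a mod 3 \<noteq> 1 \<Longrightarrow> (\<Sum>x\<in>X. c s x * mval (P s x) (tri a (3*i+1) (3*j+1))) =
       (if aindex a = i + j then alpha_scale (S s) a * beta_scale (S s) i * beta_scale (S s) j else 0)"
    "\<And>s a a' v. a \<le> n \<Longrightarrow> a' \<le> n \<Longrightarrow> v \<le> n \<Longrightarrow> a mod 3 \<noteq> 1 \<Longrightarrow> a' mod 3 \<noteq> 1 \<Longrightarrow>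
       norm (\<Sum>x\<in>X. c s x * mval (P s x) (tri a a' v)) \<le> inverse (Suc s)"
    by ((rule q1 q2[THEN conjunct1] q2[THEN conjunct2, rule_format] q3 q4 q5 q6 q7; assumption)+)
  have small: "f \<longlonglongrightarrow> 0" if "\<And>s. norm (f s) \<le> inverse (Suc s)" for f :: "nat \<Rightarrow> complex"
    by (rule Lim_null_comparison[OF _ LIMSEQ_inverse_real_of_nat]) (use that in simp)
  have V: "(\<lambda>s. P s x v) \<longlonglongrightarrow> chain_point x v" if x: "x \<in> X" for x v
  proof -
    obtain i c where ic: "x = (i, c)" by (cases x)
    have b: "1 \<le> i" "i \<le> k" "1 \<le> c" using x X(1) ic by auto
    \<comment> \<open>The \<open>b\<close> coordinates converge by the choice of scales; the others
      tend to 0 with the tolerance, or are 0 beyond \<open>n\<close>.\<close>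
    consider "v > n" | "v \<le> n" "v mod 3 \<noteq> 1" | "v \<le> n" "v mod 3 = 1" by linarith
    then show ?thesis
    proof cases
      case 1
      then show ?thesis using conf(1)[OF x 1] b n by (simp add: ic chain_point_def)
    next
      case 2
      then have "v \<noteq> 3 * i + 1" "v + 2 \<noteq> 3 * i" by presburger+
      then show ?thesis using small[of "\<lambda>s. P s x v", OF conf(5)[OF x 2]] by (simp add: ic chain_point_def)
    next
      case 3
      define l where "l = v div 3"
      have v: "v = 3 * l + 1" using 3(2) unfolding l_def by presburger
      then have "l \<le> k" using 3(1) n by simp
      show ?thesis unfolding v conf(4)[OF x \<open>l \<le> k\<close>] unfolding ic S_def by (rule chain_limit[OF b(1,3)])
    qed
  qed
  have M: "(\<lambda>s. \<Sum>x\<in>X. c s x * mval (P s x) m) \<longlonglongrightarrow> mfact m * lk (F_form k) m"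
    if m: "mon_degree m = 3" "Poly_Mapping.keys m \<subseteq> {..n}" for m
  \<comment> \<open>Three \<open>b\<close> factors: both sides vanish. Two: the prescribed values
    converge to the derivatives of the cubic. At most one: the cubic has no such monomial and the
    sums are within the tolerance.\<close>
  proof (rule cubic_kinds[OF m[unfolded n]])
    fix i j l assume "i \<le> k" "j \<le> k" "l \<le> k" and m: "m = tri (3*i+1) (3*j+1) (3*l+1)"
    moreover have "(3*i+1) mod 3 = 1" for i :: nat by presburger
    then have "bcount m = 3" unfolding m bcount_tri by simp
    then have "lk (F_form k) m = 0" using F_form_bcount[of k m] by fastforce
    ultimately show ?thesis using conf(6) by simp
  next
    fix a i j assume h: "a \<le> 3*k+1" "a mod 3 \<noteq> 1" "i \<le> k" "j \<le> k" and m: "m = tri a (3*i+1) (3*j+1)"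
    show ?thesis
      unfolding m apolar_F_form_tri[OF h(3,4,2)] conf(7)[OF h(1)[folded n] h(3,4,2)] S_def
      by (rule alpha_beta_limit[OF h(2)])
  next
    fix a a' v assume h: "a \<le> 3*k+1" "a' \<le> 3*k+1" "v \<le> 3*k+1" "a mod 3 \<noteq> 1" "a' mod 3 \<noteq> 1" and m: "m = tri a a' v"
    have "bcount m \<noteq> 2" unfolding m bcount_tri using h by simp
    then have "lk (F_form k) m = 0" using F_form_bcount[of k m] by blast
    then show ?thesis
      using small[of "\<lambda>s. \<Sum>x\<in>X. c s x * mval (P s x) (tri a a' v)", OF conf(8)[OF h(1-3)[folded n] h(4,5)]] m by simp
  qed
  show ?thesis
  proof (rule lim_ideal_Slip_Ann[OF fX _ X0 conf(1-3) V _ M])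
    show "card X = n + 1" using X(2) n by simp
    show "mon_degree m = 3 \<and> Poly_Mapping.keys m \<subseteq> {..n}" if "lk (F_form k) m \<noteq> 0" for m
      using F_form_degree[OF that] n by simp
  qed (use that in blast)+
qed

subsection \<open>Reducibility\<close>

lemma power_sum_zero:
  fixes g :: "nat \<Rightarrow> complex"
  assumes "finite E" "\<And>b. b \<in> E \<Longrightarrow> b < card C" "finite C"
    and "\<And>c. c \<in> C \<Longrightarrow> (\<Sum>b\<in>E. g b * of_nat c ^ b) = 0" and b: "b \<in> E"
  shows "g b = 0"
proof -
  define f where "f = (\<Sum>b\<in>E. Polynomial.monom (g b) b)"
  have cf: "Polynomial.coeff f i = (if i \<in> E then g i else 0)" for i
    using assms(1) by (simp add: f_def coeff_sum)
  have card: "card ((of_nat :: nat \<Rightarrow> complex) ` C) = card C" by (rule card_image) (simp add: inj_on_def)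
  have "card C > 0" using assms(2)[OF b] by simp
  have "Polynomial.degree f \<le> card C - 1"
  proof (rule degree_le, intro allI impI)
    fix i assume "card C - 1 < i"
    then have "i \<notin> E" using assms(2)[of i] by linarith
    then show "Polynomial.coeff f i = 0" by (simp add: cf)
  qed
  then have d: "Polynomial.degree f < card C" using \<open>card C > 0\<close> by simp
  have "f = 0"
  proof (rule poly_eqI_degree)
    show "card ((of_nat :: nat \<Rightarrow> complex) ` C) > Polynomial.degree f"
      "card ((of_nat :: nat \<Rightarrow> complex) ` C) > Polynomial.degree (0 :: complex poly)"
      using d card \<open>card C > 0\<close> by simp_all
    show "poly f x = poly 0 x" if "x \<in> of_nat ` C" for x
      using that assms(4) by (auto simp: f_def poly_sum poly_monom)
  qed
  then show ?thesis using cf[of b] b by simp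
qed

section \<open>Monomials on the lines of the chain and their values at chain points\<close>

definition line_mon :: "nat \<Rightarrow> nat \<Rightarrow> nat \<Rightarrow> nat \<Rightarrow>\<^sub>0 nat" where
  "line_mon i a b = sg (3 * i - 2) a + sg (3 * i + 1) b"

lemma line_mon_T:
  assumes "1 \<le> i" "i \<le> k" "n = 3 * k + 1" "a + b = e"
  shows "sg (line_mon i a b) c \<in> T n e"
proof -
  have "Poly_Mapping.keys (line_mon i a b) \<subseteq> {3 * i - 2, 3 * i + 1}"
    unfolding line_mon_def using Poly_Mapping.keys_add[of "sg (3 * i - 2) a" "sg (3 * i + 1) b"] by (auto split: if_splits)
  moreover have "mon_degree (line_mon i a b) = e" using assms(4) by (simp add: line_mon_def mon_degree_add)
  ultimately show ?thesis using assms(2,3) by (auto simp: graded_part_def polys_def)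
qed

lemma mval_line_mon: "mval v (line_mon i a b) = v (3 * i - 2) ^ a * v (3 * i + 1) ^ b"
  by (simp add: line_mon_def mval_add)

lemma mval_line_mon_same: "i \<ge> 1 \<Longrightarrow> mval (chain_point (i, c)) (line_mon i a b) = of_nat c ^ b"
  by (simp add: mval_line_mon chain_point_def)

text \<open>A pair \<open>(i, b)\<close> serves twice: as the monomial of degree 4 in the two
  variables of line \<open>i\<close> with exponent \<open>b\<close> at the later one, and as the
  chain point with parameter \<open>b\<close>. Exponent 0 is left out, and exponent 4 occurs only on
  the last line, because pure powers at an interior node do not vanish on the neighbouring
  line.\<close>

definition inner_index :: "nat \<Rightarrow> (nat \<times> nat) set" where
  "inner_index k = insert (k, 4) ({2..k} \<times> {1..3})"

text \<open>On the next line the variable of the earlier node vanishes, and its exponent is positive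
  since line \<open>i\<close> is not the last; on all other lines the variable of the later node
  vanishes and \<open>b \<ge> 1\<close>.\<close>

lemma mval_line_mon_other:
  assumes "(i, b) \<in> inner_index k" "i \<noteq> j" "j \<le> k"
  shows "mval (chain_point (j, c)) (line_mon i (4 - b) b) = 0"
proof (cases "Suc i = j")
  case True
  then have "b \<le> 3" "i \<ge> 2" using assms by (auto simp: inner_index_def)
  moreover have "chain_point (j, c) (3 * i - 2) = 0"
    using True \<open>i \<ge> 2\<close> by (auto simp: chain_point_def)
  ultimately show ?thesis by (simp add: mval_line_mon)
next
  case False
  have "b \<ge> 1" using assms by (auto simp: inner_index_def)
  moreover have "chain_point (j, c) (3 * i + 1) = 0"
    using False assms(2) by (auto simp: chain_point_def)
  ultimately show ?thesis by (simp add: mval_line_mon)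
qed

text \<open>Values at chain points tell the monomials apart: parameter 1 detects the line, parameter
  2 the exponent.\<close>

lemma inj_on_inner:
  assumes "k \<ge> 2"
  shows "inj_on (\<lambda>(i, b). line_mon i (4 - b) b) (inner_index k)"
proof (rule inj_onI, clarify)
  fix i b j d
  assume h: "(i, b) \<in> inner_index k" "(j, d) \<in> inner_index k" and eq: "line_mon i (4 - b) b = line_mon j (4 - d) d"
  have b: "1 \<le> i" "i \<le> k" "1 \<le> j" "j \<le> k" using h assms by (auto simp: inner_index_def)
  have "i = j"
  proof (rule ccontr)
    assume "i \<noteq> j"
    then have "mval (chain_point (j, 1)) (line_mon i (4 - b) b) = 0"
      using mval_line_mon_other[OF h(1)] b by simp
    then show False unfolding eq by (simp add: mval_line_mon_same[OF b(3)])
  qed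
  then have "(of_nat 2 :: complex) ^ b = of_nat 2 ^ d"
    using eq mval_line_mon_same[OF b(1), of 2] by metis
  then have "2 ^ b = (2 ^ d :: nat)" by (metis of_nat_eq_iff of_nat_power)
  then show "i = j \<and> b = d" using \<open>i = j\<close> by simp
qed

definition inner_mons :: "nat \<Rightarrow> (nat \<Rightarrow>\<^sub>0 nat) set" where
  "inner_mons k = (\<lambda>(i, b). line_mon i (4 - b) b) ` inner_index k"

text \<open>The exponent of \<open>\<beta>\<^sub>1\<close> stops at 4, so these are
  \<open>\<beta>\<^sub>0\<close> times the monomials of degree 4 in \<open>\<beta>\<^sub>0\<close>
  and \<open>\<beta>\<^sub>1\<close>.\<close>

definition end_mons :: "(nat \<Rightarrow>\<^sub>0 nat) set" where
  "end_mons = (\<lambda>b. line_mon 1 (5 - b) b) ` {0..4}"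

lemma inj_on_end: "inj_on (\<lambda>b. line_mon 1 (5 - b) b) {0..4}"
proof (rule inj_onI)
  fix b d assume "line_mon 1 (5 - b) b = line_mon 1 (5 - d) d"
  then have "lk (line_mon 1 (5 - b) b) 4 = lk (line_mon 1 (5 - d) d) 4" by simp
  then show "b = d" by (simp add: line_mon_def lookup_add lookup_single when_def)
qed

text \<open>On line \<open>j\<close> only the monomials of that line survive, so \<open>p\<close>
  restricts to a polynomial in the parameter without constant term. Besides the prescribed zeros it
  has one at 0, which gives one zero more than the largest exponent.\<close>

lemma transversal_inner:
  assumes k: "k \<ge> 2" and p: "Poly_Mapping.keys p \<subseteq> inner_mons k"
    and z: "\<And>i c. (i, c) \<in> inner_index k \<Longrightarrow> peval (chain_point (i, c)) p = 0"
  shows "p = 0"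
proof -
  have fin: "finite (inner_index k)" by (simp add: inner_index_def)
  have z': "lk p (line_mon j (4 - b) b) = 0" if jb: "(j, b) \<in> inner_index k" for j b
  proof -
    have j: "2 \<le> j" "j \<le> k" using jb k by (auto simp: inner_index_def)
    define E where "E = {b. (j, b) \<in> inner_index k}"
    define C where "C = insert 0 E"
    have E: "E = (if j = k then {1..4} else {1..3})"
      using j by (auto simp: E_def inner_index_def)
    have ev: "peval (chain_point (j, c)) p = (\<Sum>b\<in>E. lk p (line_mon j (4 - b) b) * of_nat c ^ b)" for c
    proof -
      have "peval (chain_point (j, c)) p =
        (\<Sum>(i, b)\<in>inner_index k. lk p (line_mon i (4 - b) b) * mval (chain_point (j, c)) (line_mon i (4 - b) b))"
      proof -
        have "peval (chain_point (j, c)) p = (\<Sum>m\<in>inner_mons k. lk p m * mval (chain_point (j, c)) m)"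
          using p fin by (intro peval_superset) (simp_all add: inner_mons_def)
        then show ?thesis
          unfolding inner_mons_def sum.reindex[OF inj_on_inner[OF k]] by (simp add: case_prod_unfold comp_def)
      qed
      also have "\<dots> = (\<Sum>(i, b)\<in>{j} \<times> E. lk p (line_mon i (4 - b) b) * mval (chain_point (j, c)) (line_mon i (4 - b) b))"
      proof (rule sum.mono_neutral_right)
        show "\<forall>x\<in>inner_index k - {j} \<times> E. (case x of (i, b) \<Rightarrow>
          lk p (line_mon i (4 - b) b) * mval (chain_point (j, c)) (line_mon i (4 - b) b)) = 0"
        proof
          fix x assume x: "x \<in> inner_index k - {j} \<times> E"
          obtain i b where ib: "x = (i, b)" by (cases x)
          have "mval (chain_point (j, c)) (line_mon i (4 - b) b) = 0"
            by (rule mval_line_mon_other[OF _ _ j(2)]) (use x ib in \<open>auto simp: E_def\<close>)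
          then show "(case x of (i, b) \<Rightarrow>
            lk p (line_mon i (4 - b) b) * mval (chain_point (j, c)) (line_mon i (4 - b) b)) = 0" by (simp add: ib)
        qed
      qed (use fin in \<open>auto simp: E_def\<close>)
      also have "\<dots> = (\<Sum>b\<in>E. lk p (line_mon j (4 - b) b) * of_nat c ^ b)"
        using mval_line_mon_same[of j c] j by (simp add: sum.cartesian_product[symmetric])
      finally show ?thesis .
    qed
    show ?thesis
    proof (rule power_sum_zero[where C = C and E = E and g = "\<lambda>b. lk p (line_mon j (4 - b) b)"])
      show "b \<in> E" using jb by (simp add: E_def)
      show "finite E" "finite C" by (simp_all add: C_def E)
      show "b < card C" if "b \<in> E" for b using that by (auto simp: C_def E split: if_splits)
      show "(\<Sum>b\<in>E. lk p (line_mon j (4 - b) b) * of_nat c ^ b) = 0" if c: "c \<in> C" for c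
      proof (cases "c = 0")
        case True
        have "b \<ge> 1" if "b \<in> E" for b using that by (auto simp: E split: if_splits)
        then show ?thesis using True by (intro sum.neutral) (auto simp: power_0_left)
      next
        case False
        then have "(j, c) \<in> inner_index k" using c by (simp add: C_def E_def)
        then show ?thesis using z ev by metis
      qed
    qed
  qed
  show ?thesis
  proof (rule poly_mapping_eqI)
    fix m
    show "lk p m = lk 0 m"
    proof (cases "m \<in> inner_mons k")
      case True
      then show ?thesis using z' by (auto simp: inner_mons_def)
    next
      case False
      then show ?thesis using p by (auto simp: in_keys_iff)
    qed
  qed
qed

text \<open>The restriction to the first line is a polynomial of degree at most 4 in the parameter
  with five zeros.\<close>

lemma transversal_end:
  assumes p: "Poly_Mapping.keys p \<subseteq> end_mons"
    and z: "\<And>c. c \<in> {1..5} \<Longrightarrow> peval (chain_point (1, c)) p = 0"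
  shows "p = 0"
proof -
  have ev: "peval (chain_point (1, c)) p = (\<Sum>b\<in>{0..4}. lk p (line_mon 1 (5 - b) b) * of_nat c ^ b)" for c
    using p by (subst peval_superset[of end_mons])
      (auto simp: end_mons_def sum.reindex[OF inj_on_end[unfolded One_nat_def]] mval_line_mon_same)
  have z': "lk p (line_mon 1 (5 - b) b) = 0" if "b \<in> {0..4}" for b
  proof (rule power_sum_zero[where C = "{1..5}" and E = "{0..4}" and g = "\<lambda>b. lk p (line_mon 1 (5 - b) b)"])
    show "(\<Sum>b\<in>{0..4}. lk p (line_mon 1 (5 - b) b) * of_nat c ^ b) = 0" if "c \<in> {1..5}" for c
      using z[OF that] unfolding ev .
  qed (use that in auto)
  show ?thesis
  proof (rule poly_mapping_eqI)
    fix m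
    show "lk p m = lk 0 m"
    proof (cases "m \<in> end_mons")
      case True
      then show ?thesis using z' unfolding end_mons_def by (elim imageE) simp
    next
      case False
      then show ?thesis using p by (auto simp: in_keys_iff)
    qed
  qed
qed

section \<open>Quadrics annihilating the cubic\<close>

definition hess_mon :: "nat \<Rightarrow> nat \<Rightarrow>\<^sub>0 nat" where
  "hess_mon v = (if v mod 3 = 0 then sg (v + 1) 1 + sg (v + 1) 1
     else if v mod 3 = 1 then sg (v - 1) 1 + sg v 1 else sg (v - 1) 1 + sg (v + 2) 1)"

lemma hess_mon_T:
  assumes "v \<le> n" "n = 3 * k + 1"
  shows "sg (hess_mon v) c \<in> T n 2"
proof -
  have b1: "v + 1 \<le> n" if "v mod 3 = 0"
  proof -
    have "v \<noteq> n" using that assms(2) by presburger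
    then show ?thesis using assms(1) by simp
  qed
  have b2: "v + 2 \<le> n" if "v mod 3 \<noteq> 0" "v mod 3 \<noteq> 1"
  proof -
    have "v \<noteq> n" "v + 1 \<noteq> n" using that assms(2) by presburger+
    then show ?thesis using assms(1) by simp
  qed
  have keys: "Poly_Mapping.keys (sg a 1 + sg b (1::nat)) \<subseteq> {..n}" if "a \<le> n" "b \<le> n" for a b :: nat
  proof -
    have "Poly_Mapping.keys (sg a (1::nat) + sg b 1) \<subseteq> Poly_Mapping.keys (sg a (1::nat)) \<union> Poly_Mapping.keys (sg b (1::nat))"
      by (rule Poly_Mapping.keys_add)
    also have "\<dots> \<subseteq> {..n}" using that by simp
    finally show ?thesis .
  qed
  have "Poly_Mapping.keys (hess_mon v) \<subseteq> {..n}"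
    using keys[OF b1 b1] keys[of "v - 1" v] keys[OF _ b2, of "v - 1"] assms(1)
    unfolding hess_mon_def by (cases "v mod 3 = 0"; cases "v mod 3 = 1") (simp_all only: if_True if_False simp_thms le_diff_conv trans_le_add1)
  moreover have "mon_degree (hess_mon v) = 2" by (auto simp: hess_mon_def mon_degree_add)
  ultimately show ?thesis by (auto simp: graded_part_def polys_def)
qed

text \<open>The monomial \<open>hess_mon v\<close> differentiates the cubic to a nonzero multiple of
  the variable \<open>v\<close>, which makes the cubic concise. After rewriting the product as a
  \<open>tri\<close>, either \<open>bcount\<close> differs from 2 or
  \<open>apolar_F_form_tri\<close> decides.\<close>

lemma hess_mon_dual:
  assumes "v \<le> 3 * k + 1" "w \<le> 3 * k + 1"
  shows "lk (F_form k) (sg w 1 + hess_mon v) \<noteq> 0 \<longleftrightarrow> w = v"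
proof -
  let ?F = "F_form k"
  have nb: "lk ?F m = 0" if "bcount m \<noteq> 2" for m using F_form_bcount[of k m] that by blast
  have ap: "lk ?F (tri a (3*i+1) (3*j+1)) \<noteq> 0 \<longleftrightarrow>
      (i = j \<and> a = 3*i) \<or> (j = Suc i \<and> a = 3*i+2) \<or> (i = Suc j \<and> a = 3*j+2)"
    if "i \<le> k" "j \<le> k" "a mod 3 \<noteq> 1" for a i j
    using apolar_F_form_tri[OF that] by (auto split: if_splits)
  define l where "l = v div 3"
  have m31: "(3*l+1) mod 3 = 1" "(3*l+4) mod 3 = 1" "(3*l) mod 3 = 0" for l :: nat by presburger+
  have "v = 3 * l + v mod 3" "v mod 3 = 0 \<or> v mod 3 = 1 \<or> v mod 3 = 2" by (simp add: l_def, presburger)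
  then consider "v = 3 * l" | "v = 3 * l + 1" | "v = 3 * l + 2" by linarith
  then show ?thesis
  proof cases
    case 1
    then have t: "sg w 1 + hess_mon v = tri w (3*l+1) (3*l+1)" by (simp add: hess_mon_def tri_def add.assoc)
    show ?thesis
    proof (cases "w mod 3 = 1")
      case True
      then have "w \<noteq> v" using 1 by auto
      moreover have "bcount (tri w (3*l+1) (3*l+1)) = 3" using True m31(1)[of l] by (simp add: bcount_tri)
      ultimately show ?thesis unfolding t using nb by simp
    next
      case False
      then show ?thesis unfolding t using ap[of l l w] 1 assms by auto
    qed
  next
    case 2
    have t: "sg w 1 + hess_mon v = tri (3*l) w (3*l+1)"
      using 2 m31(1)[of l] by (simp add: hess_mon_def tri_def algebra_simps)
    show ?thesis
    proof (cases "w mod 3 = 1")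
      case True
      define i where "i = w div 3"
      have w: "w = 3 * i + 1" using True unfolding i_def by presburger
      have "3 * l \<noteq> 3 * i + 2" "3 * l \<noteq> 3 * l + 2" by presburger+
      then show ?thesis unfolding t unfolding w using ap[of i l "3*l"] 2 assms w m31(3)[of l] by auto
    next
      case False
      then have "w \<noteq> v" using 2 m31(1)[of l] by auto
      moreover have "bcount (tri (3*l) w (3*l+1)) = 1" using False m31[of l] by (simp add: bcount_tri)
      ultimately show ?thesis unfolding t using nb by simp
    qed
  next
    case 3
    have m2: "(3*l+2) mod 3 = 2" by presburger
    have "hess_mon v = sg (3*l+1) 1 + sg (3*l+4) 1"
    proof -
      have v: "v mod 3 = 2" "v - 1 = 3*l+1" "v + 2 = 3*l+4" using 3 m2 by simp_all
      have "hess_mon v = sg (v - 1) 1 + sg (v + 2) 1" using v(1) by (simp add: hess_mon_def)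
      then show ?thesis by (simp only: v(2,3))
    qed
    then have t: "sg w 1 + hess_mon v = tri w (3*l+1) (3*Suc l+1)" by (simp add: tri_def algebra_simps)
    have lk: "l \<le> k" "Suc l \<le> k" using 3 assms by linarith+
    show ?thesis
    proof (cases "w mod 3 = 1")
      case True
      then have "w \<noteq> v" using 3 m2 by auto
      moreover have "(3 * Suc l + 1) mod 3 = 1" by presburger
      then have "bcount (tri w (3*l+1) (3*Suc l+1)) = 3" using True m31(1)[of l] by (simp add: bcount_tri)
      ultimately show ?thesis unfolding t using nb by simp
    next
      case False
      then show ?thesis unfolding t using ap[OF lk False] 3 by auto
    qed
  qed
qed

text \<open>As \<open>F\<close> is concise, \<open>Ann(F)\<^sub>2\<close> has codimension \<open>n + 1\<close>, so it is forced to equal \<open>J\<^sub>2\<close>.\<close>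

lemma Ann_quadrics:
  assumes n: "n = 3 * k + 1" and J: "J \<in> Hilb n (n + 1)" "J \<subseteq> Ann n (F_form k)"
    and q: "q \<in> T n 2" "q \<in> Ann n (F_form k)"
  shows "q \<in> J"
proof -
  let ?F = "F_form k"
  \<comment> \<open>Together with \<open>q\<close> these are \<open>n + 2\<close> quadrics, one more
    than can be independent modulo \<open>J\<close>.\<close>
  define u where "u v = (if v \<le> n then sg (hess_mon v) 1 else q)" for v
  have "u ` {..n + 1} \<subseteq> T n 2" using hess_mon_T[OF _ n] q(1) by (auto simp: u_def)
  then obtain c where c: "(\<Sum>v\<le>n + 1. cscale (c v) (u v)) \<in> graded_part J 2" "\<exists>v\<in>{..n + 1}. c v \<noteq> 0"
    using Hilb_relation[OF J(1), of "{..n + 1}" u 2] by auto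
  let ?g = "\<Sum>v\<le>n + 1. cscale (c v) (u v)"
  have gJ: "?g \<in> J" using c(1) by (simp add: graded_part_iff)
  have c0: "c w = 0" if w: "w \<le> n" for w
  proof -
    \<comment> \<open>Multiplying by the variable \<open>w\<close> and pairing with the cubic kills
      \<open>q\<close> and isolates the coefficient \<open>c w\<close>.\<close>
    have "0 = apolar ?F (sg (sg w 1) 1 * ?g)" using gJ J(2) by (auto simp: Ann_iff)
    also have "sg (sg w 1) 1 * ?g = (\<Sum>v\<le>n + 1. cscale (c v) (sg (sg w 1) 1 * u v))"
      unfolding sum_distrib_left cscale_def by (intro sum.cong refl mult.left_commute)
    also have "apolar ?F \<dots> = (\<Sum>v\<le>n + 1. c v * apolar ?F (sg (sg w 1) 1 * u v))"
      unfolding apolar_sum apolar_cscale ..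
    also have "\<dots> = (\<Sum>v\<le>n + 1. if v = w then c w * (mfact (sg w 1 + hess_mon w) * lk ?F (sg w 1 + hess_mon w)) else 0)"
    proof (rule sum.cong)
      fix v assume "v \<in> {..n + 1}"
      then consider "v = n + 1" | "v \<le> n" by (auto simp: le_Suc_eq)
      then show "c v * apolar ?F (sg (sg w 1) 1 * u v) =
        (if v = w then c w * (mfact (sg w 1 + hess_mon w) * lk ?F (sg w 1 + hess_mon w)) else 0)"
      proof cases
        case 1
        then show ?thesis using q(2) w by (simp add: u_def Ann_iff)
      next
        case 2
        then show ?thesis using hess_mon_dual[of v k w] w n by (auto simp: u_def mult_single)
      qed
    qed simp
    also have "\<dots> = c w * (mfact (sg w 1 + hess_mon w) * lk ?F (sg w 1 + hess_mon w))" using w by simp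
    finally show ?thesis using hess_mon_dual[of w k w] w n by simp
  qed
  then have cn: "c (n + 1) \<noteq> 0" using c(2) by (metis Suc_eq_plus1 atMost_iff le_SucE)
  have "?g = cscale (c (n + 1)) q" using c0 by (simp add: u_def)
  then have "cscale (inverse (c (n + 1))) ?g = q" using cn by simp
  then show ?thesis using HilbD(6)[OF J(1) gJ, of "inverse (c (n + 1))"] by simp
qed

text \<open>In the cubic \<open>b\<^sub>0\<close> meets only itself and \<open>b\<^sub>1\<close>
  among the \<open>b\<close> variables, so this product annihilates it.\<close>

lemma distant_product_in_J:
  assumes n: "n = 3 * k + 1" and J: "J \<in> Hilb n (n + 1)" "J \<subseteq> Ann n (F_form k)" and j: "2 \<le> j" "j \<le> k"
  shows "sg (sg 1 1 + sg (3 * j + 1) 1) 1 \<in> J"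
proof (rule Ann_quadrics[OF n J])
  let ?m = "sg (1::nat) (1::nat) + sg (3 * j + 1) 1"
  have "Poly_Mapping.keys ?m \<subseteq> {1, 3 * j + 1}"
    using Poly_Mapping.keys_add[of "sg (1::nat) (1::nat)" "sg (3 * j + 1) 1"] by auto
  then have kn: "Poly_Mapping.keys ?m \<subseteq> {..n}" using j n by auto
  then show T: "sg ?m 1 \<in> T n 2" by (auto simp: graded_part_def polys_def mon_degree_add)
  have "lk (F_form k) (a + ?m) = 0" for a
  proof (rule ccontr)
    assume nz: "lk (F_form k) (a + ?m) \<noteq> 0"
    then have "mon_degree (a + ?m) = 3" using F_form_degree by blast
    then have "mon_degree a = Suc 0" by (simp add: mon_degree_add)
    \<comment> \<open>The multiplier \<open>a\<close> may involve variables beyond \<open>n\<close>,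
      so its own largest variable serves as the bound.\<close>
    then obtain w m' where w: "a = m' + sg w 1" "mon_degree m' = 0"
      using split_monomial[of a 0 "Max (Poly_Mapping.keys a)"] by (metis (no_types, lifting) Max_ge atMost_iff finite_keys subsetI)
    have "lk m' i = 0" for i using w(2) by (auto simp: mon_degree_def in_keys_iff)
    then have "m' = 0" by (intro poly_mapping_eqI) simp
    then have t: "a + ?m = tri w (3*0+1) (3*j+1)" using w(1) by (simp add: tri_def algebra_simps)
    have "bcount (a + ?m) = 2" using F_form_bcount[OF nz] .
    moreover have "(3*j+1) mod 3 = 1" by presburger
    ultimately have "w mod 3 \<noteq> 1" unfolding t by (auto simp: bcount_tri)
    from apolar_F_form_tri[OF _ j(2) this, of 0] nz j(1) show False unfolding t by (auto split: if_splits)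
  qed
  then show "sg ?m 1 \<in> Ann n (F_form k)" using T by (simp add: Ann_iff graded_part_iff mult_single)
qed

lemma Hilb_sum: "J \<in> Hilb n r \<Longrightarrow> (\<And>x. x \<in> A \<Longrightarrow> f x \<in> J) \<Longrightarrow> sum f A \<in> J"
  by (induction A rule: infinite_finite_induct) (auto simp: HilbD(4,7))

text \<open>There are \<open>5 + (3 * k - 2) = n + 2\<close> quartic monomials in play, one more
  than can be independent modulo \<open>J\<close>, while the two conditions force every relation
  among them to be trivial.\<close>

lemma not_both_transversal:
  assumes n: "n = 3 * k + 1" "k \<ge> 2" and J: "J \<in> Hilb n (n + 1)" "J \<subseteq> Ann n (F_form k)"
    and inner: "\<And>p. p \<in> graded_part J 4 \<Longrightarrow> Poly_Mapping.keys p \<subseteq> inner_mons k \<Longrightarrow> p = 0"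
    and ends: "\<And>p. p \<in> graded_part J 5 \<Longrightarrow> Poly_Mapping.keys p \<subseteq> end_mons \<Longrightarrow> p = 0"
  shows False
proof -
  define u :: "nat \<times> nat \<Rightarrow> nat cpoly" where "u = (\<lambda>(i, b). sg (line_mon i (4 - b) b) 1)"
  define I where "I = {1::nat} \<times> {0..4} \<union> inner_index k"
  have disj: "({1::nat} \<times> {0..4}) \<inter> inner_index k = {}" using n(2) by (auto simp: inner_index_def)
  have fin: "finite (inner_index k)" by (simp add: inner_index_def)
  have "card (inner_index k) = Suc (3 * (k - 1))" unfolding inner_index_def by simp
  then have "card I = 5 + Suc (3 * (k - 1))" unfolding I_def using disj fin by (subst card_Un_disjoint) auto
  then have card: "card I > n + 1" using n by simp
  have uT: "u x \<in> T n 4" if "x \<in> I" for x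
  proof -
    obtain i b where x: "x = (i, b)" by (cases x)
    have "1 \<le> i" "i \<le> k" "b \<le> 4" using that n(2) by (auto simp: I_def inner_index_def x)
    then show ?thesis unfolding u_def x prod.case by (intro line_mon_T[OF _ _ n(1)]) auto
  qed
  obtain c where c: "(\<Sum>x\<in>I. cscale (c x) (u x)) \<in> graded_part J 4" "\<exists>x\<in>I. c x \<noteq> 0"
    by (rule Hilb_relation[OF J(1) _ card, of u 4]) (use uT fin in \<open>auto simp: I_def intro: that\<close>)
  let ?g = "\<Sum>x\<in>I. cscale (c x) (u x)"
  let ?g1 = "\<Sum>b\<in>{0..4}. cscale (c (1, b)) (u (1, b))"
  let ?g2 = "\<Sum>x\<in>inner_index k. cscale (c x) (u x)"
  have g: "?g = ?g1 + ?g2"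
  proof -
    have "(\<Sum>x\<in>{1::nat} \<times> {0..4}. cscale (c x) (u x)) = ?g1"
      by (simp add: sum.cartesian_product')
    then show ?thesis unfolding I_def using disj fin by (subst sum.union_disjoint) auto
  qed
  have gJ: "?g \<in> J" using c(1) by (simp add: graded_part_iff)
  let ?y = "sg (sg (1::nat) (1::nat)) (1::complex)"
  have y: "?y \<in> polys n" using n by (auto simp: polys_def)
  \<comment> \<open>For \<open>i \<ge> 2\<close> and \<open>b \<ge> 1\<close> the monomial is
    divisible by \<open>\<beta>\<^sub>i\<close>, so its product with \<open>\<beta>\<^sub>0\<close>
    is a multiple of the quadric \<open>\<beta>\<^sub>0\<beta>\<^sub>i\<close> in
    \<open>J\<close>.\<close>
  have yu: "?y * u x \<in> J" if "x \<in> inner_index k" for x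
  proof -
    obtain i b where x: "x = (i, b)" by (cases x)
    have ib: "2 \<le> i" "i \<le> k" "1 \<le> b" "b \<le> 4" using that n(2) by (auto simp: inner_index_def x)
    have "sg 1 1 + line_mon i (4 - b) b = line_mon i (4 - b) (b - 1) + (sg 1 1 + sg (3 * i + 1) 1)"
    proof -
      have "sg (3 * i + 1) b = sg (3 * i + 1) (b - 1) + sg (3 * i + 1) 1"
        using ib(3) by (simp flip: single_add)
      then show ?thesis by (simp add: line_mon_def algebra_simps)
    qed
    then have "?y * u x = sg (line_mon i (4 - b) (b - 1)) 1 * sg (sg 1 1 + sg (3 * i + 1) 1) 1"
      by (simp add: u_def x mult_single)
    moreover have "sg (line_mon i (4 - b) (b - 1)) (1::complex) \<in> polys n"
      using line_mon_T[of i k n "4 - b" "b - 1" "4 - b + (b - 1)" 1] ib n(1) by (simp add: graded_part_iff)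
    ultimately show ?thesis
      using HilbD(5)[OF J(1) distant_product_in_J[OF n(1) J ib(1,2)]] by simp
  qed
  \<comment> \<open>The product of \<open>\<beta>\<^sub>0\<close> with the part \<open>?g1\<close>
    on the first line. It agrees with \<open>?y * ?g\<close> modulo \<open>J\<close>, so it lies in
    \<open>J\<close> and the condition in degree 5 applies.\<close>
  define q where "q = (\<Sum>b\<in>{0..4}. sg (line_mon 1 (5 - b) b) (c (1, b)))"
  have "?y * ?g1 = q"
  proof -
    have "?y * cscale (c (1, b)) (u (1, b)) = sg (line_mon 1 (5 - b) b) (c (1, b))" if "b \<in> {0..4}" for b
    proof -
      have "sg 1 1 + line_mon 1 (4 - b) b = line_mon 1 (5 - b) b"
      proof -
        have "5 - b = 1 + (4 - b)" using that by auto
        then have "sg (1::nat) (5 - b) = sg 1 1 + sg 1 (4 - b)" by (simp only: single_add)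
        then show ?thesis by (simp add: line_mon_def algebra_simps)
      qed
      then show ?thesis by (simp add: cscale_def u_def mult_single)
    qed
    then show ?thesis unfolding q_def sum_distrib_left by (intro sum.cong) auto
  qed
  then have yq: "?y * ?g = q + (\<Sum>x\<in>inner_index k. cscale (c x) (?y * u x))"
    unfolding g distrib_left by (simp add: sum_distrib_left cscale_def mult.left_commute)
  have "(\<Sum>x\<in>inner_index k. cscale (- c x) (?y * u x)) \<in> J"
    by (intro Hilb_sum[OF J(1)] HilbD(6)[OF J(1)] yu)
  then have "?y * ?g + (\<Sum>x\<in>inner_index k. cscale (- c x) (?y * u x)) \<in> J"
    by (intro HilbD(4)[OF J(1)] HilbD(5)[OF J(1) gJ y])
  moreover have "?y * ?g + (\<Sum>x\<in>inner_index k. cscale (- c x) (?y * u x)) = q"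
    unfolding yq by (simp add: sum_negf)
  ultimately have qJ: "q \<in> J" by simp
  have qT: "q \<in> T n 5" unfolding q_def using n by (intro T_sum line_mon_T[OF _ _ n(1)]) auto
  have lq: "lk q (line_mon 1 (5 - b) b) = c (1, b)" if "b \<in> {0..4}" for b
  proof -
    have "lk q (line_mon 1 (5 - b) b) = (\<Sum>d\<in>{0..4}. if d = b then c (1, d) else 0)"
      unfolding q_def lookup_sum using inj_on_end that
      by (intro sum.cong) (auto simp: lookup_single when_def inj_on_def)
    then show ?thesis using that by simp
  qed
  have "Poly_Mapping.keys q \<subseteq> end_mons"
  proof
    fix m assume "m \<in> Poly_Mapping.keys q"
    then have "lk q m \<noteq> 0" by (simp add: in_keys_iff)
    then obtain b where "b \<in> {0..4}" "lk (sg (line_mon 1 (5 - b) b) (c (1, b))) m \<noteq> 0"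
      unfolding q_def lookup_sum by (meson sum.not_neutral_contains_not_neutral)
    then show "m \<in> end_mons"
      by (auto simp: lookup_single when_def end_mons_def split: if_splits)
  qed
  then have "q = 0" using ends[of q] qJ qT by (simp add: graded_part_iff)
  then have c1: "c (1, b) = 0" if "b \<in> {0..4}" for b using lq[OF that] by simp
  then have "?g1 = 0" by (intro sum.neutral) auto
  \<comment> \<open>With the first part gone, the relation is supported on the inner monomials, and
    the condition in degree 4 applies.\<close>
  then have g2: "?g = ?g2" using g by simp
  define m where "m = (\<lambda>(i, b). line_mon i (4 - b) b)"
  have um: "u x = sg (m x) 1" for x by (simp add: u_def m_def split: prod.split)
  have l2: "lk ?g2 (m x) = c x" if x: "x \<in> inner_index k" for x
  proof -
    have "lk ?g2 (m x) = (\<Sum>y\<in>inner_index k. if y = x then c y else 0)"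
      unfolding lookup_sum
    proof (rule sum.cong)
      fix y assume "y \<in> inner_index k"
      then have "m y = m x \<longleftrightarrow> y = x"
        using inj_on_eq_iff[OF inj_on_inner[OF n(2)]] x unfolding m_def by blast
      then show "lk (cscale (c y) (u y)) (m x) = (if y = x then c y else 0)"
        by (simp add: cscale_lookup um lookup_single when_def)
    qed simp
    then show ?thesis using x fin by simp
  qed
  have "Poly_Mapping.keys ?g2 \<subseteq> inner_mons k"
  proof
    fix a assume "a \<in> Poly_Mapping.keys ?g2"
    then have "lk ?g2 a \<noteq> 0" by (simp add: in_keys_iff)
    then obtain x where "x \<in> inner_index k" "lk (cscale (c x) (u x)) a \<noteq> 0"
      unfolding lookup_sum by (meson sum.not_neutral_contains_not_neutral)
    then show "a \<in> inner_mons k"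
      by (auto simp: cscale_lookup um m_def lookup_single when_def inner_mons_def split: if_splits)
  qed
  then have "?g2 = 0" using inner[of ?g2] c(1) unfolding g2 by blast
  then have c2: "c x = 0" if "x \<in> inner_index k" for x using l2[OF that] by simp
  from c(2) c1 c2 show False by (auto simp: I_def)
qed

theorem theorem7p9:
  fixes k n :: nat
  assumes "k \<ge> 1" and "n = 3 * k + 1" and "n \<ge> 10"
  shows "reducible_space (border_VSP_top n (F_form k) (n + 1))"
proof -
  have k: "k \<ge> 2" using assms by simp
  let ?V = "border_VSP n (F_form k) (n + 1)"
  let ?X = "border_VSP_top n (F_form k) (n + 1)"
  define UA where "UA = {J \<in> Hilb n (n + 1). \<forall>p\<in>graded_part J 4. Poly_Mapping.keys p \<subseteq> inner_mons k \<longrightarrow> p = 0}"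
  define UB where "UB = {J \<in> Hilb n (n + 1). \<forall>p\<in>graded_part J 5. Poly_Mapping.keys p \<subseteq> end_mons \<longrightarrow> p = 0}"
  have fin: "finite (inner_mons k)" "finite end_mons" by (simp_all add: inner_mons_def inner_index_def end_mons_def)
  have op: "openin (Hilb_top n (n + 1)) UA" "openin (Hilb_top n (n + 1)) UB"
    unfolding UA_def UB_def using openin_transversal fin by blast+
  have "Slip n (n + 1) \<subseteq> Hilb n (n + 1)"
    unfolding Slip_def using closure_of_subset_topspace[of "Hilb_top n (n + 1)"] by (simp add: topspace_Hilb)
  then have VH: "?V \<subseteq> Hilb n (n + 1)" by (auto simp: border_VSP_def)
  have top: "topspace ?X = ?V" using VH by (auto simp: border_VSP_top_def topspace_Hilb)
  have disj: "J \<notin> UB" if "J \<in> ?V" "J \<in> UA" for J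
  proof
    assume "J \<in> UB"
    moreover have "J \<subseteq> Ann n (F_form k)" using that(1) by (simp add: border_VSP_def)
    ultimately show False
      using not_both_transversal[OF assms(2) k] that(2) unfolding UA_def UB_def by blast
  qed
  \<comment> \<open>Three points on every line and two more: one on each end line for
    \<open>XA\<close>, both on the first line for \<open>XB\<close>. Each set has
    \<open>3 * k + 2\<close> points; \<open>XA\<close> contains the points that test the inner
    monomials, and \<open>XB\<close> has five points on the first line.\<close>
  define XA where "XA = {1..k} \<times> {1..3} \<union> {(1, 4), (k, 4 :: nat)}"
  define XB where "XB = {1..k} \<times> {1..3} \<union> {(1::nat, 4), (1, 5::nat)}"
  have XA: "XA \<subseteq> {1..k} \<times> {1..5}" "card XA = 3 * k + 2"
  proof -
    show "XA \<subseteq> {1..k} \<times> {1..5}" using k by (auto simp: XA_def)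
    have "card XA = card ({1..k} \<times> {1..3::nat}) + card {(1::nat, 4::nat), (k, 4)}"
      unfolding XA_def by (rule card_Un_disjoint) auto
    then show "card XA = 3 * k + 2" using k by simp
  qed
  have XB: "XB \<subseteq> {1..k} \<times> {1..5}" "card XB = 3 * k + 2"
  proof -
    show "XB \<subseteq> {1..k} \<times> {1..5}" using k by (auto simp: XB_def)
    have "card XB = card ({1..k} \<times> {1..3::nat}) + card {(1::nat, 4::nat), (1, 5)}"
      unfolding XB_def by (rule card_Un_disjoint) auto
    then show "card XB = 3 * k + 2" by simp
  qed
  obtain JA where JA: "JA \<in> ?V" "\<And>p e x. p \<in> graded_part JA e \<Longrightarrow> x \<in> XA \<Longrightarrow> peval (chain_point x) p = 0"
    by (rule chain_points_in_border_VSP[OF XA assms(2)]) (rule that)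
  obtain JB where JB: "JB \<in> ?V" "\<And>p e x. p \<in> graded_part JB e \<Longrightarrow> x \<in> XB \<Longrightarrow> peval (chain_point x) p = 0"
    by (rule chain_points_in_border_VSP[OF XB assms(2)]) (rule that)
  have "inner_index k \<subseteq> XA" by (auto simp: inner_index_def XA_def)
  then have JAU: "JA \<in> UA"
    unfolding UA_def using JA VH transversal_inner[OF k] by blast
  have "(1, c) \<in> XB" if "c \<in> {1..5}" for c
  proof -
    have "c \<in> {1..3} \<or> c = 4 \<or> c = 5" using that by auto
    then show ?thesis using k by (auto simp: XB_def)
  qed
  then have JBU: "JB \<in> UB"
    unfolding UB_def using JB VH transversal_end by blast
  have cl: "closedin ?X (?V - U)" if "openin (Hilb_top n (n + 1)) U" for U
  proof -
    have "openin ?X (?V \<inter> U)"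
      unfolding border_VSP_top_def using that by (auto simp: openin_subtopology)
    then have "closedin ?X (topspace ?X - (?V \<inter> U))" by (rule closedin_diff[OF closedin_topspace])
    moreover have "topspace ?X - (?V \<inter> U) = ?V - U" unfolding top by blast
    ultimately show ?thesis by simp
  qed
  \<comment> \<open>The closed sets are the complements of \<open>UA\<close> and \<open>UB\<close>.
    The ideals \<open>JA\<close> and \<open>JB\<close> make them proper, and disjointness of the two
    open sets on the border variety makes them cover it.\<close>
  show ?thesis
    unfolding reducible_space_def top
  proof (intro exI conjI)
    show "closedin ?X (?V - UA)" "closedin ?X (?V - UB)" using cl op by blast+
    show "?V - UA \<noteq> ?V" "?V - UB \<noteq> ?V" using JA(1) JAU JB(1) JBU by blast+
    show "(?V - UA) \<union> (?V - UB) = ?V" using disj by blast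
  qed
qed

end
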